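(* Assume (A1) and (A2). Let $M>0$, $W\in\dot W^{2,\infty}$ with $\|W\|_{W^{2,\infty}}<M$, and $K\ge1$. Then there exists $C=C(d,T,M,\beta,c_*,\phi_{\min},\|\phi\|_{H^\beta})>0$, independent of $K$, such that for every $H\in\dot E_K$, $$\|D\rho_W[H]\|_{L^2([0,T];L^2)}\ge C\,K^{-3\zeta}\|H\|_{L^2}.$$
   Context: $\mathbb T^d=\mathbb R^d/\mathbb Z^d$. For $s\in\mathbb R$, $H^s=H^s(\mathbb T^d)$ is the periodic Sobolev space with norm $\|u\|_{H^s}^2=\sum_{k\in\mathbb Z^d}(1+|k|^2)^s|\hat u_k|^2$, $\hat u_k=\langle u,e^{2\pi ik\cdot x}\rangle$; $W^{2,\infty}$ is the Sobolev space with derivatives up to order 2 in $L^\infty$; a dot denotes mean-zero subspace. $F_\beta:=L^2([0,T];H^{\beta+1})\cap H^1([0,T];H^{\beta-1})$. Assumption (A1): $\phi$ is a probability density on $\mathbb T^d$ with $\phi\in H^\beta$ for some even integer $\beta\ge3+d$. Assumption (A2): $\inf_x\phi(x)\ge\phi_{\min}>0$, and there are $c_*>0$ and $\zeta>\beta+d/2$ with $|\hat\phi_k|\ge c_*|k|^{-\zeta}$ for all $k\in\mathbb Z^d\setminus\{0\}$. For $W\in\dot W^{2,\infty}$, $\rho_W$ denotes the unique solution in $F_\beta$ of $\partial_t\rho=\Delta\rho+\nabla\cdot(\rho\nabla W*\rho)$, $\rho(0)=\phi$. $D\rho_W[H]$ is the Fréchet derivative of $W\mapsto\rho_W\in F_\beta$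 in direction $H$; equivalently the unique $v\in F_\beta$ with $\partial_tv-\Delta v-\nabla\cdot(v\nabla W*\rho_W)-\nabla\cdot(\rho_W\nabla W*v)=\nabla\cdot(\rho_W\nabla H*\rho_W)$, $v(0)=0$. $\dot E_K$ is the real span of $\{\tau_k:k\in\mathbb Z^d,0<|k|\le K\}$, with $\tau_k(x)=\prod_{j=1}^dT_{k_j}(x_j)$, $T_m(y)=\sqrt2\cos(2\pi my)$ ($m>0$), $T_0=1$, $T_m(y)=\sqrt2\sin(2\pi my)$ ($m<0$). *)

theory Defs
  imports "HOL-Analysis.Analysis"
begin

text \<open>Functions on the torus T^d are represented as 1-periodic functions on real^'d
  (d = CARD('d)); the fundamental domain is the unit cube cbox 0 1.\<close>

definition unit_cube :: "(real^'d) set" where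
  "unit_cube = cbox 0 1"

definition periodic1 :: "(real^'d \<Rightarrow> real) \<Rightarrow> bool" where
  "periodic1 f \<longleftrightarrow> (\<forall>x (m::int^'d). f (x + (\<chi> j. of_int (m$j))) = f x)"

definition kvec :: "int^'d \<Rightarrow> real^'d" where
  "kvec k = (\<chi> j. of_int (k$j))"

definition fc :: "(real^'d \<Rightarrow> real) \<Rightarrow> int^'d \<Rightarrow> complex" where
  "fc u k = (LINT x:unit_cube|lborel. complex_of_real (u x) * exp (- 2 * pi * \<i> * complex_of_real (kvec k \<bullet> x)))"

definition L2cube :: "(real^'d \<Rightarrow> real) \<Rightarrow> bool" where
  "L2cube u \<longleftrightarrow> u \<in> borel_measurable lborel \<and> set_integrable lborel unit_cube (\<lambda>x. (u x)^2)"

definition L2norm :: "(real^'d \<Rightarrow> real) \<Rightarrow> real" where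
  "L2norm u = sqrt (LINT x:unit_cube|lborel. (u x)^2)"

definition sob_weight :: "real \<Rightarrow> (real^'d \<Rightarrow> real) \<Rightarrow> int^'d \<Rightarrow> real" where
  "sob_weight s u k = (1 + (norm (kvec k))^2) powr s * (cmod (fc u k))^2"

definition sob_mem :: "real \<Rightarrow> (real^'d \<Rightarrow> real) \<Rightarrow> bool" where
  "sob_mem s u \<longleftrightarrow> L2cube u \<and> (sob_weight s u) summable_on UNIV"

definition sob_norm2 :: "real \<Rightarrow> (real^'d \<Rightarrow> real) \<Rightarrow> real" where
  "sob_norm2 s u = infsum (sob_weight s u) UNIV"

text \<open>The space F_beta = L^2([0,T];H^{beta+1}) \<inter> H^1([0,T];H^{beta-1}); the time derivative
  u' is an L^2([0,T];H^{beta-1}) function with u(t) = u(0) + \<integral>_0^t u'(s) ds in H^{beta-1},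
  the identity being tested against every Fourier mode.\<close>
definition in_F :: "real \<Rightarrow> nat \<Rightarrow> (real \<Rightarrow> real^'d \<Rightarrow> real) \<Rightarrow> bool" where
  "in_F T beta u \<longleftrightarrow>
     (\<forall>t\<in>{0..T}. periodic1 (u t) \<and> L2cube (u t)) \<and>
     (\<forall>k. set_borel_measurable lborel {0..T} (\<lambda>t. fc (u t) k)) \<and>
     (AE t in lborel. t \<in> {0..T} \<longrightarrow> sob_mem (real beta + 1) (u t)) \<and>
     set_integrable lborel {0..T} (\<lambda>t. sob_norm2 (real beta + 1) (u t)) \<and>
     (\<exists>u'. (\<forall>t\<in>{0..T}. L2cube (u' t)) \<and>
           (\<forall>k. set_integrable lborel {0..T} (\<lambda>t. fc (u' t) k)) \<and>
           (AE t in lborel. t \<in> {0..T} \<longrightarrow> sob_mem (real beta - 1) (u' t)) \<and>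
           set_integrable lborel {0..T} (\<lambda>t. sob_norm2 (real beta - 1) (u' t)) \<and>
           (\<forall>k. \<forall>t\<in>{0..T}. fc (u t) k = fc (u 0) k + (LINT s:{0..t}|lborel. fc (u' s) k)))"

definition conv :: "(real^'d \<Rightarrow> real) \<Rightarrow> (real^'d \<Rightarrow> real) \<Rightarrow> real^'d \<Rightarrow> real" where
  "conv f g x = (LINT y:unit_cube|lborel. f (x - y) * g y)"

text \<open>The vector field a (\<nabla>G * b), given the gradient components g of G.\<close>
definition drift :: "(real^'d \<Rightarrow> real) \<Rightarrow> ('d \<Rightarrow> real^'d \<Rightarrow> real) \<Rightarrow> (real^'d \<Rightarrow> real) \<Rightarrow> 'd \<Rightarrow> real^'d \<Rightarrow> real" where
  "drift a g b = (\<lambda>j x. a x * conv (g j) b x)"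

definition divc :: "('d \<Rightarrow> real^'d \<Rightarrow> real) \<Rightarrow> int^'d \<Rightarrow> complex" where
  "divc F k = (\<Sum>j\<in>UNIV. 2 * pi * \<i> * of_int (k$j) * fc (F j) k)"

definition lapc :: "(real^'d \<Rightarrow> real) \<Rightarrow> int^'d \<Rightarrow> complex" where
  "lapc u k = complex_of_real (- 4 * pi^2 * (norm (kvec k))^2) * fc u k"

text \<open>W in W^{2,\<infinity>}(T^d) with weak first derivatives g and weak second derivatives h
  (distributional derivatives, tested against the trigonometric basis) and
  norm max(ess sup |W|, ess sup |\<partial>_j W|, ess sup |\<partial>_i\<partial>_j W|) \<le> B.\<close>
definition W2inf :: "(real^'d \<Rightarrow> real) \<Rightarrow> ('d \<Rightarrow> real^'d \<Rightarrow> real) \<Rightarrow> ('d \<Rightarrow> 'd \<Rightarrow> real^'d \<Rightarrow> real) \<Rightarrow> real \<Rightarrow> bool" where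
  "W2inf W g h B \<longleftrightarrow>
     periodic1 W \<and> (\<forall>j. periodic1 (g j)) \<and> (\<forall>i j. periodic1 (h i j)) \<and>
     W \<in> borel_measurable lborel \<and> (\<forall>j. g j \<in> borel_measurable lborel) \<and>
     (\<forall>i j. h i j \<in> borel_measurable lborel) \<and>
     (AE x in lborel. x \<in> unit_cube \<longrightarrow>
        \<bar>W x\<bar> \<le> B \<and> (\<forall>j. \<bar>g j x\<bar> \<le> B) \<and> (\<forall>i j. \<bar>h i j x\<bar> \<le> B)) \<and>
     (\<forall>j k. fc (g j) k = 2 * pi * \<i> * of_int (k$j) * fc W k) \<and>
     (\<forall>i j k. fc (h i j) k = 2 * pi * \<i> * of_int (k$i) * fc (g j) k)"

definition pd :: "(real^'d \<Rightarrow> real) \<Rightarrow> 'd \<Rightarrow> real^'d \<Rightarrow> real" where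
  "pd f j x = deriv (\<lambda>t. f (x + t *\<^sub>R axis j 1)) 0"

text \<open>rho is a solution in F_beta of the aggregation-diffusion equation with interaction
  gradient g = \<nabla>W and initial datum phi (weak form, tested against every Fourier mode).\<close>
definition agg_sol :: "real \<Rightarrow> nat \<Rightarrow> (real^'d \<Rightarrow> real) \<Rightarrow> ('d \<Rightarrow> real^'d \<Rightarrow> real) \<Rightarrow> (real \<Rightarrow> real^'d \<Rightarrow> real) \<Rightarrow> bool" where
  "agg_sol T beta phi g rho \<longleftrightarrow> in_F T beta rho \<and>
     (\<forall>k. \<forall>t\<in>{0..T}. fc (rho t) k = fc phi k +
        (LINT s:{0..t}|lborel. lapc (rho s) k + divc (drift (rho s) g (rho s)) k))"

text \<open>v is the solution in F_beta of the linearised equation (= D rho_W[H]).\<close>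
definition lin_sol :: "real \<Rightarrow> nat \<Rightarrow> (real \<Rightarrow> real^'d \<Rightarrow> real) \<Rightarrow> ('d \<Rightarrow> real^'d \<Rightarrow> real) \<Rightarrow> ('d \<Rightarrow> real^'d \<Rightarrow> real) \<Rightarrow> (real \<Rightarrow> real^'d \<Rightarrow> real) \<Rightarrow> bool" where
  "lin_sol T beta rho g gH v \<longleftrightarrow> in_F T beta v \<and>
     (\<forall>k. \<forall>t\<in>{0..T}. fc (v t) k =
        (LINT s:{0..t}|lborel. lapc (v s) k + divc (drift (v s) g (rho s)) k
            + divc (drift (rho s) g (v s)) k + divc (drift (rho s) gH (rho s)) k))"

definition L2L2 :: "real \<Rightarrow> (real \<Rightarrow> real^'d \<Rightarrow> real) \<Rightarrow> real" where
  "L2L2 T v = sqrt (LINT t:{0..T}|lborel. (L2norm (v t))^2)"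

definition trig :: "int \<Rightarrow> real \<Rightarrow> real" where
  "trig m y = (if m > 0 then sqrt 2 * cos (2 * pi * of_int m * y)
               else if m = 0 then 1 else sqrt 2 * sin (2 * pi * of_int m * y))"

definition tau :: "int^'d \<Rightarrow> real^'d \<Rightarrow> real" where
  "tau k x = (\<Prod>j\<in>UNIV. trig (k$j) (x$j))"

definition EK :: "real \<Rightarrow> (real^'d \<Rightarrow> real) set" where
  "EK K = {H. \<exists>c::int^'d \<Rightarrow> real.
             H = (\<lambda>x. \<Sum>k\<in>{k. k \<noteq> 0 \<and> norm (kvec k) \<le> K}. c k * tau k x)}"

definition A1 :: "nat \<Rightarrow> (real^'d \<Rightarrow> real) \<Rightarrow> bool" where
  "A1 beta phi \<longleftrightarrow> periodic1 phi \<and> phi \<in> borel_measurable lborel \<and>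
     (\<forall>x. phi x \<ge> 0) \<and> set_integrable lborel unit_cube phi \<and>
     (LINT x:unit_cube|lborel. phi x) = 1 \<and>
     sob_mem (real beta) phi \<and> even beta \<and> beta \<ge> 3 + CARD('d)"

definition A2 :: "nat \<Rightarrow> (real^'d \<Rightarrow> real) \<Rightarrow> real \<Rightarrow> real \<Rightarrow> real \<Rightarrow> bool" where
  "A2 beta phi phimin cst zeta \<longleftrightarrow> phimin > 0 \<and> (\<forall>x. phi x \<ge> phimin) \<and> cst > 0 \<and>
     zeta > real beta + real CARD('d) / 2 \<and>
     (\<forall>k. k \<noteq> 0 \<longrightarrow> cmod (fc phi k) \<ge> cst * norm (kvec k) powr (- zeta))"

end

theory Submission
  imports Defs
begin

text \<open>
  Let \<open>u = H * phi\<close>. At time \<open>0\<close> the source \<open>div (phi grad (H * phi))\<close>, tested against \<open>u\<close>, has absolute value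
  at least \<open>phimin |grad u|^2\<close>, and \<open>|grad u| \<ge> cst K^(- zeta) |H|\<close> by the decay assumption. The pairing
  of \<open>v\<close> with \<open>u\<close> only sees frequencies up to \<open>K\<close>, so its derivative is the source up to an error
  \<open>O(K) |v| |grad u|\<close>. Local energy estimates show that \<open>rho\<close> stays bounded in \<open>L^2\<close>, and Duhamel's formula
  shows that its modes with \<open>|k| \<le> 2 K\<close> move by at most \<open>O(t K)\<close>; hence the source keeps half of its size up to
  a time \<open>t0\<close> of order \<open>K^(- 4 zeta / 3)\<close>. Integrating twice in time gives a lower bound of order
  \<open>t0^(3/2) |grad u|\<close>, and \<open>t0^(3/2)\<close> is of order \<open>K^(- 2 zeta)\<close>.
\<close>

section \<open>Characters on the torus\<close>

text \<open>The exponent 4/3 comes from the hypotheses on \<open>zeta\<close> and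
  \<open>beta\<close>: they give 1 + d/2 \<le> zeta/3. At time t the source has changed, relative to
  |grad u|^2, by t K (K^d + K^(zeta + d/2)) up to constants; the first term counts modes, the second
  divides by the smallest coefficient of \<open>phi\<close>. Both are absorbed for t of order K^(- 4
  zeta / 3). The formal obstacle is regularity in time. So no norm is ever differentiated: the
  bounds on \<open>rho\<close> start from Duhamel's formula for a single mode, are summed over
  finitely many modes and passed to the limit by Parseval, and measurability of the nonlinear terms
  is recovered from truncated Fourier series. The bound on \<open>rho\<close> is local in time
  because the drift is estimated by the L^2 norm alone, which makes the energy inequality quadratic.
  The time it covers depends only on d, M and the Sobolev bound.\<close>

lemma integral_Cauchy_Schwarz_real:
  fixes f g :: "'a \<Rightarrow> real"
  assumes [measurable]: "f \<in> borel_measurable M" "g \<in> borel_measurable M"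
    and f: "integrable M (\<lambda>x. (f x)^2)" and g: "integrable M (\<lambda>x. (g x)^2)"
  shows "integrable M (\<lambda>x. f x * g x)"
    and "(\<integral>x. f x * g x \<partial>M)^2 \<le> (\<integral>x. (f x)^2 \<partial>M) * (\<integral>x. (g x)^2 \<partial>M)"
proof -
  have b: "\<bar>f x * g x\<bar> \<le> (f x)^2 + (g x)^2" for x
  proof -
    have "0 \<le> (\<bar>f x\<bar> - \<bar>g x\<bar>)^2" by simp
    then have "2 * (\<bar>f x\<bar> * \<bar>g x\<bar>) \<le> (f x)^2 + (g x)^2" by (simp add: power2_diff)
    moreover have "0 \<le> \<bar>f x\<bar> * \<bar>g x\<bar>" by simp
    ultimately show ?thesis unfolding abs_mult by linarith
  qed
  show i: "integrable M (\<lambda>x. f x * g x)"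
    by (rule Bochner_Integration.integrable_bound[OF Bochner_Integration.integrable_add[OF f g]])
      (use b in \<open>auto simp: abs_of_nonneg\<close>)
  define a b c where "a = (\<integral>x. (f x)^2 \<partial>M)" and "b = (\<integral>x. (g x)^2 \<partial>M)" and "c = (\<integral>x. f x * g x \<partial>M)"
  have nn: "0 \<le> a - 2 * t * c + t^2 * b" for t
  proof -
    have "0 \<le> (\<integral>x. (f x - t * g x)^2 \<partial>M)" by simp
    also have "\<dots> = (\<integral>x. (f x)^2 - 2 * t * (f x * g x) + t^2 * (g x)^2 \<partial>M)"
      by (rule Bochner_Integration.integral_cong) (auto simp: power2_eq_square algebra_simps)
    also have "\<dots> = a - 2 * t * c + t^2 * b"
      unfolding a_def b_def c_def using f g i by simp
    finally show ?thesis .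
  qed
  have b0: "b \<ge> 0" unfolding b_def by simp
  have "c^2 \<le> a * b"
  proof (cases "b = 0")
    case True
    have "c = 0"
    proof (rule ccontr)
      assume "c \<noteq> 0"
      \<comment> \<open>With \<open>b = 0\<close> the polynomial is affine in \<open>t\<close>; this
        choice of \<open>t\<close> makes it equal to -1.\<close>
      then show False using nn[of "(a + 1) / (2 * c)"] True by (simp add: field_simps)
    qed
    then show ?thesis using True by simp
  next
    case False
    then have "b > 0" using b0 by simp
    \<comment> \<open>The minimiser of the quadratic polynomial.\<close>
    then show ?thesis using nn[of "c / b"] by (simp add: field_simps power2_eq_square)
  qed
  then show "(\<integral>x. f x * g x \<partial>M)^2 \<le> (\<integral>x. (f x)^2 \<partial>M) * (\<integral>x. (g x)^2 \<partial>M)"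
    unfolding a_def b_def c_def .
qed

lemma integral_Cauchy_Schwarz:
  fixes f g :: "'a \<Rightarrow> complex"
  assumes [measurable]: "f \<in> borel_measurable M" "g \<in> borel_measurable M"
    and f: "integrable M (\<lambda>x. (cmod (f x))^2)" and g: "integrable M (\<lambda>x. (cmod (g x))^2)"
  shows "integrable M (\<lambda>x. f x * g x)"
    and "(cmod (\<integral>x. f x * g x \<partial>M))^2 \<le> (\<integral>x. (cmod (f x))^2 \<partial>M) * (\<integral>x. (cmod (g x))^2 \<partial>M)"
proof -
  note cs = integral_Cauchy_Schwarz_real[of "\<lambda>x. cmod (f x)" M "\<lambda>x. cmod (g x)", OF _ _ f g]
  show "integrable M (\<lambda>x. f x * g x)"
    by (rule Bochner_Integration.integrable_bound[OF cs(1)]) (auto simp: norm_mult)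
  have "cmod (\<integral>x. f x * g x \<partial>M) \<le> (\<integral>x. cmod (f x) * cmod (g x) \<partial>M)"
    using integral_norm_bound[of M "\<lambda>x. f x * g x"] by (simp add: norm_mult)
  then have "(cmod (\<integral>x. f x * g x \<partial>M))^2 \<le> (\<integral>x. cmod (f x) * cmod (g x) \<partial>M)^2"
    by (rule power_mono) simp
  also note cs(2)
  finally show "(cmod (\<integral>x. f x * g x \<partial>M))^2 \<le> (\<integral>x. (cmod (f x))^2 \<partial>M) * (\<integral>x. (cmod (g x))^2 \<partial>M)"
    by simp
qed

section \<open>The unit cube as a probability space\<close>

definition torus :: "(real^'d) measure" where
  "torus = restrict_space lborel unit_cube"

definition chr :: "int^'d \<Rightarrow> real^'d \<Rightarrow> complex" where
  "chr k x = exp (2 * pi * \<i> * of_real (kvec k \<bullet> x))"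

lemma unit_cube_sets [measurable, simp]: "unit_cube \<in> sets borel"
  unfolding unit_cube_def by simp

lemma space_torus [simp]: "space torus = unit_cube"
  unfolding torus_def by (simp add: space_restrict_space)

lemma emeasure_torus_space: "emeasure torus (unit_cube :: (real^'d) set) = 1"
proof -
  have eq: "(\<lambda>b. (1::real^'d) \<bullet> b - 0 \<bullet> b) b = 1" if "b \<in> Basis" for b
    using that by (auto simp: Basis_vec_def inner_axis)
  have "emeasure lborel (cbox 0 (1::real^'d)) = ennreal (\<Prod>b\<in>Basis. ((1::real^'d) - 0) \<bullet> b)"
    by (subst emeasure_lborel_cbox) (auto simp: Basis_vec_def inner_axis)
  also have "\<dots> = 1" using eq by (simp add: inner_diff_left)
  finally show ?thesis
    unfolding torus_def by (subst emeasure_restrict_space) (simp_all add: unit_cube_def)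
qed

interpretation torus: finite_measure torus
  by standard (simp add: emeasure_torus_space)

lemma measure_torus_space [simp]: "measure torus (unit_cube :: (real^'d) set) = 1"
  using emeasure_torus_space by (simp add: measure_def)

lemma measurable_torus [measurable (raw)]:
  "f \<in> borel_measurable borel \<Longrightarrow> f \<in> borel_measurable torus"
  unfolding torus_def by (rule measurable_restrict_space1) simp

lemma set_integral_torus:
  fixes f :: "real^'d \<Rightarrow> 'b::{banach,second_countable_topology}"
  shows "(LINT x:unit_cube|lborel. f x) = (\<integral>x. f x \<partial>torus)"
  unfolding torus_def set_lebesgue_integral_def by (subst integral_restrict_space) (simp_all add: Int_absorb2)

lemma set_integrable_torus:
  fixes f :: "real^'d \<Rightarrow> 'b::{banach,second_countable_topology}"
  shows "set_integrable lborel unit_cube f \<longleftrightarrow> integrable torus f"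
  unfolding torus_def set_integrable_def by (subst integrable_restrict_space) simp_all

lemma kvec_add: "kvec (k + l) = kvec k + kvec l"
  by (simp add: kvec_def vec_eq_iff)

lemma kvec_minus: "kvec (- k) = - kvec k"
  by (simp add: kvec_def vec_eq_iff)

lemma kvec_diff: "kvec (k - l) = kvec k - kvec l"
  by (simp add: kvec_def vec_eq_iff)

lemma component_le_norm_kvec: "\<bar>real_of_int (k $ j)\<bar> \<le> norm (kvec k)"
  using component_le_norm_cart[of "kvec k" j] by (simp add: kvec_def)

lemma kvec_zero [simp]: "kvec 0 = 0"
  by (simp add: kvec_def vec_eq_iff)

lemma norm_chr [simp]: "cmod (chr k x) = 1"
  unfolding chr_def by (simp add: norm_exp_eq_Re)

lemma chr_add: "chr (k + l) x = chr k x * chr l x"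
  by (simp add: chr_def kvec_add inner_add_left exp_add [symmetric] algebra_simps)

lemma chr_zero [simp]: "chr 0 x = 1"
  by (simp add: chr_def)

lemma cnj_chr: "cnj (chr k x) = chr (- k) x"
  by (simp add: chr_def kvec_minus exp_cnj)

lemma cnj_chr_exp: "cnj (chr k x) = exp (- 2 * pi * \<i> * of_real (kvec k \<bullet> x))"
  unfolding cnj_chr by (simp add: chr_def kvec_minus)

lemma chr_diff: "chr (k - l) x = chr k x * cnj (chr l x)"
  using chr_add[of k "- l" x] by (simp add: cnj_chr)

lemma chr_arg_diff: "chr k (x - y) = chr k x * cnj (chr k y)"
  unfolding cnj_chr_exp by (simp add: chr_def inner_diff_right exp_add [symmetric] algebra_simps)

lemma chr_measurable [measurable]: "chr k \<in> borel_measurable borel"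
proof -
  have "continuous_on UNIV (chr k)"
    unfolding chr_def by (intro continuous_intros)
  then show ?thesis by (rule borel_measurable_continuous_onI)
qed

lemma borel_measurable_cnj [measurable (raw)]:
  "f \<in> borel_measurable M \<Longrightarrow> (\<lambda>x. cnj (f x)) \<in> borel_measurable M"
  by (rule borel_measurable_continuous_on[where f = cnj]) (intro continuous_intros)

lemma integrable_torus_bounded:
  fixes f :: "real^'d \<Rightarrow> 'b::{banach,second_countable_topology}"
  assumes "f \<in> borel_measurable torus" "\<And>x. norm (f x) \<le> B"
  shows "integrable torus f"
  using assms by (intro torus.integrable_const_bound[of _ B]) auto

lemma fc_eq: "fc u k = (\<integral>x. of_real (u x) * cnj (chr k x) \<partial>torus)"
  unfolding fc_def set_integral_torus
  by (simp add: cnj_chr_exp)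

lemma L2norm_eq: "L2norm u = sqrt (\<integral>x. (u x)^2 \<partial>torus)"
  unfolding L2norm_def set_integral_torus ..

lemma L2norm_power2: "(L2norm u)^2 = (\<integral>x. (u x)^2 \<partial>torus)"
  unfolding L2norm_eq by (simp add: real_sqrt_pow2)

lemma L2norm_nonneg [simp]: "0 \<le> L2norm u"
  unfolding L2norm_eq by simp

lemma L2cube_iff: "L2cube u \<longleftrightarrow> u \<in> borel_measurable borel \<and> integrable torus (\<lambda>x. (u x)^2)"
  unfolding L2cube_def set_integrable_torus by simp

lemma L2cube_integrable:
  assumes "L2cube u" shows "integrable torus u"
proof -
  have [measurable]: "u \<in> borel_measurable borel" using assms by (simp add: L2cube_iff)
  have "integrable torus (\<lambda>x. u x * 1)"
    by (rule integral_Cauchy_Schwarz_real) (use assms in \<open>auto simp: L2cube_iff\<close>)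
  then show ?thesis by simp
qed

lemma L1_le_L2norm:
  fixes u :: "real^'d \<Rightarrow> real"
  assumes "L2cube u" shows "(\<integral>x. \<bar>u x\<bar> \<partial>torus) \<le> L2norm u"
proof -
  have [measurable]: "u \<in> borel_measurable borel" using assms by (simp add: L2cube_iff)
  have "(\<integral>x. \<bar>u x\<bar> * 1 \<partial>torus)^2 \<le> (\<integral>x. \<bar>u x\<bar>^2 \<partial>torus) * (\<integral>x. 1^2 \<partial>(torus :: (real^'d) measure))"
    by (rule integral_Cauchy_Schwarz_real(2)[of "\<lambda>x. \<bar>u x\<bar>" torus "\<lambda>_. 1"])
      (use assms in \<open>auto simp: L2cube_iff\<close>)
  then have "(\<integral>x. \<bar>u x\<bar> \<partial>torus)^2 \<le> (L2norm u)^2" by (simp add: L2norm_power2)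
  then show ?thesis by (rule power2_le_imp_le) simp
qed

lemma cmod_fc_le_L1: "cmod (fc u k) \<le> (\<integral>x. \<bar>u x\<bar> \<partial>torus)"
  unfolding fc_eq
  using integral_norm_bound[of torus "\<lambda>x. of_real (u x) * cnj (chr k x)"]
  by (simp add: norm_mult)

section \<open>Orthogonality of the characters\<close>

lemma integral_unit_exp:
  "(\<integral>x. indicator {0..1} x *\<^sub>R exp (2 * pi * \<i> * of_int m * of_real x) \<partial>lborel) = (if m = 0 then 1 else 0)"
proof (cases "m = 0")
  case True then show ?thesis by simp
next
  case False
  define c where "c = 2 * pi * \<i> * of_int m"
  have c: "c \<noteq> 0" using False by (simp add: c_def)
  have "((\<lambda>x. exp (c * of_real x)) has_integral (exp (c * of_real 1) / c - exp (c * of_real 0) / c)) {0..1}"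
  proof (rule fundamental_theorem_of_calculus)
    fix x :: real
    have "((\<lambda>z. exp (c * z) / c) has_field_derivative exp (c * of_real x)) (at (of_real x))"
      using c by (auto intro!: derivative_eq_intros)
    then show "((\<lambda>x. exp (c * of_real x) / c) has_vector_derivative exp (c * of_real x)) (at x within {0..1})"
      by (intro has_vector_derivative_real_field has_vector_derivative_at_within)
  qed simp
  \<comment> \<open>The antiderivative \<open>exp (c * x) / c\<close> has period 1, so its boundary
    values cancel.\<close>
  moreover have "exp c = 1"
    unfolding c_def using exp_integer_2pi[of "of_int m"] by (simp add: mult.commute mult.left_commute)
  ultimately have h: "((\<lambda>x. exp (c * of_real x)) has_integral 0) {0..1}" by simp
  have "set_integrable lborel {0..1} (\<lambda>x. exp (c * of_real x))"
    by (rule borel_integrable_atLeastAtMost') (intro continuous_intros)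
  from set_borel_integral_eq_integral(2)[OF this] h
  have "(LINT x:{0..1}|lborel. exp (c * of_real x)) = 0"
    by (simp add: integral_unique)
  then show ?thesis using False unfolding c_def set_lebesgue_integral_def by simp
qed

text \<open>Lebesgue measure on the space is the image of a product of line measures, and both the
  character and the indicator of the cube factor over coordinates. This reduces orthogonality to
  \<open>integral_unit_exp\<close>.\<close>

lemma integral_chr:
  fixes k :: "int^'d"
  shows "(\<integral>x. chr k x \<partial>torus) = (if k = 0 then 1 else 0)"
proof -
  interpret product_sigma_finite "\<lambda>b::real^'d. lborel :: real measure"
    by (rule product_sigma_finite.intro) (rule sigma_finite_lborel)
  define f where "f b y = indicator {0..1} y *\<^sub>R exp (of_real (2 * pi) * \<i> * of_real (kvec k \<bullet> b) * of_real y)" for b :: "real^'d" and y :: real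
  have fb: "integrable lborel (f b)" for b
  proof -
    have "set_integrable lborel {0..1} (\<lambda>y. exp (of_real (2 * pi) * \<i> * of_real (kvec k \<bullet> b) * of_real y))"
      by (rule borel_integrable_atLeastAtMost') (intro continuous_intros)
    then show ?thesis unfolding f_def set_integrable_def .
  qed
  have ind: "(indicator unit_cube :: _ \<Rightarrow> real) (\<Sum>b\<in>Basis. y b *\<^sub>R b) = (\<Prod>b\<in>Basis. indicator {0..1::real} (y b))" for y :: "real^'d \<Rightarrow> real"
  proof -
    have one: "(1::real^'d) \<bullet> b = 1" if "b \<in> Basis" for b
      using that by (auto simp: Basis_vec_def inner_axis)
    have "(\<Sum>b\<in>Basis. y b *\<^sub>R b) \<in> unit_cube \<longleftrightarrow> (\<forall>b\<in>Basis. y b \<in> {0..1})"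
      unfolding unit_cube_def mem_box by (simp add: one)
    moreover have "(\<Prod>b\<in>Basis. indicator {0..1::real} (y b)) = (0::real)" if "b \<in> Basis" "y b \<notin> {0..1}" for b
      using that by (intro prod_zero bexI[of _ b]) (auto simp: indicator_def)
    ultimately show ?thesis
      by (cases "\<forall>b\<in>Basis. y b \<in> {0..1}") (auto simp: indicator_def simp del: of_bool_eq)
  qed
  have "(\<integral>x. chr k x \<partial>torus) = (\<integral>x. indicator unit_cube x *\<^sub>R chr k x \<partial>lborel)"
    unfolding torus_def by (subst integral_restrict_space) (simp_all add: Int_absorb2)
  also have "\<dots> = (\<integral>y. indicator unit_cube (\<Sum>b\<in>Basis. y b *\<^sub>R b) *\<^sub>R chr k (\<Sum>b\<in>Basis. y b *\<^sub>R b) \<partial>(\<Pi>\<^sub>M b\<in>Basis. lborel))"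
    by (subst lborel_eq, subst integral_distr) auto
  also have "\<dots> = (\<integral>y. (\<Prod>b\<in>Basis. f b (y b)) \<partial>(\<Pi>\<^sub>M b\<in>Basis. lborel))"
  proof (rule Bochner_Integration.integral_cong[OF refl])
    fix y :: "real^'d \<Rightarrow> real"
    have "chr k (\<Sum>b\<in>Basis. y b *\<^sub>R b) = (\<Prod>b\<in>Basis. exp (of_real (2 * pi) * \<i> * of_real (kvec k \<bullet> b) * of_real (y b)))"
      unfolding chr_def by (simp add: inner_sum_right sum_distrib_left exp_sum [symmetric] mult_ac)
    then show "indicator unit_cube (\<Sum>b\<in>Basis. y b *\<^sub>R b) *\<^sub>R chr k (\<Sum>b\<in>Basis. y b *\<^sub>R b) = (\<Prod>b\<in>Basis. f b (y b))"
      unfolding f_def ind by (simp add: scaleR_conv_of_real prod.distrib)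
  qed
  also have "\<dots> = (\<Prod>b\<in>Basis. \<integral>y. f b y \<partial>lborel)"
    by (rule product_integral_prod) (auto simp: fb)
  also have "\<dots> = (\<Prod>j\<in>UNIV. \<integral>y. f (axis j 1) y \<partial>lborel)"
  proof -
    have B: "(Basis :: (real^'d) set) = (\<lambda>j. axis j 1) ` UNIV" by (auto simp: Basis_vec_def)
    show ?thesis unfolding B
      by (subst prod.reindex) (auto simp: inj_on_def axis_eq_axis)
  qed
  also have "\<dots> = (\<Prod>j\<in>UNIV. if k $ j = 0 then 1 else 0)"
    using integral_unit_exp by (intro prod.cong) (auto simp: f_def kvec_def inner_axis)
  also have "\<dots> = (if k = 0 then 1 else 0)"
    by (auto simp: vec_eq_iff)
  finally show ?thesis .
qed

lemma integral_chr_cnj: "(\<integral>x. chr k x * cnj (chr l x) \<partial>torus) = (if k = l then 1 else 0)"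
  unfolding chr_diff [symmetric] integral_chr by simp

lemma integrable_chr_cnj [simp]: "integrable torus (\<lambda>x. chr k x * cnj (chr l x))"
  by (rule integrable_torus_bounded[of _ 1]) (auto simp: norm_mult)

lemma integrable_times_chr:
  assumes "integrable torus f" shows "integrable torus (\<lambda>x. f x * cnj (chr k x) :: complex)"
  by (rule Bochner_Integration.integrable_bound[OF assms]) 
     (use borel_measurable_integrable[OF assms] in \<open>auto simp: norm_mult\<close>)

lemma integrable_fc:
  assumes "integrable torus u" shows "integrable torus (\<lambda>x. of_real (u x) * cnj (chr k x))"
  by (rule integrable_times_chr) (use assms in simp)

section \<open>Finite Parseval identity and Bessel's inequality\<close>

lemma parseval_finite:
  assumes "finite F"
  shows "(\<integral>x. (cmod (\<Sum>k\<in>F. a k * chr k x))^2 \<partial>torus) = (\<Sum>k\<in>F. (cmod (a k))^2)"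
proof -
  have "complex_of_real (\<integral>x. (cmod (\<Sum>k\<in>F. a k * chr k x))^2 \<partial>torus)
     = (\<integral>x. of_real ((cmod (\<Sum>k\<in>F. a k * chr k x))^2) \<partial>torus)"
    by (rule integral_complex_of_real[symmetric])
  also have "\<dots> = (\<integral>x. (\<Sum>k\<in>F. \<Sum>l\<in>F. (a k * cnj (a l)) * (chr k x * cnj (chr l x))) \<partial>torus)"
    by (rule Bochner_Integration.integral_cong)
      (auto simp: complex_norm_square sum_product mult_ac simp del: of_real_power intro!: sum.cong)
  also have "\<dots> = (\<Sum>k\<in>F. \<Sum>l\<in>F. (a k * cnj (a l)) * (if k = l then 1 else 0))"
    by (simp add: integral_chr_cnj)
  also have "\<dots> = (\<Sum>k\<in>F. a k * cnj (a k))"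
    using assms by (intro sum.cong) (auto simp: if_distrib sum.delta cong: if_cong)
  also have "\<dots> = complex_of_real (\<Sum>k\<in>F. (cmod (a k))^2)"
    by (simp add: complex_norm_square del: of_real_power)
  finally show ?thesis using of_real_eq_iff by blast
qed

lemma integrable_trig_sum: "integrable torus (\<lambda>x. \<Sum>k\<in>F. a k * chr k x)"
  by (intro Bochner_Integration.integrable_sum integrable_mult_right)
     (rule integrable_torus_bounded[of _ 1], auto)

lemma trig_sum_le: "cmod (\<Sum>k\<in>F. a k * chr k x) \<le> (\<Sum>k\<in>F. cmod (a k))"
  by (rule order_trans[OF norm_sum]) (simp add: norm_mult)

lemma integrable_trig_sum_power2: "integrable torus (\<lambda>x. (cmod (\<Sum>k\<in>F. a k * chr k x))^2)"
proof (rule integrable_torus_bounded)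
  show "norm ((cmod (\<Sum>k\<in>F. a k * chr k x))^2) \<le> (\<Sum>k\<in>F. cmod (a k))^2" for x
    using power_mono[OF trig_sum_le[where F = F and a = a and x = x], of 2] by simp
qed measurable

text \<open>The cross term \<open>u * cnj p\<close> integrates to the same sum as
  \<open>|p|^2\<close>, so expanding the square leaves one copy with a minus sign. Nonnegativity of
  the left side is Bessel's inequality; smallness of the right side is L^2 convergence of the
  partial sums.\<close>

lemma fourier_defect:
  assumes F: "finite F" and u: "L2cube u"
  shows "integrable torus (\<lambda>x. (cmod (of_real (u x) - (\<Sum>k\<in>F. fc u k * chr k x)))^2)"
    and "(\<integral>x. (cmod (of_real (u x) - (\<Sum>k\<in>F. fc u k * chr k x)))^2 \<partial>torus)
    = (L2norm u)^2 - (\<Sum>k\<in>F. (cmod (fc u k))^2)"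
proof -
  define p where "p x = (\<Sum>k\<in>F. fc u k * chr k x)" for x
  have [measurable]: "u \<in> borel_measurable borel" using u by (simp add: L2cube_iff)
  have [measurable]: "p \<in> borel_measurable borel" unfolding p_def by measurable
  have i1: "integrable torus (\<lambda>x. (u x)^2)" using u by (simp add: L2cube_iff)
  have i2: "integrable torus (\<lambda>x. (cmod (p x))^2)" unfolding p_def by (rule integrable_trig_sum_power2)
  have e: "complex_of_real (u x) * cnj (p x) = (\<Sum>k\<in>F. cnj (fc u k) * (complex_of_real (u x) * cnj (chr k x)))" for x
    unfolding p_def by (simp add: sum_distrib_left mult_ac)
  have i3: "integrable torus (\<lambda>x. of_real (u x) * cnj (p x))"
    unfolding e by (intro Bochner_Integration.integrable_sum integrable_mult_right integrable_fc L2cube_integrable u)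
  have "(\<integral>x. of_real (u x) * cnj (p x) \<partial>torus) = (\<Sum>k\<in>F. cnj (fc u k) * fc u k)"
    unfolding e fc_eq using integrable_fc[OF L2cube_integrable[OF u]]
    by (subst Bochner_Integration.integral_sum) (auto simp: fc_eq)
  also have "\<dots> = complex_of_real (\<Sum>k\<in>F. (cmod (fc u k))^2)"
    by (simp add: complex_norm_square mult.commute del: of_real_power)
  finally have I3: "(\<integral>x. Re (of_real (u x) * cnj (p x)) \<partial>torus) = (\<Sum>k\<in>F. (cmod (fc u k))^2)"
    using i3 by (subst integral_Re) auto
  have sq: "(cmod (of_real (u x) - p x))^2 = (u x)^2 - 2 * Re (of_real (u x) * cnj (p x)) + (cmod (p x))^2" for x
    unfolding cmod_power2 by (simp add: power2_eq_square algebra_simps)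
  show "integrable torus (\<lambda>x. (cmod (of_real (u x) - (\<Sum>k\<in>F. fc u k * chr k x)))^2)"
    unfolding p_def[symmetric] sq using i1 i2 integrable_Re[OF i3] by simp
  have "(\<integral>x. (cmod (of_real (u x) - p x))^2 \<partial>torus)
     = (\<integral>x. (u x)^2 \<partial>torus) - 2 * (\<integral>x. Re (of_real (u x) * cnj (p x)) \<partial>torus) + (\<integral>x. (cmod (p x))^2 \<partial>torus)"
    unfolding sq using i1 i2 integrable_Re[OF i3] by simp
  also have "(\<integral>x. (cmod (p x))^2 \<partial>torus) = (\<Sum>k\<in>F. (cmod (fc u k))^2)"
    unfolding p_def by (rule parseval_finite[OF F])
  finally show "(\<integral>x. (cmod (of_real (u x) - (\<Sum>k\<in>F. fc u k * chr k x)))^2 \<partial>torus)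
    = (L2norm u)^2 - (\<Sum>k\<in>F. (cmod (fc u k))^2)"
    unfolding p_def[symmetric] I3 L2norm_power2 by simp
qed

lemma bessel:
  assumes "finite F" "L2cube u"
  shows "(\<Sum>k\<in>F. (cmod (fc u k))^2) \<le> (L2norm u)^2"
proof -
  have "0 \<le> (\<integral>x. (cmod (of_real (u x) - (\<Sum>k\<in>F. fc u k * chr k x)))^2 \<partial>torus)" by simp
  then show ?thesis unfolding fourier_defect(2)[OF assms] by simp
qed

section \<open>Density of trigonometric polynomials\<close>

inductive trig_poly :: "(real^'d \<Rightarrow> complex) \<Rightarrow> bool" where
  trig_poly_chr: "trig_poly (\<lambda>x. c * chr k x)"
| trig_poly_add: "trig_poly f \<Longrightarrow> trig_poly g \<Longrightarrow> trig_poly (\<lambda>x. f x + g x)"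

text \<open>Frequencies add under multiplication. This is the algebra property that
  Stone-Weierstrass requires.\<close>

lemma trig_poly_mult:
  assumes "trig_poly f" "trig_poly g" shows "trig_poly (\<lambda>x. f x * g x)"
  using assms(1)
proof induction
  case (trig_poly_chr c k)
  show ?case using assms(2)
  proof induction
    case (trig_poly_chr d l)
    have "(\<lambda>x. c * chr k x * (d * chr l x)) = (\<lambda>x. (c * d) * chr (k + l) x)"
      by (simp add: chr_add mult_ac)
    then show ?case by (simp only: trig_poly.intros)
  next
    case (trig_poly_add f g)
    then show ?case using trig_poly.trig_poly_add by (simp add: distrib_left)
  qed
next
  case (trig_poly_add f g)
  then show ?case using trig_poly.trig_poly_add by (simp add: distrib_right)
qed

lemma trig_poly_const: "trig_poly (\<lambda>x. c)"
  using trig_poly_chr[of c 0] by simp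

lemma integral_trig_poly_eq_0:
  assumes f: "integrable torus f" and 0: "\<And>k. (\<integral>x. f x * chr k x \<partial>torus) = 0" and p: "trig_poly p"
  shows "integrable torus (\<lambda>x. f x * p x) \<and> (\<integral>x. f x * p x \<partial>torus) = 0"
  using p
proof induction
  case (trig_poly_chr c k)
  have "integrable torus (\<lambda>x. f x * chr k x)"
    using integrable_times_chr[OF f, of "- k"] by (simp add: cnj_chr)
  then have "integrable torus (\<lambda>x. c * (f x * chr k x))" "(\<integral>x. c * (f x * chr k x) \<partial>torus) = 0"
    by (auto simp: 0)
  then show ?case by (simp add: mult.left_commute)
next
  case (trig_poly_add f g)
  then show ?case by (simp add: distrib_left)
qed

text \<open>Opposite faces of the cube are identified by all characters, so Stone-Weierstrass is applied
  on the image of the cube under this map, whose points the characters separate.\<close>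

definition torus_emb :: "real^'d \<Rightarrow> complex^'d" where
  "torus_emb x = (\<chi> j. cis (2 * pi * x $ j))"

lemma continuous_torus_emb: "continuous_on A torus_emb"
  unfolding torus_emb_def by (intro continuous_intros)

lemma torus_emb_measurable [measurable]: "torus_emb \<in> borel_measurable borel"
  by (rule borel_measurable_continuous_onI[OF continuous_torus_emb])

lemma chr_axis: "chr (axis j 1) x = cis (2 * pi * x $ j)"
proof -
  have "kvec (axis j 1) = axis j 1" by (simp add: kvec_def axis_def vec_eq_iff)
  then show ?thesis by (simp add: chr_def inner_axis' cis_conv_exp mult_ac)
qed

text \<open>Only boundary points are glued together: coordinates in the open and in the closed unit
  interval that differ by an integer are equal.\<close>

lemma inj_torus_emb:
  assumes "x \<in> box 0 1" "y \<in> unit_cube" "torus_emb x = torus_emb y" shows "x = y"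
proof -
  have "x $ j = y $ j" for j
  proof -
    have x: "0 < x $ j" "x $ j < 1" using assms(1) by (auto simp: mem_box_cart)
    have y: "0 \<le> y $ j" "y $ j \<le> 1" using assms(2) by (auto simp: mem_box_cart unit_cube_def)
    have "cis (2 * pi * x $ j) = cis (2 * pi * y $ j)"
      using assms(3) by (simp add: torus_emb_def vec_eq_iff)
    then have "sin (2 * pi * x $ j) = sin (2 * pi * y $ j) \<and> cos (2 * pi * x $ j) = cos (2 * pi * y $ j)"
      by (simp add: complex_eq_iff)
    then obtain n :: int where "2 * pi * x $ j = 2 * pi * y $ j + 2 * pi * n"
      by (subst (asm) sin_cos_eq_iff) auto
    then have "2 * pi * x $ j = 2 * pi * (y $ j + n)" by (simp add: algebra_simps)
    then have e: "x $ j = y $ j + n" by simp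
    then have "real_of_int n < 1" "real_of_int n > -1" using x y by linarith+
    then have "n = 0" by linarith
    then show ?thesis using e by simp
  qed
  then show ?thesis by (simp add: vec_eq_iff)
qed

section \<open>Uniqueness of Fourier coefficients\<close>

lemma compact_torus_image: "compact (torus_emb ` (unit_cube :: (real^'d) set))"
  unfolding unit_cube_def by (intro compact_continuous_image continuous_torus_emb compact_cbox)

text \<open>Stone-Weierstrass is applied over the reals. \<open>R\<close> therefore collects real
  functions whose pullback, read as a complex function, is a trigonometric polynomial, and the
  realness survives as \<open>Im (q x) = 0\<close>. Real and imaginary parts of the coordinates
  separate points and are combinations of a character and its conjugate.\<close>

lemma trig_poly_dense:
  fixes \<psi> :: "complex^'d \<Rightarrow> real"
  assumes "continuous_on (torus_emb ` unit_cube) \<psi>" "e > 0"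
  obtains q where "trig_poly q" "\<And>x. Im (q x) = 0" "\<And>x. x \<in> unit_cube \<Longrightarrow> \<bar>\<psi> (torus_emb x) - Re (q x)\<bar> < e"
proof -
  define S where "S = torus_emb ` (unit_cube :: (real^'d) set)"
  define R where "R = {p :: complex^'d \<Rightarrow> real. continuous_on S p \<and> trig_poly (\<lambda>x. of_real (p (torus_emb x)))}"
  interpret function_ring_on R S
  proof
    show "compact S" unfolding S_def by (rule compact_torus_image)
    fix f assume f: "f \<in> R"
    then show "continuous_on S f" by (simp add: R_def)
    fix g assume g: "g \<in> R"
    show "(\<lambda>x. f x + g x) \<in> R"
      using f g trig_poly_add unfolding R_def by (auto intro!: continuous_intros)
    show "(\<lambda>x. f x * g x) \<in> R"
      using f g trig_poly_mult unfolding R_def by (auto intro!: continuous_intros)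
  next
    fix c :: real
    show "(\<lambda>_. c) \<in> R" unfolding R_def using trig_poly_const by auto
  next
    fix z w :: "complex^'d" assume "z \<noteq> w"
    then obtain j where j: "z $ j \<noteq> w $ j" by (auto simp: vec_eq_iff)
    have 1: "(\<lambda>z. Re (z $ j)) \<in> R"
    proof -
      have "(\<lambda>x::real^'d. of_real (Re (torus_emb x $ j)))
         = (\<lambda>x. (1/2) * chr (axis j 1) x + (1/2) * chr (- axis j 1) x)"
        by (rule ext) (simp add: cnj_chr [symmetric] chr_axis torus_emb_def complex_eq_iff)
      then show ?thesis unfolding R_def
        by (simp only: mem_Collect_eq) (intro conjI continuous_intros trig_poly.intros)
    qed
    have 2: "(\<lambda>z. Im (z $ j)) \<in> R"
    proof -
      have "(\<lambda>x::real^'d. of_real (Im (torus_emb x $ j)))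
         = (\<lambda>x. (- \<i>/2) * chr (axis j 1) x + (\<i>/2) * chr (- axis j 1) x)"
        by (rule ext) (simp add: cnj_chr [symmetric] chr_axis torus_emb_def complex_eq_iff)
      then show ?thesis unfolding R_def
        by (simp only: mem_Collect_eq) (intro conjI continuous_intros trig_poly.intros)
    qed
    show "\<exists>f\<in>R. f z \<noteq> f w"
      using 1 2 j by (metis complex_eq_iff)
  qed
  obtain p where p: "p \<in> R" "\<forall>x\<in>S. \<bar>\<psi> x - p x\<bar> < e"
    using Stone_Weierstrass_basic[of \<psi> e] assms unfolding S_def by blast
  show thesis
    by (rule that[of "\<lambda>x. of_real (p (torus_emb x))"]) (use p in \<open>auto simp: R_def S_def\<close>)
qed

lemma AE_torus_box: "AE x in torus. x \<in> box 0 (1::real^'d)"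
proof -
  have one: "(1::real^'d) \<bullet> b = 1" if "b \<in> Basis" for b
    using that by (auto simp: Basis_vec_def inner_axis)
  have c: "emeasure lborel (cbox 0 (1::real^'d)) = 1"
    by (subst emeasure_lborel_cbox) (auto simp: one inner_diff_left)
  have b: "emeasure lborel (box 0 (1::real^'d)) = 1"
    by (subst emeasure_lborel_box) (auto simp: one inner_diff_left)
  have "emeasure lborel (cbox 0 1 - box 0 (1::real^'d)) = 0"
    by (subst emeasure_Diff) (auto simp: b c box_subset_cbox)
  then have "cbox 0 1 - box 0 (1::real^'d) \<in> null_sets lborel" by (auto simp: null_sets_def)
  then have "AE x in lborel. x \<notin> cbox 0 1 - box 0 (1::real^'d)" by (rule AE_not_in)
  then show ?thesis
    unfolding torus_def by (subst AE_restrict_space_iff) (auto simp: unit_cube_def)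
qed

text \<open>Continuous functions of \<open>torus_emb x\<close> are uniform limits of trigonometric
  polynomials, and on the open cube the indicator of \<open>C\<close> is a pointwise limit of such
  functions, because there distance zero to the image of \<open>C\<close> means membership in
  \<open>C\<close>.\<close>

lemma integral_compact_eq_0:
  fixes f :: "real^'d \<Rightarrow> complex"
  assumes f: "integrable torus f" and 0: "\<And>k. (\<integral>x. f x * chr k x \<partial>torus) = 0"
    and C: "compact C" "C \<subseteq> box 0 1" "C \<noteq> {}"
  shows "(\<integral>x. f x * indicator C x \<partial>torus) = 0"
proof -
  have fm [measurable]: "f \<in> borel_measurable torus" using f by simp
  have cont0: "(\<integral>x. f x * of_real (\<psi> (torus_emb x)) \<partial>torus) = 0"
    if \<psi>: "continuous_on UNIV \<psi>" for \<psi> :: "complex^'d \<Rightarrow> real"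
  proof -
    have [measurable]: "\<psi> \<in> borel_measurable borel" using \<psi> by (rule borel_measurable_continuous_onI)
    have \<psi>': "continuous_on (torus_emb ` unit_cube) \<psi>" using \<psi> continuous_on_subset by blast
    define L where "L = (\<integral>x. cmod (f x) \<partial>torus)"
    have L: "0 \<le> L" by (simp add: L_def)
    obtain B where B: "\<And>z. z \<in> torus_emb ` (unit_cube :: (real^'d) set) \<Longrightarrow> \<bar>\<psi> z\<bar> \<le> B"
      using compact_imp_bounded[OF compact_continuous_image[OF \<psi>' compact_torus_image]]
      unfolding bounded_iff by auto
    have int: "integrable torus (\<lambda>x. f x * of_real (\<psi> (torus_emb x)))"
    proof (rule Bochner_Integration.integrable_bound[of torus "\<lambda>x. B * cmod (f x)"])
      show "integrable torus (\<lambda>x. B * cmod (f x))" using f by simp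
      show "AE x in torus. norm (f x * of_real (\<psi> (torus_emb x))) \<le> norm (B * cmod (f x))"
      proof (rule AE_I2)
        fix x :: "real^'d" assume "x \<in> space torus"
        then have "\<bar>\<psi> (torus_emb x)\<bar> \<le> B" by (intro B) auto
        then have "\<bar>\<psi> (torus_emb x)\<bar> \<le> \<bar>B\<bar>" by linarith
        then have "\<bar>\<psi> (torus_emb x)\<bar> * cmod (f x) \<le> \<bar>B\<bar> * cmod (f x)"
          by (rule mult_right_mono) simp
        then show "norm (f x * of_real (\<psi> (torus_emb x))) \<le> norm (B * cmod (f x))"
          by (simp add: norm_mult abs_mult mult.commute)
      qed
    qed measurable
    have "cmod (\<integral>x. f x * of_real (\<psi> (torus_emb x)) \<partial>torus) \<le> e * L" if e: "e > 0" for e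
    proof -
      obtain q where q: "trig_poly q" "\<And>x. Im (q x) = 0" "\<And>x. x \<in> unit_cube \<Longrightarrow> \<bar>\<psi> (torus_emb x) - Re (q x)\<bar> < e"
        using trig_poly_dense[OF \<psi>' e] by blast
      note q0 = integral_trig_poly_eq_0[OF f 0 q(1)]
      have "(\<integral>x. f x * of_real (\<psi> (torus_emb x)) \<partial>torus)
        = (\<integral>x. f x * of_real (\<psi> (torus_emb x)) - f x * q x \<partial>torus)"
        using q0 int by (subst Bochner_Integration.integral_diff) auto
      also have "cmod \<dots> \<le> (\<integral>x. cmod (f x * of_real (\<psi> (torus_emb x)) - f x * q x) \<partial>torus)"
        by (rule integral_norm_bound)
      also have "\<dots> \<le> (\<integral>x. e * cmod (f x) \<partial>torus)"
      proof (rule integral_mono)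
        show "integrable torus (\<lambda>x. cmod (f x * of_real (\<psi> (torus_emb x)) - f x * q x))"
          using q0 int by auto
        show "integrable torus (\<lambda>x. e * cmod (f x))" using f by simp
        fix x :: "real^'d" assume x: "x \<in> space torus"
        have "f x * of_real (\<psi> (torus_emb x)) - f x * q x
            = f x * of_real (\<psi> (torus_emb x) - Re (q x))"
          using q(2)[of x] by (simp add: complex_eq_iff algebra_simps)
        then have "cmod (f x * of_real (\<psi> (torus_emb x)) - f x * q x)
            = cmod (f x) * \<bar>\<psi> (torus_emb x) - Re (q x)\<bar>"
          by (simp only: norm_mult norm_of_real)
        also have "\<dots> \<le> cmod (f x) * e"
          using q(3)[of x] x by (intro mult_left_mono) auto
        finally show "cmod (f x * of_real (\<psi> (torus_emb x)) - f x * q x) \<le> e * cmod (f x)"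
          by (simp add: mult.commute)
      qed
      also have "\<dots> = e * L" by (simp add: L_def)
      finally show ?thesis .
    qed
    note b = this
    \<comment> \<open>Dividing by \<open>L + 1\<close> instead of \<open>L\<close> also covers
      \<open>L = 0\<close>.\<close>
    have "cmod (\<integral>x. f x * of_real (\<psi> (torus_emb x)) \<partial>torus) \<le> 0 + e" if "e > 0" for e
      using b[of "e / (L + 1)"] that L by (simp add: field_simps) (smt (verit) mult_left_mono mult_nonneg_nonneg)
    then show ?thesis using field_le_epsilon[of "cmod (\<integral>x. f x * of_real (\<psi> (torus_emb x)) \<partial>torus)" 0] by simp
  qed
  define D where "D = torus_emb ` C"
  have D: "compact D" unfolding D_def by (intro compact_continuous_image continuous_torus_emb C)
  have Dne: "D \<noteq> {}" using C by (simp add: D_def)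
  \<comment> \<open>Urysohn functions of \<open>D\<close>: equal to 1 on \<open>D\<close>, and
    eventually 0 at each point at positive distance from it.\<close>
  define \<psi> where "\<psi> n z = max 0 (1 - real n * infdist z D)" for n z
  have \<psi>c: "continuous_on UNIV (\<psi> n)" for n
    unfolding \<psi>_def by (intro continuous_intros)
  have \<psi>m [measurable]: "\<psi> n \<in> borel_measurable borel" for n by (rule borel_measurable_continuous_onI[OF \<psi>c])
  have Cm [measurable]: "C \<in> sets borel" using C(1) by (simp add: borel_compact)
  have "(\<lambda>n. \<integral>x. f x * of_real (\<psi> n (torus_emb x)) \<partial>torus) \<longlonglongrightarrow> (\<integral>x. f x * indicator C x \<partial>torus)"
  proof (rule integral_dominated_convergence[where w = "\<lambda>x. cmod (f x)"])
    show "AE x in torus. (\<lambda>n. f x * of_real (\<psi> n (torus_emb x))) \<longlonglongrightarrow> f x * indicator C x"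
      using AE_torus_box
    proof (eventually_elim)
      fix x :: "real^'d" assume x: "x \<in> box 0 1"
      have "(\<lambda>n. \<psi> n (torus_emb x)) \<longlonglongrightarrow> indicator C x"
      proof (cases "x \<in> C")
        case True
        then have "infdist (torus_emb x) D = 0" by (simp add: D_def)
        then show ?thesis using True by (simp add: \<psi>_def)
      next
        case False
        have "torus_emb x \<notin> D"
        proof
          assume "torus_emb x \<in> D"
          then obtain y where y: "y \<in> C" "torus_emb x = torus_emb y" by (auto simp: D_def)
          have "y \<in> unit_cube" using y(1) C(2) box_subset_cbox unfolding unit_cube_def by blast
          then have "x = y" using inj_torus_emb[OF x _ y(2)] by blast
          then show False using False y(1) by simp
        qed
        then have d: "infdist (torus_emb x) D > 0"
          using in_closed_iff_infdist_zero[OF compact_imp_closed[OF D] Dne, of "torus_emb x"] infdist_nonneg[of "torus_emb x" D] by linarith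
        obtain N :: nat where N: "1 / infdist (torus_emb x) D < real N" using reals_Archimedean2 by blast
        have "\<psi> n (torus_emb x) = 0" if "n \<ge> N" for n
        proof -
          have "1 < real N * infdist (torus_emb x) D" using N d by (simp add: field_simps)
          also have "\<dots> \<le> real n * infdist (torus_emb x) D" using that d by simp
          finally show ?thesis by (simp add: \<psi>_def)
        qed
        then have "\<forall>\<^sub>F n in sequentially. \<psi> n (torus_emb x) = 0" by (auto simp: eventually_sequentially)
        then have "(\<lambda>n. \<psi> n (torus_emb x)) \<longlonglongrightarrow> 0" by (rule tendsto_eventually)
        then show ?thesis using False by simp
      qed
      then have "(\<lambda>n. f x * of_real (\<psi> n (torus_emb x))) \<longlonglongrightarrow> f x * of_real (indicator C x)"
        by (intro tendsto_intros)
      then show "(\<lambda>n. f x * of_real (\<psi> n (torus_emb x))) \<longlonglongrightarrow> f x * indicator C x"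
        by (cases "x \<in> C") simp_all
    qed
    have "\<bar>\<psi> n z\<bar> \<le> 1" for n z unfolding \<psi>_def using infdist_nonneg[of z D] by auto
    then show "AE x in torus. norm (f x * of_real (\<psi> n (torus_emb x))) \<le> cmod (f x)" for n
      by (auto simp: norm_mult intro!: mult_left_le AE_I2)
    show "integrable torus (\<lambda>x. cmod (f x))" using f by simp
  qed measurable
  then show ?thesis using cont0[OF \<psi>c] by (simp add: LIMSEQ_const_iff)
qed

text \<open>Inner regularity: on a compact subset of the set where \<open>g\<close> is positive, a
  vanishing integral forces measure zero, and the measure of the whole set is the supremum over its
  compact subsets.\<close>

lemma AE_nonpos_if_compact_integrals:
  fixes g :: "real^'d \<Rightarrow> real"
  assumes g: "integrable torus g"
    and 0: "\<And>C. compact C \<Longrightarrow> C \<subseteq> box 0 1 \<Longrightarrow> C \<noteq> {} \<Longrightarrow> (\<integral>x. g x * indicator C x \<partial>torus) = 0"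
  shows "AE x in torus. g x \<le> 0"
proof -
  have gm [measurable]: "g \<in> borel_measurable torus" using g by simp
  define A where "A = {x \<in> space torus. x \<in> box 0 1 \<and> 0 < g x}"
  have A [measurable]: "A \<in> sets torus" unfolding A_def by measurable
  have Ab: "A \<in> sets borel" using A unfolding torus_def by (auto simp: sets_restrict_space)
  \<comment> \<open>Inner regularity concerns measures on the Borel sets of the whole space, so
    \<open>torus\<close> is pushed forward by the identity.\<close>
  define N where "N = distr torus borel (\<lambda>x::real^'d. x)"
  have N: "emeasure N K = emeasure torus (K \<inter> unit_cube)" if "K \<in> sets borel" for K
    unfolding N_def using that by (subst emeasure_distr) auto
  have idm: "(\<lambda>x::real^'d. x) \<in> torus \<rightarrow>\<^sub>M borel" by measurable
  have AU: "A \<subseteq> unit_cube" by (auto simp: A_def)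
  have "emeasure N A = (SUP K \<in> {K. K \<subseteq> A \<and> compact K}. emeasure N K)"
    by (rule inner_regular) (use Ab in \<open>auto simp: N_def emeasure_distr[OF idm] emeasure_torus_space\<close>)
  also have "\<dots> \<le> 0"
  proof (rule SUP_least)
    fix K assume K: "K \<in> {K. K \<subseteq> A \<and> compact K}"
    show "emeasure N K \<le> 0"
    proof (cases "K = {}")
      case False
      have KU: "K \<subseteq> unit_cube" and Kb: "K \<subseteq> box 0 1" using K by (auto simp: A_def)
      have Ks: "K \<in> sets borel" using K by (auto intro: borel_compact)
      have Km [measurable]: "K \<in> sets torus"
        using KU Ks unfolding torus_def by (auto simp: sets_restrict_space image_iff intro!: bexI[of _ K])
      have i: "integrable torus (\<lambda>x. g x * indicator K x)"
        using integrable_mult_indicator[OF Km g] by (simp add: mult.commute)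
      have "AE x in torus. g x * indicator K x = 0"
        using 0[OF _ Kb False] K by (subst integral_nonneg_eq_0_iff_AE[OF i, symmetric]) (auto simp: A_def indicator_def intro!: AE_I2)
      then have "AE x in torus. x \<notin> K"
        by (rule AE_mp) (use K in \<open>auto simp: A_def indicator_def intro!: AE_I2\<close>)
      then have "K \<in> null_sets torus" by (subst AE_iff_null_sets[OF Km])
      then show ?thesis using N[OF Ks] KU by (simp add: null_sets_def Int_absorb2)
    qed simp
  qed
  finally have "emeasure torus A = 0" using N[OF Ab] AU by (simp add: Int_absorb2)
  then have "A \<in> null_sets torus" using A by (auto simp: null_sets_def)
  then have "AE x in torus. x \<notin> A" by (rule AE_not_in)
  then show ?thesis using AE_torus_box AE_space by eventually_elim (auto simp: A_def)
qed

lemma fourier_unique: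
  fixes f :: "real^'d \<Rightarrow> complex"
  assumes f: "integrable torus f" and 0: "\<And>k. (\<integral>x. f x * chr k x \<partial>torus) = 0"
  shows "AE x in torus. f x = 0"
proof -
  have C: "(\<integral>x. f x * indicator C x \<partial>torus) = 0" "integrable torus (\<lambda>x. f x * indicator C x)"
    if "compact C" "C \<subseteq> box 0 1" "C \<noteq> {}" for C
  proof -
    show "(\<integral>x. f x * indicator C x \<partial>torus) = 0" by (rule integral_compact_eq_0[OF f 0 that])
    have [measurable]: "C \<in> sets borel" using that by (auto intro: borel_compact)
    have [measurable]: "f \<in> borel_measurable torus" using f by simp
    show "integrable torus (\<lambda>x. f x * indicator C x)"
      by (rule Bochner_Integration.integrable_bound[OF f]) (auto simp: indicator_def)
  qed
  have ir: "complex_of_real (indicator C x) = indicator C x" "Re (indicator C x) = indicator C x" "Im (indicator C x) = 0" for C :: "(real^'d) set" and x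
    by (auto simp: indicator_def)
  have R: "(\<integral>x. Re (f x) * indicator C x \<partial>torus) = 0" "(\<integral>x. Im (f x) * indicator C x \<partial>torus) = 0"
    if "compact C" "C \<subseteq> box 0 1" "C \<noteq> {}" for C
    using integral_Re[OF C(2)[OF that]] integral_Im[OF C(2)[OF that]] C(1)[OF that] by (simp_all add: ir)
  have "AE x in torus. Re (f x) \<le> 0"
    by (rule AE_nonpos_if_compact_integrals) (use f R in auto)
  moreover have "AE x in torus. - Re (f x) \<le> 0"
    by (rule AE_nonpos_if_compact_integrals) (use f R in auto)
  moreover have "AE x in torus. Im (f x) \<le> 0"
    by (rule AE_nonpos_if_compact_integrals) (use f R in auto)
  moreover have "AE x in torus. - Im (f x) \<le> 0"
    by (rule AE_nonpos_if_compact_integrals) (use f R in auto)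
  ultimately show ?thesis
    by eventually_elim (simp add: complex_eq_iff)
qed

section \<open>Absolutely convergent Fourier series\<close>

text \<open>Boxes instead of balls, because sums of products over a box factor into one-dimensional
  sums. They exhaust all frequencies along a sequence, which makes limit theorems for sequences
  applicable to unconditional sums.\<close>

definition fbox :: "nat \<Rightarrow> (int^'d) set" where
  "fbox n = {k. \<forall>j. \<bar>k $ j\<bar> \<le> int n}"

lemma fbox_eq_image: "fbox n = vec_lambda ` (PiE UNIV (\<lambda>_. {- int n..int n}))"
proof (intro equalityI subsetI)
  fix k :: "int^'d" assume "k \<in> fbox n"
  then have "vec_nth k \<in> PiE UNIV (\<lambda>_. {- int n..int n})" by (auto simp: fbox_def abs_le_iff minus_le_iff)
  then show "k \<in> vec_lambda ` (PiE UNIV (\<lambda>_. {- int n..int n}))" by (metis image_eqI vec_nth_inverse)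
next
  fix k :: "int^'d" assume "k \<in> vec_lambda ` (PiE UNIV (\<lambda>_. {- int n..int n}))"
  then show "k \<in> fbox n" by (auto simp: fbox_def abs_le_iff PiE_iff) (metis atLeastAtMost_iff minus_le_iff)
qed

lemma finite_fbox [simp]: "finite (fbox n)"
  unfolding fbox_eq_image by (intro finite_imageI finite_PiE) auto

lemma sum_prod_fbox:
  fixes f :: "int \<Rightarrow> real"
  shows "(\<Sum>k\<in>(fbox n :: (int^'d) set). \<Prod>j\<in>UNIV. f (k $ j)) = (\<Sum>m=-int n..int n. f m) ^ CARD('d)"
proof -
  have "(\<Sum>k\<in>(fbox n :: (int^'d) set). \<Prod>j\<in>UNIV. f (k $ j)) = (\<Sum>g\<in>PiE (UNIV::'d set) (\<lambda>_. {-int n..int n}). \<Prod>j\<in>UNIV. f (g j))"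
    unfolding fbox_eq_image
    by (subst sum.reindex) (auto intro!: inj_onI simp: vec_lambda_inject)
  also have "\<dots> = (\<Prod>j\<in>(UNIV::'d set). \<Sum>m=-int n..int n. f m)"
    by (rule prod_sum_PiE[symmetric]) auto
  finally show ?thesis by simp
qed

lemma card_fbox: "real (card (fbox n :: (int^'d) set)) = (2 * real n + 1) ^ CARD('d)"
  using sum_prod_fbox[where 'd='d, of "\<lambda>_. 1" n] by (simp add: add.commute)

lemma fbox_mono: "m \<le> n \<Longrightarrow> fbox m \<subseteq> fbox n"
  unfolding fbox_def by (auto intro: order_trans)

lemma finite_subset_fbox:
  assumes "finite (F :: (int^'d) set)" obtains n where "F \<subseteq> fbox n"
proof -
  have "\<exists>n. F \<subseteq> fbox n" using assms
  proof induction
    case empty then show ?case by simp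
  next
    case (insert k F)
    then obtain n where n: "F \<subseteq> fbox n" by blast
    define m where "m = nat (\<Sum>j\<in>UNIV. \<bar>k $ j\<bar>)"
    have "\<bar>k $ j\<bar> \<le> int m" for j
      unfolding m_def using member_le_sum[of j UNIV "\<lambda>j. \<bar>k $ j\<bar>"] by (simp add: sum_nonneg)
    then have "k \<in> fbox m" by (simp add: fbox_def)
    then have "insert k F \<subseteq> fbox (max m n)" using n fbox_mono[of m "max m n"] fbox_mono[of n "max m n"] by auto
    then show ?case by blast
  qed
  then show ?thesis using that by blast
qed

lemma filterlim_fbox: "filterlim (fbox :: nat \<Rightarrow> (int^'d) set) (finite_subsets_at_top UNIV) sequentially"
proof (rule filterlim_finite_subsets_at_top[THEN iffD2], intro allI impI)
  fix F :: "(int^'d) set" assume "finite F \<and> F \<subseteq> UNIV"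
  then obtain n where "F \<subseteq> fbox n" using finite_subset_fbox by blast
  then have "\<forall>m\<ge>n. F \<subseteq> fbox m" using fbox_mono by blast
  then show "\<forall>\<^sub>F x in sequentially. finite (fbox x) \<and> F \<subseteq> fbox x \<and> fbox x \<subseteq> UNIV"
    by (auto simp: eventually_sequentially)
qed

lemma has_sum_fbox: "(f has_sum S) (UNIV :: (int^'d) set) \<Longrightarrow> (\<lambda>n. \<Sum>k\<in>fbox n. f k) \<longlonglongrightarrow> S"
  unfolding has_sum_def using filterlim_compose[OF _ filterlim_fbox] by blast

text \<open>The error term telescopes, which makes the induction go through.\<close>

lemma sum_inverse_squares_bound: "(\<Sum>m=-int n..int n. 1 / (1 + (real_of_int m)^2)) \<le> 5 - 4 / (2 * real n + 1)"
proof (induction n)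
  case 0 then show ?case by simp
next
  case (Suc n)
  have "{-int (Suc n)..int (Suc n)} = insert (- int (Suc n)) (insert (int (Suc n)) {-int n..int n})" by auto
  then have "(\<Sum>m=-int (Suc n)..int (Suc n). 1 / (1 + (real_of_int m)^2))
     = 2 / (1 + (real n + 1)^2) + (\<Sum>m=-int n..int n. 1 / (1 + (real_of_int m)^2))"
    by (simp add: power2_eq_square algebra_simps add_divide_distrib [symmetric])
  also have "\<dots> \<le> 2 / (1 + (real n + 1)^2) + (5 - 4 / (2 * real n + 1))" using Suc by simp
  also have "2 / (1 + (real n + 1)^2) \<le> 8 / ((2 * real n + 1) * (2 * real n + 3))"
  proof -
    have "2 / (1 + (real n + 1)^2) = 8 / (4 * (1 + (real n + 1)^2))" by (subst mult_divide_mult_cancel_left[of 4 2, symmetric]) simp_all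
    also have "\<dots> \<le> 8 / ((2 * real n + 1) * (2 * real n + 3))"
    proof (rule frac_le)
      show "0 < (2 * real n + 1) * (2 * real n + 3)" by (intro mult_pos_pos) auto
    qed (auto simp: power2_eq_square algebra_simps)
    finally show ?thesis .
  qed
  also have "\<dots> = 4 / (2 * real n + 1) - 4 / (2 * real n + 3)" by (simp add: field_simps)
  finally show ?case by (simp add: algebra_simps)
qed

section \<open>Sobolev weights and absolute convergence\<close>

definition wt :: "int^'d \<Rightarrow> real" where "wt k = 1 + (norm (kvec k))^2"

lemma wt_ge_1: "1 \<le> wt k" by (simp add: wt_def)

lemma norm_kvec_power2: "(norm (kvec k))^2 = (\<Sum>j\<in>UNIV. (real_of_int (k $ j))^2)"
  by (simp add: norm_vec_def L2_set_def kvec_def sum_nonneg)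

lemma prod_le_wt: "(\<Prod>j\<in>UNIV. 1 + (real_of_int ((k :: int^'d) $ j))^2) \<le> wt k ^ CARD('d)"
proof -
  have "(\<Prod>j\<in>UNIV. 1 + (real_of_int (k $ j))^2) \<le> (\<Prod>j\<in>(UNIV::'d set). wt k)"
  proof (rule prod_mono, intro conjI)
    fix j :: 'd
    show "1 + (real_of_int (k $ j))^2 \<le> wt k"
      unfolding wt_def norm_kvec_power2 using member_le_sum[of j UNIV "\<lambda>j. (real_of_int (k $ j))^2"] by simp
  qed simp
  then show ?thesis by simp
qed

text \<open>By \<open>prod_le_wt\<close> each term is at most a product of one-dimensional terms,
  and each one-dimensional sum stays below 5.\<close>

lemma sum_wt_bound:
  assumes "finite (F :: (int^'d) set)"
  shows "(\<Sum>k\<in>F. 1 / wt k ^ CARD('d)) \<le> 5 ^ CARD('d)"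
proof -
  obtain n where n: "F \<subseteq> fbox n" using assms finite_subset_fbox by blast
  have wp: "0 < wt k" for k :: "int^'d" using wt_ge_1[of k] by simp
  have pp: "0 < (\<Prod>j\<in>UNIV. 1 + (real_of_int ((k :: int^'d) $ j))^2)" for k
    by (intro prod_pos) (simp add: add_pos_nonneg)
  have "(\<Sum>k\<in>F. 1 / wt k ^ CARD('d)) \<le> (\<Sum>k\<in>(fbox n :: (int^'d) set). 1 / wt k ^ CARD('d))"
    using n by (intro sum_mono2) (auto simp: less_imp_le[OF wp])
  also have "\<dots> \<le> (\<Sum>k\<in>(fbox n :: (int^'d) set). \<Prod>j\<in>UNIV. 1 / (1 + (real_of_int (k $ j))^2))"
    unfolding prod_dividef by (intro sum_mono) (simp add: frac_le[OF _ _ pp prod_le_wt])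
  also have "\<dots> = (\<Sum>m=-int n..int n. 1 / (1 + (real_of_int m)^2)) ^ CARD('d)"
    by (rule sum_prod_fbox)
  also have "\<dots> \<le> 5 ^ CARD('d)"
  proof (rule power_mono)
    have "0 \<le> 4 / (2 * real n + 1)" by simp
    then show "(\<Sum>m=-int n..int n. 1 / (1 + (real_of_int m)^2)) \<le> 5" using sum_inverse_squares_bound[of n] by linarith
  qed (simp add: sum_nonneg)
  finally show ?thesis .
qed

text \<open>Cauchy-Schwarz after inserting the weight and its inverse: the embedding of the Sobolev
  space of order d into absolutely convergent Fourier series.\<close>

lemma abs_summable_of_weighted:
  fixes c :: "int^'d \<Rightarrow> complex"
  assumes "\<And>F. finite F \<Longrightarrow> (\<Sum>k\<in>F. wt k ^ CARD('d) * (cmod (c k))^2) \<le> Q"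
  shows "(\<lambda>k. cmod (c k)) summable_on UNIV"
proof (rule nonneg_bdd_above_summable_on)
  have wp: "0 < wt k" for k :: "int^'d" using wt_ge_1[of k] by simp
  have Q0: "0 \<le> Q" using assms[of "{}"] by simp
  have "(\<Sum>k\<in>F. cmod (c k)) \<le> sqrt (5 ^ CARD('d) * Q)" if F: "finite F" for F :: "(int^'d) set"
  proof (rule real_le_rsqrt)
    have "(\<Sum>k\<in>F. cmod (c k)) = (\<Sum>k\<in>F. sqrt (1 / wt k ^ CARD('d)) * (sqrt (wt k ^ CARD('d)) * cmod (c k)))"
      using wp by (intro sum.cong) (auto simp: real_sqrt_divide less_imp_neq[OF wp, symmetric])
    then have "(\<Sum>k\<in>F. cmod (c k))^2 \<le> (\<Sum>k\<in>F. (sqrt (1 / wt k ^ CARD('d)))^2) * (\<Sum>k\<in>F. (sqrt (wt k ^ CARD('d)) * cmod (c k))^2)"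
      by (simp only: Cauchy_Schwarz_ineq_sum)
    also have "\<dots> = (\<Sum>k\<in>F. 1 / wt k ^ CARD('d)) * (\<Sum>k\<in>F. wt k ^ CARD('d) * (cmod (c k))^2)"
      using wp by (simp add: power_mult_distrib less_imp_le)
    also have "\<dots> \<le> 5 ^ CARD('d) * Q"
      by (intro mult_mono sum_wt_bound assms F sum_nonneg) (auto simp: less_imp_le[OF wp])
    finally show "(\<Sum>k\<in>F. cmod (c k))^2 \<le> 5 ^ CARD('d) * Q" .
  qed
  then show "bdd_above (sum (\<lambda>k. cmod (c k)) ` {F. F \<subseteq> UNIV \<and> finite F})"
    by (intro bdd_aboveI2) auto
qed simp

text \<open>The series converges uniformly to some \<open>S\<close> that has the coefficients of
  \<open>u\<close>, so \<open>u = S\<close> almost everywhere by \<open>fourier_unique\<close>, and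
  the defect of the partial sums is at most the squared tail.\<close>

lemma parseval_limit:
  fixes u :: "real^'d \<Rightarrow> real"
  assumes u: "L2cube u" and s: "(\<lambda>k. cmod (fc u k)) summable_on UNIV"
  shows "(\<lambda>n. \<Sum>k\<in>fbox n. (cmod (fc u k))^2) \<longlonglongrightarrow> (L2norm u)^2"
proof -
  define p where "p n x = (\<Sum>k\<in>fbox n. fc u k * chr k x)" for n x
  define S where "S x = (\<Sum>\<^sub>\<infinity>k. fc u k * chr k x)" for x
  define tail where "tail n = (\<Sum>\<^sub>\<infinity>k. cmod (fc u k)) - (\<Sum>k\<in>fbox n. cmod (fc u k))" for n
  have tail0: "tail \<longlonglongrightarrow> 0"
    using tendsto_diff[OF tendsto_const has_sum_fbox[OF has_sum_infsum[OF s]], of "\<Sum>\<^sub>\<infinity>k. cmod (fc u k)"]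
    by (simp add: tail_def[abs_def])
  have abs: "(\<lambda>k. cmod (fc u k * chr k x)) summable_on UNIV" for x using s by (simp add: norm_mult)
  have pS: "cmod (S x - p n x) \<le> tail n" for n x
  proof -
    have "S x - p n x = (\<Sum>\<^sub>\<infinity>k\<in>UNIV - fbox n. fc u k * chr k x)"
      unfolding S_def p_def
      by (subst infsum_Diff) (auto intro: abs_summable_summable[OF abs])
    also have "cmod \<dots> \<le> (\<Sum>\<^sub>\<infinity>k\<in>UNIV - fbox n. cmod (fc u k * chr k x))"
      by (rule norm_infsum_bound) (rule summable_on_subset_banach[OF abs], simp)
    also have "\<dots> = (\<Sum>\<^sub>\<infinity>k\<in>UNIV - fbox n. cmod (fc u k))" by (simp add: norm_mult)
    also have "\<dots> = tail n" unfolding tail_def by (subst infsum_Diff) (auto intro: s)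
    finally show ?thesis .
  qed
  have [measurable]: "p n \<in> borel_measurable borel" for n unfolding p_def by measurable
  have lim: "(\<lambda>n. p n x) \<longlonglongrightarrow> S x" for x
    unfolding p_def S_def by (rule has_sum_fbox) (rule has_sum_infsum[OF abs_summable_summable[OF abs]])
  have [measurable]: "S \<in> borel_measurable borel"
    by (rule borel_measurable_LIMSEQ_metric[OF _ lim]) measurable
  have Sb: "cmod (S x) \<le> (\<Sum>\<^sub>\<infinity>k. cmod (fc u k))" for x
    unfolding S_def using norm_infsum_bound[OF abs[of x]] by (simp add: norm_mult)
  have Si: "integrable torus S" by (rule integrable_torus_bounded[OF _ Sb]) measurable
  have pi: "integrable torus (p n)" for n unfolding p_def by (rule integrable_trig_sum)
  have um [measurable]: "u \<in> borel_measurable borel" using u by (simp add: L2cube_iff)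
  have ui: "integrable torus u" by (rule L2cube_integrable[OF u])
  have coeff: "(\<integral>x. S x * cnj (chr m x) \<partial>torus) = fc u m" for m
  proof -
    have pm: "(\<integral>x. p n x * cnj (chr m x) \<partial>torus) = (if m \<in> fbox n then fc u m else 0)" for n
    proof -
      have "(\<integral>x. p n x * cnj (chr m x) \<partial>torus) = (\<integral>x. (\<Sum>k\<in>fbox n. fc u k * (chr k x * cnj (chr m x))) \<partial>torus)"
        by (simp only: p_def sum_distrib_right mult.assoc)
      also have "\<dots> = (\<Sum>k\<in>fbox n. fc u k * (if k = m then 1 else 0))"
        by (subst Bochner_Integration.integral_sum) (auto simp: integral_chr_cnj)
      also have "\<dots> = (if m \<in> fbox n then fc u m else 0)" by (simp add: if_distrib sum.delta cong: if_cong)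
      finally show ?thesis .
    qed
    have b: "cmod ((\<integral>x. p n x * cnj (chr m x) \<partial>torus) - (\<integral>x. S x * cnj (chr m x) \<partial>torus)) \<le> tail n" for n
    proof -
      have "(\<integral>x. p n x * cnj (chr m x) \<partial>torus) - (\<integral>x. S x * cnj (chr m x) \<partial>torus) = (\<integral>x. p n x * cnj (chr m x) - S x * cnj (chr m x) \<partial>torus)"
        by (rule Bochner_Integration.integral_diff[symmetric]) (intro integrable_times_chr pi Si)+
      also have "cmod \<dots> \<le> (\<integral>x. cmod (p n x * cnj (chr m x) - S x * cnj (chr m x)) \<partial>torus)"
        by (rule integral_norm_bound)
      also have "\<dots> \<le> (\<integral>x. tail n \<partial>(torus :: (real^'d) measure))"
      proof (rule integral_mono)
        show "integrable torus (\<lambda>x. cmod (p n x * cnj (chr m x) - S x * cnj (chr m x)))"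
          by (intro integrable_norm Bochner_Integration.integrable_diff integrable_times_chr pi Si)
        fix x show "cmod (p n x * cnj (chr m x) - S x * cnj (chr m x)) \<le> tail n"
          using pS[of x n] by (simp add: left_diff_distrib [symmetric] norm_mult norm_minus_commute)
      qed simp
      finally show ?thesis by simp
    qed
    have "(\<lambda>n. (\<integral>x. p n x * cnj (chr m x) \<partial>torus) - (\<integral>x. S x * cnj (chr m x) \<partial>torus)) \<longlonglongrightarrow> 0"
      by (rule Lim_null_comparison[OF _ tail0]) (use b in auto)
    then have 1: "(\<lambda>n. \<integral>x. p n x * cnj (chr m x) \<partial>torus) \<longlonglongrightarrow> (\<integral>x. S x * cnj (chr m x) \<partial>torus)"
      by (rule LIM_zero_cancel)
    obtain N where "{m} \<subseteq> fbox N" using finite_subset_fbox[of "{m}"] by auto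
    then have "\<forall>n\<ge>N. m \<in> fbox n" using fbox_mono by blast
    then have "\<forall>\<^sub>F n in sequentially. (\<integral>x. p n x * cnj (chr m x) \<partial>torus) = fc u m"
      unfolding pm eventually_sequentially by auto
    then have 2: "(\<lambda>n. \<integral>x. p n x * cnj (chr m x) \<partial>torus) \<longlonglongrightarrow> fc u m" by (rule tendsto_eventually)
    show ?thesis using LIMSEQ_unique[OF 1 2] .
  qed
  have "AE x in torus. of_real (u x) - S x = 0"
  proof (rule fourier_unique)
    show "integrable torus (\<lambda>x. of_real (u x) - S x)" using ui Si by auto
    fix k
    have "(\<integral>x. (of_real (u x) - S x) * chr k x \<partial>torus)
        = (\<integral>x. of_real (u x) * cnj (chr (- k) x) - S x * cnj (chr (- k) x) \<partial>torus)"
      by (simp add: cnj_chr left_diff_distrib)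
    also have "\<dots> = 0"
      by (subst Bochner_Integration.integral_diff)
        (auto intro!: integrable_fc integrable_times_chr ui Si simp: coeff simp flip: fc_eq)
    finally show "(\<integral>x. (of_real (u x) - S x) * chr k x \<partial>torus) = 0" .
  qed
  then have AE: "AE x in torus. of_real (u x) = S x" by simp
  have "\<bar>(L2norm u)^2 - (\<Sum>k\<in>fbox n. (cmod (fc u k))^2)\<bar> \<le> (tail n)^2" for n
  proof -
    have "(L2norm u)^2 - (\<Sum>k\<in>fbox n. (cmod (fc u k))^2) = (\<integral>x. (cmod (of_real (u x) - p n x))^2 \<partial>torus)"
      unfolding p_def by (rule fourier_defect(2)[symmetric]) (auto simp: u)
    also have "\<dots> = (\<integral>x. (cmod (S x - p n x))^2 \<partial>torus)"
      by (rule integral_cong_AE) (use AE in \<open>auto\<close>)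
    finally have e: "(L2norm u)^2 - (\<Sum>k\<in>fbox n. (cmod (fc u k))^2) = (\<integral>x. (cmod (S x - p n x))^2 \<partial>torus)" .
    also have "\<dots> \<le> (\<integral>x. (tail n)^2 \<partial>(torus :: (real^'d) measure))"
    proof (rule integral_mono)
      show "integrable torus (\<lambda>x. (cmod (S x - p n x))^2)"
        by (rule integrable_torus_bounded[of _ "(tail n)^2"]) (auto intro!: power_mono pS)
      show "(cmod (S x - p n x))^2 \<le> (tail n)^2" for x by (intro power_mono pS) simp
    qed simp
    finally have "(L2norm u)^2 - (\<Sum>k\<in>fbox n. (cmod (fc u k))^2) \<le> (tail n)^2" by simp
    moreover have "0 \<le> (L2norm u)^2 - (\<Sum>k\<in>fbox n. (cmod (fc u k))^2)" unfolding e by simp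
    ultimately show ?thesis by simp
  qed
  then have "\<forall>\<^sub>F n in sequentially. norm ((\<Sum>k\<in>fbox n. (cmod (fc u k))^2) - (L2norm u)^2) \<le> (tail n)^2"
    by (simp add: abs_minus_commute)
  moreover have "(\<lambda>n. (tail n)^2) \<longlonglongrightarrow> 0" using tendsto_power[OF tail0, of 2] by simp
  ultimately have "(\<lambda>n. (\<Sum>k\<in>fbox n. (cmod (fc u k))^2) - (L2norm u)^2) \<longlonglongrightarrow> 0"
    by (rule Lim_null_comparison)
  then show ?thesis by (rule LIM_zero_cancel)
qed

text \<open>Taking \<open>Re\<close> makes the truncation real by construction, and since
  \<open>u\<close> is real it cannot increase the distance to \<open>u\<close>.\<close>

definition fpart :: "nat \<Rightarrow> (real^'d \<Rightarrow> real) \<Rightarrow> real^'d \<Rightarrow> real" where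
  "fpart n u x = Re (\<Sum>k\<in>fbox n. fc u k * chr k x)"

lemma fpart_bounded: "\<bar>fpart n u x\<bar> \<le> (\<Sum>k\<in>fbox n. cmod (fc u k))"
  unfolding fpart_def by (rule order_trans[OF abs_Re_le_cmod trig_sum_le])

lemma fpart_measurable [measurable]: "fpart n u \<in> borel_measurable borel"
  unfolding fpart_def by measurable

lemma L2cube_fpart: "L2cube (fpart n u)"
  unfolding L2cube_iff
proof
  show "integrable torus (\<lambda>x. (fpart n u x)^2)"
  proof (rule integrable_torus_bounded)
    fix x show "norm ((fpart n u x)^2) \<le> (\<Sum>k\<in>fbox n. cmod (fc u k))^2"
      using power_mono[OF fpart_bounded[of n u x], of 2] by simp
  qed measurable
qed measurable

lemma L2cube_diff:
  assumes "L2cube u" "L2cube v" shows "L2cube (\<lambda>x. u x - v x)"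
proof -
  have [measurable]: "u \<in> borel_measurable borel" "v \<in> borel_measurable borel" using assms by (auto simp: L2cube_iff)
  have "integrable torus (\<lambda>x. u x * v x)"
    by (rule integral_Cauchy_Schwarz_real) (use assms in \<open>auto simp: L2cube_iff\<close>)
  then have "integrable torus (\<lambda>x. (u x)^2 + (v x)^2 - 2 * (u x * v x))"
    using assms by (auto simp: L2cube_iff)
  then show ?thesis unfolding L2cube_iff by (simp add: power2_diff mult.assoc)
qed

lemma fpart_tendsto:
  fixes u :: "real^'d \<Rightarrow> real"
  assumes u: "L2cube u" and s: "(\<lambda>k. cmod (fc u k)) summable_on UNIV"
  shows "(\<lambda>n. L2norm (\<lambda>x. u x - fpart n u x)) \<longlonglongrightarrow> 0"
proof -
  define d where "d n = (L2norm u)^2 - (\<Sum>k\<in>fbox n. (cmod (fc u k))^2)" for n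
  have d0: "d \<longlonglongrightarrow> 0"
    using tendsto_diff[OF tendsto_const parseval_limit[OF u s], of "(L2norm u)^2"] by (simp add: d_def[abs_def])
  have le: "L2norm (\<lambda>x. u x - fpart n u x) \<le> sqrt (d n)" for n
  proof -
    define p where "p x = (\<Sum>k\<in>fbox n. fc u k * chr k x)" for x
    have "(L2norm (\<lambda>x. u x - fpart n u x))^2 \<le> (\<integral>x. (cmod (of_real (u x) - p x))^2 \<partial>torus)"
      unfolding L2norm_power2
    proof (rule integral_mono)
      show "integrable torus (\<lambda>x. (u x - fpart n u x)^2)"
        using L2cube_diff[OF u L2cube_fpart] by (simp add: L2cube_iff)
      fix x
      have "\<bar>u x - fpart n u x\<bar> \<le> cmod (of_real (u x) - p x)"
        using abs_Re_le_cmod[of "complex_of_real (u x) - p x"] by (simp add: fpart_def p_def)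
      then show "(u x - fpart n u x)^2 \<le> (cmod (of_real (u x) - p x))^2"
        by (metis abs_norm_cancel abs_le_square_iff)
      show "integrable torus (\<lambda>x. (cmod (of_real (u x) - p x))^2)"
        unfolding p_def by (rule fourier_defect(1)[OF finite_fbox u])
    qed
    also have "\<dots> = d n" unfolding p_def d_def by (rule fourier_defect(2)[OF finite_fbox u])
    finally show ?thesis by (rule real_le_rsqrt)
  qed
  have "(\<lambda>n. sqrt (d n)) \<longlonglongrightarrow> 0" using tendsto_real_sqrt[OF d0] by simp
  then show ?thesis by (rule Lim_null_comparison[rotated]) (use le in auto)
qed

section \<open>Convolution with a bounded kernel\<close>

lemma lborel_distr_reflect: "distr lborel borel (\<lambda>y. x - y) = (lborel :: (real^'d) measure)"
  by (subst lborel_affine[of "-1" x]) (auto simp: density_1)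

lemma AE_lborel_reflect:
  assumes "AE z in lborel. P z" shows "AE y in lborel. P (x - y :: real^'d)"
proof (rule AE_distrD[where f = "\<lambda>y. x - y" and M' = borel])
  show "AE z in distr lborel borel (\<lambda>y. x - y). P z"
    unfolding lborel_distr_reflect by (rule assms)
qed measurable

lemma AE_lborel_shift:
  assumes "AE z in lborel. P z" shows "AE y in lborel. P (c + y :: real^'d)"
proof (rule AE_distrD[where f = "\<lambda>y. c + y" and M' = borel])
  show "AE z in distr lborel borel (\<lambda>y. c + y). P z"
    unfolding lborel_distr_plus by (rule assms)
qed measurable

text \<open>The kernel is evaluated at \<open>x - y\<close>, which leaves the cube, whereas its
  essential bound is given on the cube only. Countably many integer translates cover the space, so
  the exceptional sets together are still null.\<close>

lemma periodic1_AE: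
  fixes \<gamma> :: "real^'d \<Rightarrow> real"
  assumes per: "periodic1 \<gamma>" and ae: "AE x in lborel. x \<in> unit_cube \<longrightarrow> \<bar>\<gamma> x\<bar> \<le> B"
  shows "AE x in lborel. \<bar>\<gamma> x\<bar> \<le> B"
proof -
  have "AE x in lborel. - kvec m + x \<in> unit_cube \<longrightarrow> \<bar>\<gamma> (- kvec m + x)\<bar> \<le> B" for m :: "int^'d"
    by (rule AE_lborel_shift[OF ae])
  then have "AE x in lborel. \<forall>m. - kvec m + x \<in> unit_cube \<longrightarrow> \<bar>\<gamma> (- kvec m + x)\<bar> \<le> B"
    unfolding AE_all_countable by blast
  then show ?thesis
  proof eventually_elim
    fix x :: "real^'d"
    assume a: "\<forall>m. - kvec m + x \<in> unit_cube \<longrightarrow> \<bar>\<gamma> (- kvec m + x)\<bar> \<le> B"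
    define m :: "int^'d" where "m = (\<chi> j. \<lfloor>x $ j\<rfloor>)"
    have "- kvec m + x \<in> unit_cube"
    proof -
      have "0 \<le> x $ j - real_of_int \<lfloor>x $ j\<rfloor> \<and> x $ j - real_of_int \<lfloor>x $ j\<rfloor> \<le> 1" for j
        using floor_correct[of "x $ j"] by linarith
      then show ?thesis unfolding unit_cube_def mem_box_cart by (simp add: m_def kvec_def)
    qed
    with a have "\<bar>\<gamma> (- kvec m + x)\<bar> \<le> B" by blast
    moreover have "\<gamma> ((- kvec m + x) + (\<chi> j. of_int (m $ j))) = \<gamma> (- kvec m + x)"
      using per unfolding periodic1_def by blast
    moreover have "(- kvec m + x) + (\<chi> j. of_int (m $ j)) = x" by (simp add: kvec_def)
    ultimately show "\<bar>\<gamma> x\<bar> \<le> B" by simp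
  qed
qed

lemma conv_eq: "conv f g x = (\<integral>y. f (x - y) * g y \<partial>torus)"
  unfolding conv_def set_integral_torus ..

lemma AE_torus_reflect:
  assumes "AE z in lborel. \<bar>\<gamma> z\<bar> \<le> (M::real)" shows "AE y in torus. \<bar>\<gamma> (x - y :: real^'d)\<bar> \<le> M"
  unfolding torus_def
  by (subst AE_restrict_space_iff) (use AE_lborel_reflect[OF assms, of x] in \<open>auto\<close>)

lemma conv_integrable:
  fixes \<gamma> b :: "real^'d \<Rightarrow> real"
  assumes [measurable]: "\<gamma> \<in> borel_measurable borel" and ae: "AE z in lborel. \<bar>\<gamma> z\<bar> \<le> M" and b: "L2cube b"
  shows "integrable torus (\<lambda>y. \<gamma> (x - y) * b y)"
proof (rule Bochner_Integration.integrable_bound[of torus "\<lambda>y. M * b y"])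
  have [measurable]: "b \<in> borel_measurable borel" using b by (simp add: L2cube_iff)
  show "integrable torus (\<lambda>y. M * b y)" using L2cube_integrable[OF b] by simp
  show "AE y in torus. norm (\<gamma> (x - y) * b y) \<le> norm (M * b y)"
    using AE_torus_reflect[OF ae, of x] by eventually_elim (auto simp: abs_mult intro!: mult_right_mono)
  show "(\<lambda>y. \<gamma> (x - y) * b y) \<in> borel_measurable torus" by measurable
qed

text \<open>The kernel enters only through its essential bound, so keeping the gradient on the
  interaction potential costs no derivative of \<open>b\<close>. The L^1 norm of \<open>b\<close> is
  below its L^2 norm because the cube has measure one.\<close>

lemma conv_bound:
  fixes \<gamma> b :: "real^'d \<Rightarrow> real"
  assumes g [measurable]: "\<gamma> \<in> borel_measurable borel" and ae: "AE z in lborel. \<bar>\<gamma> z\<bar> \<le> M" and b: "L2cube b" and M: "0 \<le> M"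
  shows "\<bar>conv \<gamma> b x\<bar> \<le> M * L2norm b"
proof -
  have [measurable]: "b \<in> borel_measurable borel" using b by (simp add: L2cube_iff)
  have "\<bar>conv \<gamma> b x\<bar> \<le> (\<integral>y. \<bar>\<gamma> (x - y) * b y\<bar> \<partial>torus)"
    unfolding conv_eq using integral_norm_bound[of torus "\<lambda>y. \<gamma> (x - y) * b y"] by simp
  also have "\<dots> \<le> (\<integral>y. M * \<bar>b y\<bar> \<partial>torus)"
  proof (rule integral_mono_AE)
    show "integrable torus (\<lambda>y. \<bar>\<gamma> (x - y) * b y\<bar>)"
      using conv_integrable[OF g ae b, of x] by simp
    show "integrable torus (\<lambda>y. M * \<bar>b y\<bar>)" using L2cube_integrable[OF b] by simp
    show "AE y in torus. \<bar>\<gamma> (x - y) * b y\<bar> \<le> M * \<bar>b y\<bar>"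
      using AE_torus_reflect[OF ae, of x] by eventually_elim (auto simp: abs_mult intro!: mult_right_mono)
  qed
  also have "\<dots> = M * (\<integral>y. \<bar>b y\<bar> \<partial>torus)" by simp
  also have "\<dots> \<le> M * L2norm b" by (intro mult_left_mono L1_le_L2norm b M)
  finally show ?thesis .
qed

lemma integral_torus_lborel:
  fixes f :: "real^'d \<Rightarrow> 'b::{banach,second_countable_topology}"
  shows "(\<integral>x. f x \<partial>torus) = (\<integral>x. indicator unit_cube x *\<^sub>R f x \<partial>lborel)"
  unfolding set_integral_torus[symmetric] set_lebesgue_integral_def ..

lemma conv_measurable:
  assumes [measurable]: "\<gamma> \<in> borel_measurable borel" "b \<in> borel_measurable borel"
  shows "conv \<gamma> b \<in> borel_measurable borel"
  unfolding conv_eq[abs_def] integral_torus_lborel by measurable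

lemma L2cube_mult_bounded:
  assumes a: "L2cube a" and [measurable]: "w \<in> borel_measurable borel" and w: "\<And>x. \<bar>w x\<bar> \<le> B"
  shows "L2cube (\<lambda>x. a x * w x)" "L2norm (\<lambda>x. a x * w x) \<le> B * L2norm a"
proof -
  have [measurable]: "a \<in> borel_measurable borel" using a by (simp add: L2cube_iff)
  have B: "0 \<le> B" using w[of 0] by simp
  have le: "(a x * w x)^2 \<le> B^2 * (a x)^2" for x
  proof -
    have "(w x)^2 \<le> B^2" using power_mono[OF w[of x], of 2] by simp
    then show ?thesis by (simp add: power_mult_distrib mult_left_mono mult.commute[of "B^2"])
  qed
  have ia: "integrable torus (\<lambda>x. (a x)^2)" using a by (simp add: L2cube_iff)
  have i: "integrable torus (\<lambda>x. (a x * w x)^2)"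
    by (rule Bochner_Integration.integrable_bound[of torus "\<lambda>x. B^2 * (a x)^2"]) (use ia le in auto)
  then show "L2cube (\<lambda>x. a x * w x)" by (simp add: L2cube_iff)
  have "(L2norm (\<lambda>x. a x * w x))^2 \<le> (\<integral>x. B^2 * (a x)^2 \<partial>torus)"
    unfolding L2norm_power2 by (rule integral_mono[OF i _ le]) (use ia in simp)
  also have "\<dots> = (B * L2norm a)^2" by (simp add: L2norm_power2 power_mult_distrib)
  finally show "L2norm (\<lambda>x. a x * w x) \<le> B * L2norm a"
    by (rule power2_le_imp_le) (simp add: B)
qed

locale bounded_kernel =
  fixes \<gamma> :: "real^'d \<Rightarrow> real" and M :: real
  assumes meas [measurable]: "\<gamma> \<in> borel_measurable borel" and ae: "AE z in lborel. \<bar>\<gamma> z\<bar> \<le> M" and M: "0 \<le> M"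
begin

lemma L2cube_mult_conv:
  assumes "L2cube a" "L2cube b"
  shows "L2cube (\<lambda>x. a x * conv \<gamma> b x)" "L2norm (\<lambda>x. a x * conv \<gamma> b x) \<le> M * L2norm a * L2norm b"
proof -
  have [measurable]: "b \<in> borel_measurable borel" using assms by (simp add: L2cube_iff)
  note 1 = L2cube_mult_bounded[OF assms(1) conv_measurable conv_bound[OF meas ae assms(2) M]]
  show "L2cube (\<lambda>x. a x * conv \<gamma> b x)" by (rule 1) measurable
  have "L2norm (\<lambda>x. a x * conv \<gamma> b x) \<le> M * L2norm b * L2norm a" by (rule 1) measurable
  then show "L2norm (\<lambda>x. a x * conv \<gamma> b x) \<le> M * L2norm a * L2norm b" by (simp add: mult_ac)
qed

lemma fc_mult_conv_bound:
  assumes "L2cube a" "L2cube b"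
  shows "cmod (fc (\<lambda>x. a x * conv \<gamma> b x) k) \<le> M * L2norm a * L2norm b"
  using cmod_fc_le_L1[of "\<lambda>x. a x * conv \<gamma> b x" k] L1_le_L2norm[OF L2cube_mult_conv(1)[OF assms]] L2cube_mult_conv(2)[OF assms]
  by linarith

text \<open>Telescoping of a bilinear expression,
  \<open>a b - a' b' = (a - a') b + a' (b - b')\<close>. It gives the continuity by which truncated
  series approximate the nonlinearity.\<close>

lemma fc_mult_conv_diff:
  assumes "L2cube a" "L2cube b" "L2cube a'" "L2cube b'"
  shows "cmod (fc (\<lambda>x. a x * conv \<gamma> b x) k - fc (\<lambda>x. a' x * conv \<gamma> b' x) k)
    \<le> M * (L2norm (\<lambda>x. a x - a' x) * L2norm b + L2norm a' * L2norm (\<lambda>x. b x - b' x))"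
proof -
  have c: "conv \<gamma> b x - conv \<gamma> b' x = conv \<gamma> (\<lambda>x. b x - b' x) x" for x
    unfolding conv_eq
    by (subst Bochner_Integration.integral_diff[symmetric])
      (auto simp: right_diff_distrib intro!: conv_integrable meas ae assms)
  have i: "integrable torus (\<lambda>x. of_real (a x * conv \<gamma> b x) * cnj (chr k x))" if "L2cube a" "L2cube b" for a b
    by (intro integrable_fc L2cube_integrable L2cube_mult_conv that)
  have e: "fc (\<lambda>x. a x * conv \<gamma> b x) k - fc (\<lambda>x. a' x * conv \<gamma> b' x) k
     = fc (\<lambda>x. (a x - a' x) * conv \<gamma> b x) k + fc (\<lambda>x. a' x * conv \<gamma> (\<lambda>x. b x - b' x) x) k"
    unfolding fc_eq
    by (subst Bochner_Integration.integral_diff[symmetric], (intro i assms)+,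
        subst Bochner_Integration.integral_add[symmetric], (intro i assms L2cube_diff)+,
        intro Bochner_Integration.integral_cong refl)
      (simp add: c[symmetric] algebra_simps)
  have "cmod (fc (\<lambda>x. (a x - a' x) * conv \<gamma> b x) k) \<le> M * L2norm (\<lambda>x. a x - a' x) * L2norm b"
    by (intro fc_mult_conv_bound L2cube_diff assms)
  moreover have "cmod (fc (\<lambda>x. a' x * conv \<gamma> (\<lambda>x. b x - b' x) x) k) \<le> M * L2norm a' * L2norm (\<lambda>x. b x - b' x)"
    by (intro fc_mult_conv_bound L2cube_diff assms)
  ultimately show ?thesis unfolding e by (intro order_trans[OF norm_triangle_ineq]) (simp add: algebra_simps)
qed

lemma L2norm_fpart_le:
  assumes "L2cube u" shows "L2norm (fpart n u) \<le> L2norm u"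
proof -
  have "(L2norm (fpart n u))^2 \<le> (\<integral>x. (cmod (\<Sum>k\<in>fbox n. fc u k * chr k x))^2 \<partial>torus)"
    unfolding L2norm_power2
  proof (rule integral_mono)
    show "integrable torus (\<lambda>x. (fpart n u x)^2)" using L2cube_fpart by (simp add: L2cube_iff)
    show "integrable torus (\<lambda>x. (cmod (\<Sum>k\<in>fbox n. fc u k * chr k x))^2)"
      by (rule integrable_trig_sum_power2)
    show "(fpart n u x)^2 \<le> (cmod (\<Sum>k\<in>fbox n. fc u k * chr k x))^2" for x
      unfolding fpart_def by (metis abs_Re_le_cmod abs_norm_cancel abs_le_square_iff)
  qed
  also have "\<dots> = (\<Sum>k\<in>fbox n. (cmod (fc u k))^2)" by (rule parseval_finite) simp
  also have "\<dots> \<le> (L2norm u)^2" by (rule bessel) (auto simp: assms)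
  finally show ?thesis by (rule power2_le_imp_le) simp
qed

text \<open>The truncated series \<open>fpart n (a s) x\<close> are jointly measurable in \<open>(s, x)\<close>, which \<open>a s x\<close> itself
  need not be.\<close>

lemma fc_mult_conv_measurable:
  assumes N: "\<And>s. s \<in> space N \<Longrightarrow> L2cube (a s) \<and> L2cube (b s)"
    and sa: "\<And>s. s \<in> space N \<Longrightarrow> (\<lambda>k. cmod (fc (a s) k)) summable_on UNIV"
    and sb: "\<And>s. s \<in> space N \<Longrightarrow> (\<lambda>k. cmod (fc (b s) k)) summable_on UNIV"
    and ma [measurable]: "\<And>k. (\<lambda>s. fc (a s) k) \<in> borel_measurable N"
    and mb [measurable]: "\<And>k. (\<lambda>s. fc (b s) k) \<in> borel_measurable N"
  shows "(\<lambda>s. fc (\<lambda>x. a s x * conv \<gamma> (b s) x) k) \<in> borel_measurable N"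
proof (rule borel_measurable_LIMSEQ_metric)
  fix n
  have [measurable]: "(\<lambda>(s, x). fpart n (a s) x) \<in> borel_measurable (N \<Otimes>\<^sub>M borel)"
      "(\<lambda>(s, x). fpart n (b s) x) \<in> borel_measurable (N \<Otimes>\<^sub>M borel)"
    unfolding fpart_def by measurable
  show "(\<lambda>s. fc (\<lambda>x. fpart n (a s) x * conv \<gamma> (fpart n (b s)) x) k) \<in> borel_measurable N"
    unfolding fc_eq conv_eq integral_torus_lborel by measurable
next
  fix s assume s: "s \<in> space N"
  note L = N[OF s, THEN conjunct1] N[OF s, THEN conjunct2]
  define D where "D n = M * (L2norm (\<lambda>x. a s x - fpart n (a s) x) * L2norm (b s) + L2norm (a s) * L2norm (\<lambda>x. b s x - fpart n (b s) x))" for n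
  have "D \<longlonglongrightarrow> M * (0 * L2norm (b s) + L2norm (a s) * 0)"
    unfolding D_def by (intro tendsto_intros fpart_tendsto L sa sb s)
  then have D0: "D \<longlonglongrightarrow> 0" by simp
  have "cmod (fc (\<lambda>x. fpart n (a s) x * conv \<gamma> (fpart n (b s)) x) k - fc (\<lambda>x. a s x * conv \<gamma> (b s) x) k) \<le> D n" for n
  proof -
    have "cmod (fc (\<lambda>x. a s x * conv \<gamma> (b s) x) k - fc (\<lambda>x. fpart n (a s) x * conv \<gamma> (fpart n (b s)) x) k)
      \<le> M * (L2norm (\<lambda>x. a s x - fpart n (a s) x) * L2norm (b s) + L2norm (fpart n (a s)) * L2norm (\<lambda>x. b s x - fpart n (b s) x))"
      by (rule fc_mult_conv_diff) (auto simp: L L2cube_fpart)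
    also have "\<dots> \<le> D n"
      unfolding D_def by (intro mult_left_mono add_left_mono mult_right_mono L2norm_fpart_le L M) auto
    finally show ?thesis by (simp add: norm_minus_commute)
  qed
  then have "(\<lambda>n. fc (\<lambda>x. fpart n (a s) x * conv \<gamma> (fpart n (b s)) x) k - fc (\<lambda>x. a s x * conv \<gamma> (b s) x) k) \<longlonglongrightarrow> 0"
    by (intro Lim_null_comparison[OF _ D0]) auto
  then show "(\<lambda>n. fc (\<lambda>x. fpart n (a s) x * conv \<gamma> (fpart n (b s)) x) k) \<longlonglongrightarrow> fc (\<lambda>x. a s x * conv \<gamma> (b s) x) k"
    by (rule LIM_zero_cancel)
qed

end

section \<open>Curves of functions on the torus\<close>

definition tm :: "real \<Rightarrow> real measure" where
  "tm t = restrict_space lborel {0..t}"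

lemma space_tm [simp]: "space (tm t) = {0..t}"
  unfolding tm_def by (simp add: space_restrict_space)

lemma finite_measure_tm: "finite_measure (tm t)"
proof
  have "emeasure lborel {0..t} \<le> emeasure lborel (cbox 0 t)" by (intro emeasure_mono) auto
  also have "\<dots> < \<infinity>" using emeasure_lborel_cbox_finite by blast
  finally show "emeasure (tm t) (space (tm t)) \<noteq> \<infinity>"
    by (simp add: tm_def emeasure_restrict_space space_restrict_space less_top[symmetric])
qed

interpretation tm: finite_measure "tm t" for t
  by (rule finite_measure_tm)

lemma measure_tm: "0 \<le> t \<Longrightarrow> measure (tm t) {0..t} = t"
  unfolding tm_def by (subst measure_restrict_space) auto

lemma set_integral_tm:
  fixes f :: "real \<Rightarrow> 'b::{banach,second_countable_topology}"
  shows "(LINT x:{0..t}|lborel. f x) = (\<integral>x. f x \<partial>tm t)"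
  unfolding tm_def set_lebesgue_integral_def by (subst integral_restrict_space) simp_all

lemma set_integrable_tm:
  fixes f :: "real \<Rightarrow> 'b::{banach,second_countable_topology}"
  shows "set_integrable lborel {0..t} f \<longleftrightarrow> integrable (tm t) f"
  unfolding tm_def set_integrable_def by (subst integrable_restrict_space) simp_all

lemma set_borel_measurable_tm:
  fixes f :: "real \<Rightarrow> 'b::real_normed_vector"
  shows "set_borel_measurable lborel {0..t} f \<longleftrightarrow> f \<in> borel_measurable (tm t)"
  unfolding tm_def set_borel_measurable_def by (subst borel_measurable_restrict_space_iff) auto

lemma AE_tm: "(AE t in lborel. t \<in> {0..T} \<longrightarrow> P t) \<longleftrightarrow> (AE t in tm T. P t)"
  unfolding tm_def by (subst AE_restrict_space_iff) auto

lemma tm_restrict: "s \<le> t \<Longrightarrow> tm s = restrict_space (tm t) {0..s}"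
proof -
  assume "s \<le> t"
  then have "{0..t} \<inter> {0..s} = {0..s}" by auto
  then show ?thesis unfolding tm_def by (subst restrict_restrict_space) auto
qed

lemma measurable_tm_mono:
  "f \<in> measurable (tm t) N \<Longrightarrow> s \<le> t \<Longrightarrow> f \<in> measurable (tm s) N"
  unfolding tm_restrict[of s t] by (rule measurable_restrict_space1)

lemma integrable_tm_mono:
  fixes f :: "real \<Rightarrow> 'b::{banach,second_countable_topology}"
  assumes "integrable (tm t) f" "s \<le> t" shows "integrable (tm s) f"
proof -
  have "set_integrable lborel {0..s} f"
    by (rule set_integrable_subset[of lborel "{0..t}"]) (use assms in \<open>auto simp: set_integrable_tm\<close>)
  then show ?thesis by (simp add: set_integrable_tm)
qed

lemma integral_tm_mono:
  fixes f :: "real \<Rightarrow> real"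
  assumes i: "integrable (tm t) f" and s: "s \<le> t" and nn: "\<And>x. x \<in> {0..t} \<Longrightarrow> 0 \<le> f x"
  shows "(\<integral>x. f x \<partial>tm s) \<le> (\<integral>x. f x \<partial>tm t)"
proof -
  have i': "integrable lborel (\<lambda>x. indicator {0..t} x *\<^sub>R f x)"
    using i unfolding set_integrable_tm[symmetric] set_integrable_def .
  have i'': "integrable lborel (\<lambda>x. indicator {0..s} x *\<^sub>R f x)"
    using integrable_tm_mono[OF i s] unfolding set_integrable_tm[symmetric] set_integrable_def .
  show ?thesis
    unfolding set_integral_tm[symmetric] set_lebesgue_integral_def
    by (rule integral_mono[OF i'' i']) (use s nn in \<open>auto simp: indicator_def\<close>)
qed

lemma integrable_tm_bounded:
  fixes f :: "real \<Rightarrow> 'b::{banach,second_countable_topology}"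
  assumes "f \<in> borel_measurable (tm t)" "\<And>x. x \<in> {0..t} \<Longrightarrow> norm (f x) \<le> B"
  shows "integrable (tm t) f"
  by (rule tm.integrable_const_bound[of _ B]) (use assms in auto)

lemma integral_tm_const: "0 \<le> t \<Longrightarrow> (\<integral>x. c \<partial>tm t) = t *\<^sub>R (c :: 'b::{banach,second_countable_topology})"
  using measure_tm[of t] by simp

lemma integral_tm_Cauchy_Schwarz:
  fixes g :: "real \<Rightarrow> complex"
  assumes t: "0 \<le> t" and [measurable]: "g \<in> borel_measurable (tm t)" and g: "integrable (tm t) (\<lambda>s. (cmod (g s))^2)"
  shows "(cmod (\<integral>s. g s \<partial>tm t))^2 \<le> t * (\<integral>s. (cmod (g s))^2 \<partial>tm t)"
  using integral_Cauchy_Schwarz(2)[of "\<lambda>_. 1" "tm t" g] g integral_tm_const[OF t, of "1::real"] by simp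

section \<open>Regularity of a curve at every time\<close>

lemma sob_weight_sum_le:
  assumes "sob_mem s u" "finite F"
  shows "(\<Sum>k\<in>F. sob_weight s u k) \<le> sob_norm2 s u"
  unfolding sob_norm2_def
proof (rule finite_sum_le_infsum)
  show "sob_weight s u summable_on UNIV" using assms by (simp add: sob_mem_def)
  show "0 \<le> sob_weight s u k" for k by (simp add: sob_weight_def)
qed (use assms in auto)

lemma wt_le_sob_weight:
  fixes u :: "real^'d \<Rightarrow> real"
  assumes "real CARD('d) \<le> s"
  shows "wt k ^ CARD('d) * (cmod (fc u k))^2 \<le> sob_weight s u k"
proof -
  have "wt k ^ CARD('d) = wt k powr real CARD('d)"
    using wt_ge_1[of k] by (simp add: powr_realpow)
  also have "\<dots> \<le> wt k powr s" by (rule powr_mono) (use assms wt_ge_1 in auto)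
  finally show ?thesis unfolding sob_weight_def wt_def by (rule mult_right_mono) simp
qed

text \<open>What is extracted from membership in F_beta, at every time. The bound \<open>R\<close>
  is not controlled by the data: it serves integrability and is the crude bound handed to
  \<open>quadratic_gronwall\<close>.\<close>

definition regular :: "real \<Rightarrow> (real \<Rightarrow> real^'d \<Rightarrow> real) \<Rightarrow> bool" where
  "regular T u \<longleftrightarrow> (\<forall>t\<in>{0..T}. L2cube (u t) \<and> (\<lambda>k. cmod (fc (u t) k)) summable_on UNIV) \<and>
     (\<forall>k. (\<lambda>t. fc (u t) k) \<in> borel_measurable (tm T)) \<and> (\<exists>R. \<forall>t\<in>{0..T}. L2norm (u t) \<le> R)"

lemma L2norm_le_of_sums:
  assumes "L2cube u" "(\<lambda>k. cmod (fc u k)) summable_on UNIV"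
    and "\<And>F. finite F \<Longrightarrow> (\<Sum>k\<in>F. (cmod (fc u k))^2) \<le> Q"
  shows "(L2norm u)^2 \<le> Q"
  by (rule LIMSEQ_le_const2[OF parseval_limit[OF assms(1,2)]]) (use assms(3) in auto)

text \<open>Regularity at a single time propagates to every time, because increments of \<open>fc (u t) k\<close> are
  integrals of \<open>fc (u' s) k\<close>. Statements for every \<open>t\<close> rather than almost every \<open>t\<close> are needed:
  \<open>lborel\<close> is not complete, and the integral of a function that is not Borel measurable is the junk value \<open>0\<close>.\<close>

lemma in_F_weighted_bound:
  fixes u :: "real \<Rightarrow> real^'d \<Rightarrow> real"
  assumes T: "T > 0" and beta: "beta \<ge> CARD('d) + 1" and u: "in_F T beta u"
  obtains Q where "\<And>t F. t \<in> {0..T} \<Longrightarrow> finite F \<Longrightarrow> (\<Sum>k\<in>F. wt k ^ CARD('d) * (cmod (fc (u t) k))^2) \<le> Q"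
proof -
  obtain u' where
    u'i: "\<And>k. integrable (tm T) (\<lambda>t. fc (u' t) k)" and
    u's: "AE t in tm T. sob_mem (real beta - 1) (u' t)" and
    u'n: "integrable (tm T) (\<lambda>t. sob_norm2 (real beta - 1) (u' t))" and
    u'e: "\<And>k t. t \<in> {0..T} \<Longrightarrow> fc (u t) k = fc (u 0) k + (\<integral>s. fc (u' s) k \<partial>tm t)"
    using u unfolding in_F_def AE_tm set_integrable_tm set_integral_tm by blast
  have "AE t in tm T. sob_mem (real beta + 1) (u t)" using u unfolding in_F_def AE_tm by blast
  \<comment> \<open>An interval of positive length is not a null set, so the almost everywhere
    statement holds at some time.\<close>
  then have "\<exists>t1\<in>{0..T}. sob_mem (real beta + 1) (u t1)"
  proof (rule contrapos_pp)
    assume "\<not> (\<exists>t1\<in>{0..T}. sob_mem (real beta + 1) (u t1))"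
    then have n: "\<And>t. t \<in> space (tm T) \<Longrightarrow> \<not> sob_mem (real beta + 1) (u t)" by auto
    show "\<not> (AE t in tm T. sob_mem (real beta + 1) (u t))"
    proof
      assume "AE t in tm T. sob_mem (real beta + 1) (u t)"
      then have "AE t in tm T. False" using AE_space by eventually_elim (use n in auto)
      then have "emeasure (tm T) (space (tm T)) = 0"
        by (subst (asm) AE_iff_measurable[of "space (tm T)"]) (use sets.top[of "tm T"] in auto)
      then have "measure (tm T) {0..T} = 0" by (simp add: measure_def)
      then show False using T by (simp add: measure_tm)
    qed
  qed
  then obtain t1 where t1: "t1 \<in> {0..T}" "sob_mem (real beta + 1) (u t1)" by blast
  have wp: "0 \<le> wt k" for k :: "int^'d" using wt_ge_1[of k] by simp
  define d where "d = CARD('d)"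
  define G where "G k = (\<integral>s. (cmod (fc (u' s) k))^2 \<partial>tm T)" for k
  have d1: "wt k ^ d * (cmod (fc (u' s) k))^2 \<le> sob_weight (real beta - 1) (u' s) k" for k s
    unfolding d_def by (rule wt_le_sob_weight) (use beta in linarith)
  have d2: "wt k ^ d * (cmod (fc (u s) k))^2 \<le> sob_weight (real beta + 1) (u s) k" for k s
    unfolding d_def by (rule wt_le_sob_weight) (use beta in linarith)
  have [measurable]: "(\<lambda>t. fc (u' t) k) \<in> borel_measurable (tm T)" for k
    using u'i[of k] by simp
  have sumle: "AE s in tm T. (\<Sum>k\<in>F. wt k ^ d * (cmod (fc (u' s) k))^2) \<le> sob_norm2 (real beta - 1) (u' s)" if "finite F" for F
    using u's
  proof eventually_elim
    fix s assume s: "sob_mem (real beta - 1) (u' s)"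
    have "(\<Sum>k\<in>F. wt k ^ d * (cmod (fc (u' s) k))^2) \<le> (\<Sum>k\<in>F. sob_weight (real beta - 1) (u' s) k)"
      by (intro sum_mono d1)
    also have "\<dots> \<le> sob_norm2 (real beta - 1) (u' s)" by (rule sob_weight_sum_le[OF s that])
    finally show "(\<Sum>k\<in>F. wt k ^ d * (cmod (fc (u' s) k))^2) \<le> sob_norm2 (real beta - 1) (u' s)" .
  qed
  have i2: "integrable (tm T) (\<lambda>s. wt k ^ d * (cmod (fc (u' s) k))^2)" for k
  proof (rule Bochner_Integration.integrable_bound[OF u'n])
    show "AE s in tm T. norm (wt k ^ d * (cmod (fc (u' s) k))^2) \<le> norm (sob_norm2 (real beta - 1) (u' s))"
      using sumle[of "{k}"] by (auto simp: wp)
  qed measurable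
  have i2': "integrable (tm T) (\<lambda>s. (cmod (fc (u' s) k))^2)" for k
  proof (rule Bochner_Integration.integrable_bound[OF i2[of k]])
    have "1 \<le> wt k ^ d" using wt_ge_1 by (rule one_le_power)
    then show "AE s in tm T. norm ((cmod (fc (u' s) k))^2) \<le> norm (wt k ^ d * (cmod (fc (u' s) k))^2)"
      by (intro AE_I2) (simp add: wp mult_le_cancel_right1)
  qed measurable
  have sG: "(\<Sum>k\<in>F. wt k ^ d * G k) \<le> (\<integral>s. sob_norm2 (real beta - 1) (u' s) \<partial>tm T)" if F: "finite F" for F
  proof -
    have "(\<Sum>k\<in>F. wt k ^ d * G k) = (\<integral>s. (\<Sum>k\<in>F. wt k ^ d * (cmod (fc (u' s) k))^2) \<partial>tm T)"
      unfolding G_def using i2 by (subst Bochner_Integration.integral_sum) auto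
    also have "\<dots> \<le> (\<integral>s. sob_norm2 (real beta - 1) (u' s) \<partial>tm T)"
      by (rule integral_mono_AE) (use i2 u'n sumle[OF F] in auto)
    finally show ?thesis .
  qed
  have J: "(cmod (\<integral>s. fc (u' s) k \<partial>tm t))^2 \<le> T * G k" if t: "t \<in> {0..T}" for t k
  proof -
    have "(cmod (\<integral>s. fc (u' s) k \<partial>tm t))^2 \<le> t * (\<integral>s. (cmod (fc (u' s) k))^2 \<partial>tm t)"
    proof (rule integral_tm_Cauchy_Schwarz)
      show "(\<lambda>s. fc (u' s) k) \<in> borel_measurable (tm t)"
        by (rule measurable_tm_mono[of _ T]) (use t in auto)
      show "integrable (tm t) (\<lambda>s. (cmod (fc (u' s) k))^2)"
        by (rule integrable_tm_mono[OF i2']) (use t in auto)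
    qed (use t in auto)
    also have "\<dots> \<le> T * G k"
    proof (rule mult_mono)
      show "(\<integral>s. (cmod (fc (u' s) k))^2 \<partial>tm t) \<le> G k"
        unfolding G_def by (rule integral_tm_mono[OF i2']) (use t in auto)
    qed (use t in auto)
    finally show ?thesis .
  qed
  \<comment> \<open>The integral of the derivative from \<open>t1\<close> to \<open>t\<close> is
    written as a difference of two integrals from 0. Squaring a sum of three terms costs the factor
    3, and the two integrals together give 6.\<close>
  have pt: "(cmod (fc (u t) k))^2 \<le> 3 * (cmod (fc (u t1) k))^2 + 6 * (T * G k)" if t: "t \<in> {0..T}" for t k
  proof -
    define a b c where "a = fc (u t1) k" and "b = (\<integral>s. fc (u' s) k \<partial>tm t)" and "c = (\<integral>s. fc (u' s) k \<partial>tm t1)"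
    have "fc (u t) k = a + b - c" using u'e[OF t, of k] u'e[OF t1(1), of k] by (simp add: a_def b_def c_def)
    then have "cmod (fc (u t) k) \<le> cmod a + cmod b + cmod c"
      using norm_triangle_ineq4[of "a + b" c] norm_triangle_ineq[of a b] by simp
    then have "(cmod (fc (u t) k))^2 \<le> (cmod a + cmod b + cmod c)^2" by (rule power_mono) simp
    also have "\<dots> \<le> 3 * (cmod a)^2 + 3 * (cmod b)^2 + 3 * (cmod c)^2"
      using zero_le_power2[of "cmod a - cmod b"] zero_le_power2[of "cmod a - cmod c"] zero_le_power2[of "cmod b - cmod c"]
      by (simp add: power2_eq_square algebra_simps)
    also have "\<dots> \<le> 3 * (cmod a)^2 + 6 * (T * G k)"
      using J[OF t, of k] J[OF t1(1), of k] by (simp add: b_def c_def)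
    finally show ?thesis by (simp add: a_def)
  qed
  show thesis
  proof (rule that)
    fix t F assume t: "t \<in> {0..T}" and F: "finite (F :: (int^'d) set)"
    have "(\<Sum>k\<in>F. wt k ^ d * (cmod (fc (u t) k))^2) \<le> (\<Sum>k\<in>F. wt k ^ d * (3 * (cmod (fc (u t1) k))^2 + 6 * (T * G k)))"
      by (intro sum_mono mult_left_mono pt t) (simp add: wp)
    also have "\<dots> = 3 * (\<Sum>k\<in>F. wt k ^ d * (cmod (fc (u t1) k))^2) + 6 * T * (\<Sum>k\<in>F. wt k ^ d * G k)"
      by (simp add: distrib_left sum.distrib sum_distrib_left mult_ac)
    also have "\<dots> \<le> 3 * sob_norm2 (real beta + 1) (u t1) + 6 * T * (\<integral>s. sob_norm2 (real beta - 1) (u' s) \<partial>tm T)"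
      by (intro add_mono mult_left_mono sG F order_trans[OF sum_mono[OF d2] sob_weight_sum_le[OF t1(2) F]]) (use T in auto)
    finally show "(\<Sum>k\<in>F. wt k ^ CARD('d) * (cmod (fc (u t) k))^2) \<le> 3 * sob_norm2 (real beta + 1) (u t1) + 6 * T * (\<integral>s. sob_norm2 (real beta - 1) (u' s) \<partial>tm T)"
      by (simp add: d_def)
  qed
qed

lemma in_F_regular:
  fixes u :: "real \<Rightarrow> real^'d \<Rightarrow> real"
  assumes T: "T > 0" and beta: "beta \<ge> CARD('d) + 1" and u: "in_F T beta u"
  shows "regular T u"
proof -
  obtain Q where Q: "\<And>t F. t \<in> {0..T} \<Longrightarrow> finite F \<Longrightarrow> (\<Sum>k\<in>F. wt k ^ CARD('d) * (cmod (fc (u t) k))^2) \<le> Q"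
    using in_F_weighted_bound[OF assms] by blast
  have L: "L2cube (u t)" if "t \<in> {0..T}" for t using u that unfolding in_F_def by blast
  have m: "(\<lambda>t. fc (u t) k) \<in> borel_measurable (tm T)" for k
    using u unfolding in_F_def set_borel_measurable_tm by blast
  have s: "(\<lambda>k. cmod (fc (u t) k)) summable_on UNIV" if "t \<in> {0..T}" for t
    by (rule abs_summable_of_weighted[OF Q[OF that]])
  have "L2norm (u t) \<le> sqrt Q" if t: "t \<in> {0..T}" for t
  proof (rule real_le_rsqrt, rule L2norm_le_of_sums[OF L[OF t] s[OF t]])
    fix F :: "(int^'d) set" assume F: "finite F"
    have "(\<Sum>k\<in>F. (cmod (fc (u t) k))^2) \<le> (\<Sum>k\<in>F. wt k ^ CARD('d) * (cmod (fc (u t) k))^2)"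
    proof (rule sum_mono)
      fix k :: "int^'d"
      have "1 \<le> wt k ^ CARD('d)" using wt_ge_1 by (rule one_le_power)
      then show "(cmod (fc (u t) k))^2 \<le> wt k ^ CARD('d) * (cmod (fc (u t) k))^2"
        by (simp add: mult_le_cancel_right1)
    qed
    also have "\<dots> \<le> Q" by (rule Q[OF t F])
    finally show "(\<Sum>k\<in>F. (cmod (fc (u t) k))^2) \<le> Q" .
  qed
  then show ?thesis unfolding regular_def using L m s by blast
qed

text \<open>The norm is an integral over \<open>x\<close> of a function that need not be jointly
  measurable; Parseval exhibits it as a limit of measurable finite sums.\<close>

lemma regular_L2norm_measurable:
  assumes "regular T u" shows "(\<lambda>t. (L2norm (u t))^2) \<in> borel_measurable (tm T)" "(\<lambda>t. L2norm (u t)) \<in> borel_measurable (tm T)"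
proof -
  have [measurable]: "(\<lambda>t. fc (u t) k) \<in> borel_measurable (tm T)" for k using assms by (simp add: regular_def)
  show 1 [measurable]: "(\<lambda>t. (L2norm (u t))^2) \<in> borel_measurable (tm T)"
  proof (rule borel_measurable_LIMSEQ_real)
    show "(\<lambda>t. \<Sum>k\<in>fbox n. (cmod (fc (u t) k))^2) \<in> borel_measurable (tm T)" for n by measurable
    fix t assume "t \<in> space (tm T)"
    then show "(\<lambda>n. \<Sum>k\<in>fbox n. (cmod (fc (u t) k))^2) \<longlonglongrightarrow> (L2norm (u t))^2"
      using assms by (intro parseval_limit) (auto simp: regular_def)
  qed
  have "(\<lambda>t. sqrt ((L2norm (u t))^2)) \<in> borel_measurable (tm T)" by measurable
  then show "(\<lambda>t. L2norm (u t)) \<in> borel_measurable (tm T)" by simp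
qed

section \<open>Duhamel's formula\<close>

lemma tm_measurable_id [measurable]: "(\<lambda>x::real. x) \<in> tm t \<rightarrow>\<^sub>M borel"
  unfolding tm_def by (rule measurable_restrict_space1) simp

lemma integral_tm_indicator:
  fixes f :: "real \<Rightarrow> 'b::{banach,second_countable_topology}"
  assumes "s \<le> t"
  shows "(\<integral>r. indicator {..s} r *\<^sub>R f r \<partial>tm t) = (\<integral>r. f r \<partial>tm s)"
proof -
  have "indicator {0..t} r *\<^sub>R indicator {..s} r *\<^sub>R f r = indicator {0..s} r *\<^sub>R f r" for r
    using assms by (auto simp: indicator_def)
  then show ?thesis
    unfolding set_integral_tm[symmetric] set_lebesgue_integral_def by (simp only:)
qed

lemma integral_tm_exp:
  fixes a :: real
  assumes "0 \<le> r" "r \<le> t"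
  shows "(\<integral>s. indicator {r..} s * (a * exp (a * s)) \<partial>tm t) = exp (a * t) - exp (a * r)"
proof -
  have "((\<lambda>s. a * exp (a * s)) has_integral (exp (a * t) - exp (a * r))) {r..t}"
    by (rule fundamental_theorem_of_calculus)
      (use assms in \<open>auto intro!: derivative_eq_intros simp flip: has_real_derivative_iff_has_vector_derivative\<close>)
  moreover have "set_integrable lborel {r..t} (\<lambda>s. a * exp (a * s))"
    by (rule borel_integrable_atLeastAtMost') (intro continuous_intros)
  ultimately have "(LINT s:{r..t}|lborel. a * exp (a * s)) = exp (a * t) - exp (a * r)"
    using set_borel_integral_eq_integral(2) integral_unique by metis
  moreover have "indicator {0..t} s *\<^sub>R (indicator {r..} s * (a * exp (a * s))) = indicator {r..t} s *\<^sub>R (a * exp (a * s))" for s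
    using assms by (auto simp: indicator_def)
  ultimately show ?thesis unfolding set_integral_tm[symmetric] set_lebesgue_integral_def by (simp only:)
qed

text \<open>The right-hand side is merely bounded and measurable, so the evolution of a mode is
  recorded in integrated form and not as a differential equation.\<close>

locale integral_curve =
  fixes z G :: "real \<Rightarrow> complex" and z0 :: complex and T Bz BG :: real
  assumes zm: "z \<in> borel_measurable (tm T)" and zb: "\<And>s. s \<in> {0..T} \<Longrightarrow> cmod (z s) \<le> Bz"
    and Gm: "G \<in> borel_measurable (tm T)" and Gb: "\<And>s. s \<in> {0..T} \<Longrightarrow> cmod (G s) \<le> BG"
    and z: "\<And>t. t \<in> {0..T} \<Longrightarrow> z t = z0 + (\<integral>s. G s \<partial>tm t)"
begin

text \<open>Fubini on the triangle \<open>r \<le> s \<le> t\<close> for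
  \<open>a * exp (a * s) * G r\<close> replaces differentiation of \<open>exp (a * s) * z s\<close>.
  Integrating in \<open>r\<close> first recovers \<open>z s - z0\<close>; integrating in
  \<open>s\<close> first gives \<open>exp (a * t) - exp (a * r)\<close>.\<close>

lemma duhamel:
  fixes a :: real
  assumes t: "t \<in> {0..T}"
  shows "z t = complex_of_real (exp (- a * t)) * z0 + (\<integral>s. complex_of_real (exp (- a * (t - s))) * (G s + a * z s) \<partial>tm t)"
proof -
  have tT: "t \<le> T" and t0: "0 \<le> t" using t by auto
  define N where "N = tm t"
  have [measurable]: "z \<in> borel_measurable N" "G \<in> borel_measurable N" "(\<lambda>x::real. x) \<in> N \<rightarrow>\<^sub>M borel"
    unfolding N_def using measurable_tm_mono[OF zm tT] measurable_tm_mono[OF Gm tT] by auto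
  have sN [simp]: "space N = {0..t}" by (simp add: N_def)
  interpret N: finite_measure N unfolding N_def by (rule finite_measure_tm)
  interpret NN: pair_sigma_finite N N by standard
  interpret P: finite_measure "N \<Otimes>\<^sub>M N" by (rule finite_measure_pair_measure) unfold_locales
  have bnd: "integrable N f" if "f \<in> borel_measurable N" "\<And>s. s \<in> {0..t} \<Longrightarrow> cmod (f s) \<le> B" for f :: "real \<Rightarrow> complex" and B
    by (rule N.integrable_const_bound[of _ B]) (use that in auto)
  define E where "E = exp (\<bar>a\<bar> * t)"
  have E: "exp (a * s) \<le> E" if "s \<in> {0..t}" for s
  proof -
    have "a * s \<le> \<bar>a\<bar> * t" using that by (intro mult_mono) auto
    then show ?thesis by (simp add: E_def)
  qed
  have E0: "0 \<le> E" by (simp add: E_def)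
  define K where "K s r = (indicator {..s} r * (a * exp (a * s))) *\<^sub>R G r" for s r
  have [measurable]: "(\<lambda>(s, r). K s r) \<in> borel_measurable (N \<Otimes>\<^sub>M N)"
  proof -
    have "(\<lambda>(s, r). ((if r \<le> s then 1 else 0) * (a * exp (a * s))) *\<^sub>R G r) \<in> borel_measurable (N \<Otimes>\<^sub>M N)"
      by measurable
    also have "(\<lambda>(s, r). ((if r \<le> s then 1 else 0) * (a * exp (a * s))) *\<^sub>R G r) = (\<lambda>(s, r). K s r)"
      by (auto simp: K_def indicator_def fun_eq_iff)
    finally show ?thesis .
  qed
  have Kb: "cmod (K s r) \<le> \<bar>a\<bar> * E * BG" if "s \<in> {0..t}" "r \<in> {0..t}" for s r
  proof -
    have "cmod (K s r) \<le> \<bar>a\<bar> * exp (a * s) * cmod (G r)"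
      by (auto simp: K_def indicator_def abs_mult)
    also have "\<dots> \<le> \<bar>a\<bar> * E * BG"
      using that tT by (intro mult_mono E Gb) (auto simp: E0)
    finally show ?thesis .
  qed
  have Ki: "integrable (N \<Otimes>\<^sub>M N) (\<lambda>(s, r). K s r)"
    by (rule P.integrable_const_bound[of _ "\<bar>a\<bar> * E * BG"]) (auto simp: space_pair_measure intro!: Kb AE_I2)
  have iG: "integrable N G" by (rule bnd[of _ BG]) (use Gb tT in auto)
  have iz: "integrable N z" by (rule bnd[of _ Bz]) (use zb tT in auto)
  have ie: "integrable N (\<lambda>s. of_real (exp (a * s)) * f s)" if [measurable]: "f \<in> borel_measurable N" and f: "\<And>s. s \<in> {0..t} \<Longrightarrow> cmod (f s) \<le> B" for f :: "real \<Rightarrow> complex" and B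
  proof (rule bnd[of _ "E * B"])
    fix s assume s: "s \<in> {0..t}"
    show "cmod (of_real (exp (a * s)) * f s) \<le> E * B"
      unfolding norm_mult using E[OF s] f[OF s] E0 by (intro mult_mono) auto
  qed measurable
  have GbN: "\<And>s. s \<in> {0..t} \<Longrightarrow> cmod (G s) \<le> BG" and zbN: "\<And>s. s \<in> {0..t} \<Longrightarrow> cmod (z s) \<le> Bz" using Gb zb tT by auto
  note ieG = ie[OF _ GbN, simplified] and iez = ie[OF _ zbN, simplified]
  have I: "(\<integral>s. \<integral>r. K s r \<partial>N \<partial>N) = (\<integral>r. \<integral>s. K s r \<partial>N \<partial>N)"
    using NN.Fubini_integral[OF Ki] by simp
  have L: "(\<integral>r. K s r \<partial>N) = complex_of_real (a * exp (a * s)) * (z s - z0)" if s: "s \<in> {0..t}" for s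
  proof -
    have "(\<integral>r. K s r \<partial>N) = (\<integral>r. complex_of_real (a * exp (a * s)) * (indicator {..s} r *\<^sub>R G r) \<partial>N)"
      by (simp add: K_def scaleR_conv_of_real mult_ac)
    also have "\<dots> = complex_of_real (a * exp (a * s)) * (\<integral>r. indicator {..s} r *\<^sub>R G r \<partial>N)"
      by (rule integral_mult_right_zero)
    also have "(\<integral>r. indicator {..s} r *\<^sub>R G r \<partial>N) = z s - z0"
      unfolding N_def using s tT z[of s] by (subst integral_tm_indicator) auto
    finally show ?thesis .
  qed
  have R: "(\<integral>s. K s r \<partial>N) = complex_of_real (exp (a * t) - exp (a * r)) * G r" if r: "r \<in> {0..t}" for r
  proof -
    have "(\<integral>s. K s r \<partial>N) = (\<integral>s. complex_of_real (indicator {r..} s * (a * exp (a * s))) * G r \<partial>N)"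
      by (rule Bochner_Integration.integral_cong) (auto simp: K_def scaleR_conv_of_real indicator_def)
    also have "\<dots> = complex_of_real (exp (a * t) - exp (a * r)) * G r"
      unfolding integral_mult_left_zero integral_complex_of_real N_def using r by (subst integral_tm_exp) auto
    finally show ?thesis .
  qed
  have e1: "(\<integral>s. complex_of_real (a * exp (a * s)) \<partial>N) = complex_of_real (exp (a * t) - 1)"
  proof -
    have "(\<integral>s. complex_of_real (a * exp (a * s)) \<partial>N) = (\<integral>s. complex_of_real (indicator {0..} s * (a * exp (a * s))) \<partial>N)"
      by (rule Bochner_Integration.integral_cong) auto
    also have "\<dots> = complex_of_real (exp (a * t) - 1)"
      unfolding integral_complex_of_real N_def using t0 by (subst integral_tm_exp) auto
    finally show ?thesis .
  qed
  have "(\<integral>s. \<integral>r. K s r \<partial>N \<partial>N) = (\<integral>s. complex_of_real a * (complex_of_real (exp (a * s)) * z s) - complex_of_real (a * exp (a * s)) * z0 \<partial>N)"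
    by (rule Bochner_Integration.integral_cong) (auto simp: L algebra_simps)
  also have "\<dots> = complex_of_real a * (\<integral>s. complex_of_real (exp (a * s)) * z s \<partial>N) - complex_of_real (exp (a * t) - 1) * z0"
    using iez ie[of "\<lambda>_. of_real a" "\<bar>a\<bar>"] e1 by (simp add: mult.commute)
  finally have A: "(\<integral>s. \<integral>r. K s r \<partial>N \<partial>N) = complex_of_real a * (\<integral>s. complex_of_real (exp (a * s)) * z s \<partial>N) - complex_of_real (exp (a * t) - 1) * z0" .
  have "(\<integral>r. \<integral>s. K s r \<partial>N \<partial>N) = (\<integral>r. complex_of_real (exp (a * t)) * G r - complex_of_real (exp (a * r)) * G r \<partial>N)"
    by (rule Bochner_Integration.integral_cong) (auto simp: R algebra_simps)
  also have "\<dots> = complex_of_real (exp (a * t)) * (\<integral>r. G r \<partial>N) - (\<integral>r. complex_of_real (exp (a * r)) * G r \<partial>N)"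
    using ieG iG by simp
  also have "(\<integral>r. G r \<partial>N) = z t - z0" using z[OF t] by (simp add: N_def)
  finally have B: "(\<integral>r. \<integral>s. K s r \<partial>N \<partial>N) = complex_of_real (exp (a * t)) * (z t - z0) - (\<integral>r. complex_of_real (exp (a * r)) * G r \<partial>N)" .
  have "complex_of_real (exp (a * t)) * z t = z0 + (complex_of_real a * (\<integral>s. complex_of_real (exp (a * s)) * z s \<partial>N) + (\<integral>r. complex_of_real (exp (a * r)) * G r \<partial>N))"
    using A B I by (simp add: algebra_simps)
  also have "\<dots> = z0 + (\<integral>s. complex_of_real (exp (a * s)) * (G s + a * z s) \<partial>N)"
    using iez ieG by (simp add: algebra_simps)
  finally have C: "complex_of_real (exp (a * t)) * z t = z0 + (\<integral>s. complex_of_real (exp (a * s)) * (G s + a * z s) \<partial>N)" .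
  have "z t = complex_of_real (exp (- a * t)) * (complex_of_real (exp (a * t)) * z t)"
    by (simp add: exp_minus field_simps flip: of_real_mult)
  also have "\<dots> = complex_of_real (exp (- a * t)) * z0 + (\<integral>s. complex_of_real (exp (- a * t)) * (complex_of_real (exp (a * s)) * (G s + a * z s)) \<partial>N)"
    unfolding C integral_mult_right_zero by (rule distrib_left)
  also have "(\<integral>s. complex_of_real (exp (- a * t)) * (complex_of_real (exp (a * s)) * (G s + a * z s)) \<partial>N) = (\<integral>s. complex_of_real (exp (- a * (t - s))) * (G s + a * z s) \<partial>N)"
  proof -
    have "exp (- a * t) * exp (a * s) = exp (- a * (t - s))" for s
      by (simp add: exp_add [symmetric] algebra_simps)
    then have "complex_of_real (exp (- a * t)) * (complex_of_real (exp (a * s)) * X) = complex_of_real (exp (- a * (t - s))) * X" for s X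
      by (simp only: mult.assoc[symmetric] of_real_mult[symmetric])
    then show ?thesis by (simp only:)
  qed
  finally show ?thesis by (simp add: N_def)
qed

text \<open>Duhamel's formula is applied to \<open>z - z0\<close>, which starts at 0 and is driven
  by \<open>G s + a * z s - a * z0\<close>. Hence \<open>a\<close> multiplies only the initial
  value, whose decay in the frequency is known, and the heat factor is at most 1.\<close>

lemma duhamel_increment_bound:
  fixes a :: real
  assumes a: "0 \<le> a" and t: "t \<in> {0..T}" and F: "\<And>s. s \<in> {0..t} \<Longrightarrow> cmod (G s + a * z s) \<le> B"
  shows "cmod (z t - z0) \<le> t * (a * cmod z0 + B)"
proof -
  define w where "w s = z s - z0" for s
  interpret w: integral_curve w G 0 T "Bz + cmod z0" BG
  proof
    show "w \<in> borel_measurable (tm T)" unfolding w_def using zm by measurable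
    show "cmod (w s) \<le> Bz + cmod z0" if "s \<in> {0..T}" for s
      unfolding w_def using zb[OF that] norm_triangle_ineq4[of "z s" z0] by simp
    show "w t = 0 + (\<integral>s. G s \<partial>tm t)" if "t \<in> {0..T}" for t unfolding w_def using z[OF that] by simp
  qed (rule Gm Gb; assumption?)+
  have "w t = complex_of_real (exp (- a * t)) * 0 + (\<integral>s. complex_of_real (exp (- a * (t - s))) * (G s + a * w s) \<partial>tm t)"
    by (rule w.duhamel[OF t])
  then have "cmod (w t) = cmod (\<integral>s. of_real (exp (- a * (t - s))) * (G s + a * w s) \<partial>tm t)" by simp
  also have "\<dots> \<le> (\<integral>s. (a * cmod z0 + B) \<partial>tm t)"
  proof (rule order_trans[OF integral_norm_bound integral_mono'])
    fix s assume "s \<in> space (tm t)"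
    then have s: "s \<in> {0..t}" by simp
    have "cmod (of_real (exp (- a * (t - s))) * (G s + a * w s)) \<le> 1 * (a * cmod z0 + B)"
      unfolding norm_mult
    proof (rule mult_mono)
      show "cmod (of_real (exp (- a * (t - s)))) \<le> 1" using s a by simp
      have "G s + a * w s = (G s + a * z s) - a * z0" by (simp add: w_def algebra_simps)
      also have "cmod \<dots> \<le> B + a * cmod z0"
        using F[OF s] norm_triangle_ineq4[of "G s + a * z s" "a * z0"] a by (simp add: norm_mult)
      finally show "cmod (G s + a * w s) \<le> a * cmod z0 + B" by simp
    qed simp_all
    then show "cmod (of_real (exp (- a * (t - s))) * (G s + a * w s)) \<le> a * cmod z0 + B" by simp
    show "0 \<le> a * cmod z0 + B" using F[OF s] a norm_ge_zero order_trans by (metis add_nonneg_nonneg mult_nonneg_nonneg norm_ge_zero)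
  qed simp
  also have "\<dots> = t * (a * cmod z0 + B)" using t integral_tm_const[of t "a * cmod z0 + B"] by simp
  finally show ?thesis by (simp add: w_def)
qed

text \<open>Cauchy-Schwarz in Duhamel's formula: the squared heat factor has integral at most
  \<open>1 / (2 * a)\<close>, and squaring a sum of two terms costs a factor 2.\<close>

lemma duhamel_energy_bound:
  fixes a :: real
  assumes a: "0 < a" and t: "t \<in> {0..T}"
  shows "(cmod (z t))^2 \<le> 2 * (cmod z0)^2 + (1 / a) * (\<integral>s. (cmod (G s + a * z s))^2 \<partial>tm t)"
proof -
  have tT: "t \<le> T" and t0: "0 \<le> t" using t by auto
  note [measurable] = measurable_tm_mono[OF zm tT] measurable_tm_mono[OF Gm tT]
  have Fb: "cmod (G s + a * z s) \<le> BG + a * Bz" if "s \<in> {0..t}" for s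
  proof -
    have "cmod (G s + a * z s) \<le> cmod (G s) + a * cmod (z s)"
      using norm_triangle_ineq[of "G s" "a * z s"] a by (simp add: norm_mult)
    also have "\<dots> \<le> BG + a * Bz" using a that tT Gb[of s] zb[of s] by (intro add_mono mult_left_mono) auto
    finally show ?thesis .
  qed
  define J where "J = (\<integral>s. of_real (exp (- a * (t - s))) * (G s + a * z s) \<partial>tm t)"
  have "(cmod J)^2 \<le> (\<integral>s. (cmod (of_real (exp (- a * (t - s)))))^2 \<partial>tm t) * (\<integral>s. (cmod (G s + a * z s))^2 \<partial>tm t)"
    unfolding J_def
  proof (rule integral_Cauchy_Schwarz(2))
    show "integrable (tm t) (\<lambda>s. (cmod (of_real (exp (- a * (t - s)))))^2)"
    proof (rule integrable_tm_bounded)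
      fix s assume "s \<in> {0..t}"
      then show "norm ((cmod (of_real (exp (- a * (t - s)))))^2) \<le> 1"
        using a by (simp add: power_le_one)
    qed measurable
    show "integrable (tm t) (\<lambda>s. (cmod (G s + a * z s))^2)"
    proof (rule integrable_tm_bounded)
      fix s assume "s \<in> {0..t}"
      then show "norm ((cmod (G s + a * z s))^2) \<le> (BG + a * Bz)^2"
        using power_mono[OF Fb[of s], of 2] by simp
    qed measurable
  qed measurable
  also have "\<dots> \<le> (1 / (2 * a)) * (\<integral>s. (cmod (G s + a * z s))^2 \<partial>tm t)"
  proof (rule mult_right_mono)
    have "(exp (- a * (t - s)))^2 = exp (- 2 * a * t) * exp ((2 * a) * s)" for s
      by (simp add: power2_eq_square exp_add [symmetric] algebra_simps)
    then have "(2 * a) * (\<integral>s. (cmod (of_real (exp (- a * (t - s)))))^2 \<partial>tm t)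
       = (\<integral>s. exp (- 2 * a * t) * (indicator {0..} s * ((2 * a) * exp ((2 * a) * s))) \<partial>tm t)"
      unfolding integral_mult_right_zero[symmetric]
      by (intro Bochner_Integration.integral_cong refl) (simp only: norm_of_real abs_exp_cancel, simp)
    also have "\<dots> = exp (- 2 * a * t) * (exp (2 * a * t) - 1)"
      unfolding integral_mult_right_zero using integral_tm_exp[of 0 t "2 * a"] t0 by simp
    also have "\<dots> = 1 - exp (- 2 * a * t)" by (simp add: right_diff_distrib exp_minus)
    also have "\<dots> \<le> 1" by simp
    finally show "(\<integral>s. (cmod (of_real (exp (- a * (t - s)))))^2 \<partial>tm t) \<le> 1 / (2 * a)"
      using a by (simp add: field_simps)
  qed simp
  finally have J: "(cmod J)^2 \<le> (1 / (2 * a)) * (\<integral>s. (cmod (G s + a * z s))^2 \<partial>tm t)" .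
  have "z t = complex_of_real (exp (- a * t)) * z0 + J" unfolding J_def by (rule duhamel[OF t])
  then have "cmod (z t) \<le> exp (- a * t) * cmod z0 + cmod J"
    using norm_triangle_ineq[of "complex_of_real (exp (- a * t)) * z0" J] by (simp add: norm_mult)
  also have "\<dots> \<le> 1 * cmod z0 + cmod J" using a t0 by (intro add_right_mono mult_right_mono) auto
  finally have "(cmod (z t))^2 \<le> (cmod z0 + cmod J)^2" by (intro power_mono) auto
  also have "\<dots> \<le> 2 * (cmod z0)^2 + 2 * (cmod J)^2"
    using zero_le_power2[of "cmod z0 - cmod J"] by (simp add: power2_eq_square algebra_simps)
  also have "\<dots> \<le> 2 * (cmod z0)^2 + (1 / a) * (\<integral>s. (cmod (G s + a * z s))^2 \<partial>tm t)"
    using J by simp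
  finally show ?thesis .
qed

end

section \<open>The aggregation-diffusion equation\<close>

text \<open>The eigenvalue of minus the Laplacian at \<open>chr k\<close>.\<close>

definition lam :: "int^'d \<Rightarrow> real" where "lam k = 4 * pi^2 * (norm (kvec k))^2"

lemma lam_nonneg: "0 \<le> lam k" by (simp add: lam_def)

lemma kvec_eq_0_iff: "kvec k = 0 \<longleftrightarrow> k = 0"
  by (auto simp: kvec_def vec_eq_iff)

lemma lam_pos: "k \<noteq> 0 \<Longrightarrow> 0 < lam k"
  by (simp add: lam_def kvec_eq_0_iff)

lemma lam_zero [simp]: "lam 0 = 0" by (simp add: lam_def)

lemma lapc_eq: "lapc u k = - (of_real (lam k) * fc u k)"
  by (simp add: lapc_def lam_def)

lemma divc_le_sum:
  "cmod (divc F k) \<le> (\<Sum>j\<in>UNIV. (2 * pi * \<bar>real_of_int (k $ j)\<bar>) * cmod (fc (F j) k))"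
  unfolding divc_def by (rule order_trans[OF norm_sum]) (simp add: norm_mult)

text \<open>Cauchy-Schwarz in the components; the squared symbols of the partial derivatives add up
  to \<open>lam k\<close>.\<close>

lemma divc_power2_le: "(cmod (divc F k))^2 \<le> lam k * (\<Sum>j\<in>UNIV. (cmod (fc (F j) k))^2)"
proof -
  have "(cmod (divc F k))^2 \<le> (\<Sum>j\<in>UNIV. (2 * pi * \<bar>real_of_int (k $ j)\<bar>) * cmod (fc (F j) k))^2"
    by (rule power_mono[OF divc_le_sum]) simp
  also have "\<dots> \<le> (\<Sum>j\<in>UNIV. (2 * pi * \<bar>real_of_int (k $ j)\<bar>)^2) * (\<Sum>j\<in>UNIV. (cmod (fc (F j) k))^2)"
    by (rule Cauchy_Schwarz_ineq_sum)
  also have "(\<Sum>j\<in>UNIV. (2 * pi * \<bar>real_of_int (k $ j)\<bar>)^2) = lam k"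
    unfolding lam_def norm_kvec_power2 by (simp add: power_mult_distrib sum_distrib_left)
  finally show ?thesis .
qed

lemma divc_le:
  fixes F :: "'d \<Rightarrow> real^'d \<Rightarrow> real"
  assumes "\<And>j. cmod (fc (F j) k) \<le> B"
  shows "cmod (divc F k) \<le> 2 * pi * norm (kvec k) * (real CARD('d) * B)"
proof -
  have "cmod (divc F k) \<le> (\<Sum>j\<in>UNIV. (2 * pi * \<bar>real_of_int (k $ j)\<bar>) * cmod (fc (F j) k))"
    by (rule divc_le_sum)
  also have "\<dots> \<le> (\<Sum>j\<in>(UNIV :: 'd set). (2 * pi * norm (kvec k)) * B)"
  proof (intro sum_mono mult_mono assms mult_left_mono)
    fix j show "\<bar>real_of_int (k $ j)\<bar> \<le> norm (kvec k)" by (rule component_le_norm_kvec)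
  qed auto
  finally show ?thesis by (simp add: mult_ac)
qed

text \<open>No continuity of \<open>P\<close> is assumed. The bound is propagated in time steps so short that the crude
  bound \<open>Q\<close> costs at most \<open>a / 2\<close> on each of them.\<close>

lemma quadratic_gronwall:
  fixes P :: "real \<Rightarrow> real"
  assumes Pm: "P \<in> borel_measurable (tm T)" and P0: "\<And>t. t \<in> {0..T} \<Longrightarrow> 0 \<le> P t" and PQ: "\<And>t. t \<in> {0..T} \<Longrightarrow> P t \<le> Q"
    and a: "0 < a" and b: "0 \<le> b" and P: "\<And>t. t \<in> {0..T} \<Longrightarrow> P t \<le> a + b * (\<integral>s. (P s)^2 \<partial>tm t)"
    and t: "t \<in> {0..T}" "8 * a * b * t \<le> 1"
  shows "P t \<le> 2 * a"
proof -
  \<comment> \<open>Adding 1 keeps the denominator positive when \<open>b\<close> or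
    \<open>Q\<close> vanishes.\<close>
  define \<delta> where "\<delta> = a / (2 * (b * Q^2 + 1))"
  have bQ: "0 \<le> b * Q^2" using b by simp
  have \<delta>: "0 < \<delta>" using a bQ by (simp add: \<delta>_def add_nonneg_pos)
  have \<delta>b: "b * Q^2 * \<delta> \<le> a / 2"
  proof -
    have "b * Q^2 * \<delta> \<le> (b * Q^2 + 1) * \<delta>" using \<delta> by simp
    also have "\<dots> = a / 2" using bQ by (simp add: \<delta>_def field_simps)
    finally show ?thesis .
  qed
  have "\<forall>t\<in>{0..T}. 8 * a * b * t \<le> 1 \<longrightarrow> t < real n * \<delta> \<longrightarrow> P t \<le> 2 * a" for n
  proof (induction n)
    case 0 then show ?case by auto
  next
    case (Suc n)
    show ?case
    proof (intro ballI impI)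
      fix t assume t: "t \<in> {0..T}" "8 * a * b * t \<le> 1" "t < real (Suc n) * \<delta>"
      have tT: "t \<le> T" and t0: "0 \<le> t" using t by auto
      have [measurable]: "P \<in> borel_measurable (tm t)" by (rule measurable_tm_mono[OF Pm tT])
      have st: "{real n * \<delta>..} \<inter> {0..t} \<in> sets (tm t)"
        unfolding tm_def by (auto simp: sets_restrict_space)
      \<comment> \<open>Times covered by the induction hypothesis contribute
        \<open>(2 * a)^2\<close>; the crude bound is used only on the last, short interval.\<close>
      have pw: "(P s)^2 \<le> 4 * a^2 + Q^2 * indicator {real n * \<delta>..} s" if s: "s \<in> {0..t}" for s
      proof (cases "s < real n * \<delta>")
        case True
        have "8 * a * b * s \<le> 8 * a * b * t" using s a b by (intro mult_left_mono) auto
        then have "P s \<le> 2 * a" using Suc True s t tT by auto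
        then have "(P s)^2 \<le> (2 * a)^2" using P0[of s] s tT by (intro power_mono) auto
        then show ?thesis using True by (simp add: power_mult_distrib)
      next
        case False
        have "(P s)^2 \<le> Q^2" using P0[of s] PQ[of s] s tT by (intro power_mono) auto
        then show ?thesis using False by (simp add: add_increasing)
      qed
      have im: "(indicator {real n * \<delta>..} :: real \<Rightarrow> real) \<in> borel_measurable (tm t)"
        by (rule measurable_compose[OF tm_measurable_id]) measurable
      have ii: "integrable (tm t) (indicator {real n * \<delta>..} :: real \<Rightarrow> real)"
        by (rule integrable_tm_bounded[OF im, where B = 1]) (auto simp: indicator_def)
      have "(\<integral>s. (P s)^2 \<partial>tm t) \<le> (\<integral>s. 4 * a^2 + Q^2 * indicator {real n * \<delta>..} s \<partial>tm t)"
      proof (rule integral_mono)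
        show "integrable (tm t) (\<lambda>s. (P s)^2)"
          by (rule integrable_tm_bounded[of _ _ "Q^2"]) (use P0 PQ tT in \<open>auto intro!: power_mono\<close>)
        show "integrable (tm t) (\<lambda>s. 4 * a^2 + Q^2 * indicator {real n * \<delta>..} s)" using ii by simp
      qed (use pw in auto)
      also have "\<dots> = t * (4 * a^2) + Q^2 * (\<integral>s. indicator {real n * \<delta>..} s \<partial>tm t)"
        using ii integral_tm_const[OF t0, of "4 * a^2"] by simp
      also have "(\<integral>s. indicator {real n * \<delta>..} s \<partial>tm t) \<le> \<delta>"
      proof -
        have "(\<integral>s. indicator {real n * \<delta>..} s \<partial>tm t) = measure lborel ({0..t} \<inter> {real n * \<delta>..})"
        proof -
          have "(\<integral>s. indicator {real n * \<delta>..} s \<partial>tm t) = (\<integral>s. indicator ({0..t} \<inter> {real n * \<delta>..}) s \<partial>lborel :: real)"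
            unfolding set_integral_tm[symmetric] set_lebesgue_integral_def
            by (rule Bochner_Integration.integral_cong) (auto simp: indicator_def)
          then show ?thesis by simp
        qed
        also have "\<dots> \<le> measure lborel {real n * \<delta>..real (Suc n) * \<delta>}"
        proof (rule measure_mono_fmeasurable)
          show "{0..t} \<inter> {real n * \<delta>..} \<subseteq> {real n * \<delta>..real (Suc n) * \<delta>}" using t(3) by auto
          show "{real n * \<delta>..real (Suc n) * \<delta>} \<in> fmeasurable lborel"
            using fmeasurable_cbox[of "real n * \<delta>" "real (Suc n) * \<delta>"] by simp
        qed simp
        also have "\<dots> = \<delta>" using \<delta> by (simp add: algebra_simps)
        finally show ?thesis .
      qed
      finally have "(\<integral>s. (P s)^2 \<partial>tm t) \<le> t * (4 * a^2) + Q^2 * \<delta>" by (simp add: mult_left_mono)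
      then have "b * (\<integral>s. (P s)^2 \<partial>tm t) \<le> b * (t * (4 * a^2) + Q^2 * \<delta>)" using b by (rule mult_left_mono)
      also have "\<dots> = a / 2 * (8 * a * b * t) + b * Q^2 * \<delta>" by (simp add: power2_eq_square algebra_simps)
      \<comment> \<open>The restriction on \<open>t\<close> pays for the first half and the choice
        of \<open>\<delta>\<close> for the second; with the leading \<open>a\<close> this adds up to
        \<open>2 * a\<close>.\<close>
      also have "\<dots> \<le> a / 2 * 1 + a / 2" using t(2) a \<delta>b by (intro add_mono mult_left_mono) auto
      finally show "P t \<le> 2 * a" using P[OF t(1)] by simp
    qed
  qed
  moreover obtain n :: nat where "t / \<delta> < real n" using reals_Archimedean2 by blast
  then have "t < real n * \<delta>" using \<delta> by (simp add: field_simps)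
  ultimately show ?thesis using t by blast
qed

section \<open>Fourier estimates of the drift\<close>

locale drift_field =
  fixes g :: "'d \<Rightarrow> real^'d \<Rightarrow> real" and M T :: real
  assumes kernel: "\<And>j. bounded_kernel (g j) M" and T: "0 < T"
begin

lemma M0: "0 \<le> M" using kernel unfolding bounded_kernel_def by blast

lemma drift_L2:
  assumes "L2cube a" "L2cube b"
  shows "L2cube (drift a g b j)" "L2norm (drift a g b j) \<le> M * L2norm a * L2norm b"
  unfolding drift_def using bounded_kernel.L2cube_mult_conv[OF kernel assms] by auto

lemma fc_drift_le:
  assumes "L2cube a" "L2cube b"
  shows "cmod (fc (drift a g b j) k) \<le> M * L2norm a * L2norm b"
  unfolding drift_def using bounded_kernel.fc_mult_conv_bound[OF kernel assms] by auto

lemma fc_drift_measurable: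
  assumes "regular T a" "regular T b"
  shows "(\<lambda>s. fc (drift (a s) g (b s) j) k) \<in> borel_measurable (tm T)"
  unfolding drift_def
  by (rule bounded_kernel.fc_mult_conv_measurable[OF kernel]) (use assms in \<open>auto simp: regular_def\<close>)

lemma divc_drift_measurable:
  assumes "regular T a" "regular T b"
  shows "(\<lambda>s. divc (drift (a s) g (b s)) k) \<in> borel_measurable (tm T)"
proof -
  note [measurable] = fc_drift_measurable[OF assms]
  show ?thesis unfolding divc_def by measurable
qed

lemma divc_drift_le:
  assumes "L2cube a" "L2cube b"
  shows "cmod (divc (drift a g b) k) \<le> 2 * pi * norm (kvec k) * (real CARD('d) * (M * L2norm a * L2norm b))"
  by (rule divc_le) (rule fc_drift_le[OF assms])

text \<open>Bessel's inequality for each component, so that summing over modes does not cost their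
  number.\<close>

lemma sum_fc_drift_le:
  assumes "L2cube a" "L2cube b" "finite F"
  shows "(\<Sum>j\<in>UNIV. \<Sum>k\<in>F. (cmod (fc (drift a g b j) k))^2) \<le> real CARD('d) * M^2 * (L2norm a)^2 * (L2norm b)^2"
proof -
  have "(\<Sum>j\<in>UNIV. \<Sum>k\<in>F. (cmod (fc (drift a g b j) k))^2) \<le> (\<Sum>j\<in>(UNIV::'d set). (M * L2norm a * L2norm b)^2)"
  proof (rule sum_mono)
    fix j
    have "(\<Sum>k\<in>F. (cmod (fc (drift a g b j) k))^2) \<le> (L2norm (drift a g b j))^2"
      by (rule bessel[OF assms(3) drift_L2(1)[OF assms(1,2)]])
    also have "\<dots> \<le> (M * L2norm a * L2norm b)^2"
      by (rule power_mono[OF drift_L2(2)[OF assms(1,2)]]) simp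
    finally show "(\<Sum>k\<in>F. (cmod (fc (drift a g b j) k))^2) \<le> (M * L2norm a * L2norm b)^2" .
  qed
  then show ?thesis by (simp add: power_mult_distrib mult_ac)
qed

lemma regularD:
  assumes "regular T u" "t \<in> {0..T}"
  shows "L2cube (u t)" "(\<lambda>k. cmod (fc (u t) k)) summable_on UNIV"
  using assms by (auto simp: regular_def)

lemma regular_bound:
  assumes "regular T u" obtains R where "0 < R" "\<And>t. t \<in> {0..T} \<Longrightarrow> L2norm (u t) \<le> R"
proof -
  obtain R where "\<forall>t\<in>{0..T}. L2norm (u t) \<le> R" using assms by (auto simp: regular_def)
  then show ?thesis using that[of "max R 1"] by (auto simp: le_max_iff_disj)
qed

lemma regular_fc_le:
  assumes "L2cube u" shows "cmod (fc u k) \<le> L2norm u"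
  using cmod_fc_le_L1[of u k] L1_le_L2norm[OF assms] by linarith

end

section \<open>A priori bounds for the nonlinear solution\<close>

locale aggregation = drift_field g M T for g :: "'d \<Rightarrow> real^'d \<Rightarrow> real" and M T :: real +
  fixes beta :: nat and phi :: "real^'d \<Rightarrow> real" and rho :: "real \<Rightarrow> real^'d \<Rightarrow> real" and A :: real
  assumes beta: "beta \<ge> CARD('d) + 1" "beta \<ge> 2"
    and sol: "agg_sol T beta phi g rho"
    and phi: "sob_mem (real beta) phi" and A: "0 < A" "sob_norm2 (real beta) phi \<le> A^2"
begin

lemma rho_regular: "regular T rho"
  using sol unfolding agg_sol_def by (intro in_F_regular[OF T beta(1)]) blast

abbreviation (input) "z k s \<equiv> fc (rho s) k"
abbreviation (input) "f k s \<equiv> divc (drift (rho s) g (rho s)) k"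
abbreviation (input) "G k s \<equiv> lapc (rho s) k + divc (drift (rho s) g (rho s)) k"

lemma G_eq: "G k s + lam k * z k s = f k s"
  by (simp add: lapc_eq)

lemma rho_bound_qualitative:
  obtains R where "0 < R" "\<And>t. t \<in> {0..T} \<Longrightarrow> L2norm (rho t) \<le> R"
  using regular_bound[OF rho_regular] by blast

text \<open>\<open>Bz\<close> and \<open>BG\<close> stay existential since they rest on an
  uncontrolled bound for \<open>rho\<close>; their role is to justify integrability in Duhamel's
  formula.\<close>

lemma mode_integral_curve:
  obtains Bz BG where "integral_curve (z k) (G k) (fc phi k) T Bz BG"
proof -
  obtain R where R: "0 < R" "\<And>t. t \<in> {0..T} \<Longrightarrow> L2norm (rho t) \<le> R" using rho_bound_qualitative by blast
  have [measurable]: "z k \<in> borel_measurable (tm T)" using rho_regular by (simp add: regular_def)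
  note [measurable] = divc_drift_measurable[OF rho_regular rho_regular]
  have zb: "cmod (z k s) \<le> R" if "s \<in> {0..T}" for s
    using regular_fc_le[OF regularD(1)[OF rho_regular that], of k] R(2)[OF that] by linarith
  have "integral_curve (z k) (G k) (fc phi k) T R (lam k * R + 2 * pi * norm (kvec k) * (real CARD('d) * (M * R * R)))"
  proof
    show "z k \<in> borel_measurable (tm T)" by measurable
    show "G k \<in> borel_measurable (tm T)" unfolding lapc_eq by measurable
    show "z k t = fc phi k + (\<integral>s. G k s \<partial>tm t)" if "t \<in> {0..T}" for t
      using sol that unfolding agg_sol_def set_integral_tm by blast
    fix s assume s: "s \<in> {0..T}"
    show "cmod (z k s) \<le> R" by (rule zb[OF s])
    have "cmod (lapc (rho s) k) \<le> lam k * R"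
      unfolding lapc_eq using zb[OF s] lam_nonneg[of k] by (simp add: norm_mult mult_left_mono)
    moreover have "cmod (f k s) \<le> 2 * pi * norm (kvec k) * (real CARD('d) * (M * R * R))"
      by (rule order_trans[OF divc_drift_le[OF regularD(1)[OF rho_regular s] regularD(1)[OF rho_regular s]]])
        (use R(1) R(2)[OF s] M0 in \<open>auto intro!: mult_left_mono mult_mono\<close>)
    ultimately show "cmod (G k s) \<le> lam k * R + 2 * pi * norm (kvec k) * (real CARD('d) * (M * R * R))"
      by (rule norm_triangle_mono)
  qed
  then show thesis by (rule that)
qed

text \<open>By Cauchy-Schwarz, this dominates \<open>(cmod (f k s))^2 / lam k\<close>.\<close>

definition "drift_modes k s = (\<Sum>j\<in>UNIV. (cmod (fc (drift (rho s) g (rho s) j) k))^2)"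

lemma drift_modes_nonneg: "0 \<le> drift_modes k s"
  unfolding drift_modes_def by (simp add: sum_nonneg)

lemma sum_drift_modes_le:
  assumes "s \<in> {0..T}" "finite F"
  shows "(\<Sum>k\<in>F. drift_modes k s) \<le> real CARD('d) * M^2 * ((L2norm (rho s))^2)^2"
proof -
  have "(\<Sum>k\<in>F. drift_modes k s) = (\<Sum>j\<in>UNIV. \<Sum>k\<in>F. (cmod (fc (drift (rho s) g (rho s) j) k))^2)"
    unfolding drift_modes_def by (rule sum.swap)
  also have "\<dots> \<le> real CARD('d) * M^2 * (L2norm (rho s))^2 * (L2norm (rho s))^2"
    using assms by (intro sum_fc_drift_le regularD[OF rho_regular])
  finally show ?thesis by (simp add: power2_eq_square mult_ac)
qed

lemma L2norm_power4_integrable: "integrable (tm T) (\<lambda>s. ((L2norm (rho s))^2)^2)"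
proof -
  obtain R where R: "0 < R" "\<And>t. t \<in> {0..T} \<Longrightarrow> L2norm (rho t) \<le> R" using rho_bound_qualitative by blast
  note [measurable] = regular_L2norm_measurable(1)[OF rho_regular]
  show ?thesis
  proof (rule integrable_tm_bounded)
    fix s assume "s \<in> {0..T}"
    then have "((L2norm (rho s))^2)^2 \<le> (R^2)^2" using R by (intro power_mono) auto
    then show "norm (((L2norm (rho s))^2)^2) \<le> (R^2)^2" by simp
  qed measurable
qed

lemma drift_modes_integrable: "integrable (tm T) (drift_modes k)"
proof (rule Bochner_Integration.integrable_bound[of _ "\<lambda>s. real CARD('d) * M^2 * ((L2norm (rho s))^2)^2"])
  show "integrable (tm T) (\<lambda>s. real CARD('d) * M^2 * ((L2norm (rho s))^2)^2)"
    using L2norm_power4_integrable by simp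
  show "AE s in tm T. norm (drift_modes k s) \<le> norm (real CARD('d) * M^2 * ((L2norm (rho s))^2)^2)"
    using sum_drift_modes_le[of _ "{k}"] drift_modes_nonneg by (auto intro!: AE_I2)
  note [measurable] = fc_drift_measurable[OF rho_regular rho_regular]
  show "drift_modes k \<in> borel_measurable (tm T)" unfolding drift_modes_def by measurable
qed

lemma phi_sum_le:
  assumes "finite F" shows "(\<Sum>k\<in>F. (cmod (fc phi k))^2) \<le> A^2"
proof -
  have "(\<Sum>k\<in>F. (cmod (fc phi k))^2) \<le> (\<Sum>k\<in>F. sob_weight (real beta) phi k)"
  proof (rule sum_mono)
    fix k :: "int^'d"
    have "1 \<le> (1 + (norm (kvec k))^2) powr real beta" by (rule ge_one_powr_ge_zero) auto
    then show "(cmod (fc phi k))^2 \<le> sob_weight (real beta) phi k"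
      unfolding sob_weight_def by (simp add: mult_le_cancel_right1)
  qed
  also have "\<dots> \<le> A^2" using sob_weight_sum_le[OF phi assms] A(2) by linarith
  finally show ?thesis .
qed

text \<open>Since \<open>beta \<ge> 2\<close>, the Laplacian of \<open>phi\<close> has bounded
  modes; applied to the initial datum it therefore costs no power of the frequency.\<close>

lemma phi_decay: "(norm (kvec k))^2 * cmod (fc phi k) \<le> A"
proof (rule power2_le_imp_le)
  have "((norm (kvec k))^2 * cmod (fc phi k))^2 \<le> (wt k)^2 * (cmod (fc phi k))^2"
    unfolding power_mult_distrib wt_def by (intro mult_right_mono power_mono) auto
  also have "(wt k)^2 * (cmod (fc phi k))^2 \<le> wt k powr real beta * (cmod (fc phi k))^2"
  proof (rule mult_right_mono)
    have "(wt k)^2 = wt k powr 2" using wt_ge_1[of k] by (simp add: powr_numeral)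
    also have "\<dots> \<le> wt k powr real beta" using wt_ge_1 beta(2) by (intro powr_mono) auto
    finally show "(wt k)^2 \<le> wt k powr real beta" .
  qed simp
  also have "\<dots> = (\<Sum>k\<in>{k}. sob_weight (real beta) phi k)" by (simp add: sob_weight_def wt_def)
  also have "\<dots> \<le> A^2" using sob_weight_sum_le[OF phi, of "{k}"] A(2) by simp
  finally show "((norm (kvec k))^2 * cmod (fc phi k))^2 \<le> A^2" .
qed (use A in simp)

text \<open>Dissipation absorbs the derivative in the drift: the factor \<open>1 / lam k\<close> from the heat kernel
  cancels the \<open>lam k\<close> lost in the divergence.\<close>

lemma mode_energy:
  assumes t: "t \<in> {0..T}"
  shows "(cmod (z k t))^2 \<le> 2 * (cmod (fc phi k))^2 + (\<integral>s. drift_modes k s \<partial>tm t)"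
proof -
  obtain Bz BG where "integral_curve (z k) (G k) (fc phi k) T Bz BG" using mode_integral_curve by blast
  then interpret integral_curve "z k" "G k" "fc phi k" T Bz BG .
  show ?thesis
  proof (cases "k = 0")
    case True
    \<comment> \<open>At frequency 0, where one cannot divide by \<open>lam k\<close>, mass is
      conserved.\<close>
    have "G k s = 0" for s unfolding lapc_eq True by (simp add: divc_def)
    then have "z k t = fc phi k" using z[OF t] by simp
    moreover have "0 \<le> (\<integral>s. drift_modes k s \<partial>tm t)" using drift_modes_nonneg by simp
    ultimately show ?thesis by simp
  next
    case False
    note l = lam_pos[OF False]
    have "(cmod (z k t))^2 \<le> 2 * (cmod (fc phi k))^2 + (1 / lam k) * (\<integral>s. (cmod (G k s + lam k * z k s))^2 \<partial>tm t)"
      by (rule duhamel_energy_bound[OF l t])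
    also have "(1 / lam k) * (\<integral>s. (cmod (G k s + lam k * z k s))^2 \<partial>tm t) = (\<integral>s. (1 / lam k) * (cmod (f k s))^2 \<partial>tm t)"
      unfolding G_eq by simp
    also have "\<dots> \<le> (\<integral>s. drift_modes k s \<partial>tm t)"
    proof (rule integral_mono')
      show "integrable (tm t) (drift_modes k)" by (rule integrable_tm_mono[OF drift_modes_integrable]) (use t in simp)
      fix s show "(1 / lam k) * (cmod (f k s))^2 \<le> drift_modes k s"
        using divc_power2_le[of "drift (rho s) g (rho s)" k] l unfolding drift_modes_def by (simp add: field_simps)
    qed (rule drift_modes_nonneg)
    finally show ?thesis by simp
  qed
qed

text \<open>The modewise bounds are summed over a finite set and passed to the limit. The drift is
  bilinear in \<open>rho\<close>, so its square is quadratic in the squared norm; this is why the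
  resulting bound is local in time.\<close>

lemma energy_inequality:
  assumes t: "t \<in> {0..T}"
  shows "(L2norm (rho t))^2 \<le> 2 * A^2 + real CARD('d) * M^2 * (\<integral>s. ((L2norm (rho s))^2)^2 \<partial>tm t)"
proof (rule L2norm_le_of_sums[OF regularD[OF rho_regular t]])
  fix F :: "(int^'d) set" assume F: "finite F"
  have tT: "t \<le> T" using t by simp
  note i = integrable_tm_mono[OF drift_modes_integrable tT] integrable_tm_mono[OF L2norm_power4_integrable tT]
  have "(\<Sum>k\<in>F. (cmod (z k t))^2) \<le> (\<Sum>k\<in>F. 2 * (cmod (fc phi k))^2 + (\<integral>s. drift_modes k s \<partial>tm t))"
    by (intro sum_mono mode_energy t)
  also have "\<dots> = 2 * (\<Sum>k\<in>F. (cmod (fc phi k))^2) + (\<integral>s. (\<Sum>k\<in>F. drift_modes k s) \<partial>tm t)"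
    using i by (simp add: sum.distrib sum_distrib_left)
  also have "\<dots> \<le> 2 * A^2 + (\<integral>s. real CARD('d) * M^2 * ((L2norm (rho s))^2)^2 \<partial>tm t)"
    by (intro add_mono mult_left_mono phi_sum_le F integral_mono)
      (use i sum_drift_modes_le[OF _ F] tT in auto)
  finally show "(\<Sum>k\<in>F. (cmod (fc (rho t) k))^2) \<le> 2 * A^2 + real CARD('d) * M^2 * (\<integral>s. ((L2norm (rho s))^2)^2 \<partial>tm t)"
    by simp
qed

text \<open>\<open>quadratic_gronwall\<close> for the squared norm with \<open>a = 2 * A^2\<close>,
  which doubles to \<open>(2 * A)^2\<close>.\<close>

lemma rho_bound:
  assumes t: "t \<in> {0..T}" "16 * A^2 * (real CARD('d) * M^2) * t \<le> 1"
  shows "L2norm (rho t) \<le> 2 * A"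
proof (rule power2_le_imp_le)
  obtain R where R: "0 < R" "\<And>t. t \<in> {0..T} \<Longrightarrow> L2norm (rho t) \<le> R" using rho_bound_qualitative by blast
  have "(L2norm (rho t))^2 \<le> 2 * (2 * A^2)"
  proof (rule quadratic_gronwall[where P = "\<lambda>t. (L2norm (rho t))^2" and Q = "R^2" and b = "real CARD('d) * M^2"])
    show "(\<lambda>t. (L2norm (rho t))^2) \<in> borel_measurable (tm T)" by (rule regular_L2norm_measurable(1)[OF rho_regular])
    show "(L2norm (rho t))^2 \<le> R^2" if "t \<in> {0..T}" for t using R that by (intro power_mono) auto
    show "8 * (2 * A^2) * (real CARD('d) * M^2) * t \<le> 1" using t(2) by simp
  qed (use t A energy_inequality in auto)
  then show "(L2norm (rho t))^2 \<le> (2 * A)^2" by (simp add: power_mult_distrib)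
qed (use A in simp)

text \<open>The growth is linear in \<open>N\<close> and not quadratic: the divergence in front of
  the drift costs one power, while the Laplacian of the initial mode is bounded by
  \<open>phi_decay\<close>.\<close>

lemma mode_increment:
  assumes t: "t \<in> {0..T}" "16 * A^2 * (real CARD('d) * M^2) * t \<le> 1" and k: "norm (kvec k) \<le> N" "1 \<le> N"
  shows "cmod (z k t - fc phi k) \<le> t * N * (4 * pi^2 * A + 8 * pi * real CARD('d) * M * A^2)"
proof -
  obtain Bz BG where "integral_curve (z k) (G k) (fc phi k) T Bz BG" using mode_integral_curve by blast
  then interpret integral_curve "z k" "G k" "fc phi k" T Bz BG .
  define B where "B = N * (8 * pi * real CARD('d) * M * A^2)"
  have "cmod (z k t - fc phi k) \<le> t * (lam k * cmod (fc phi k) + B)"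
  proof (rule duhamel_increment_bound[OF lam_nonneg t(1)])
    fix s assume s: "s \<in> {0..t}"
    then have s': "s \<in> {0..T}" using t by simp
    have "16 * A^2 * (real CARD('d) * M^2) * s \<le> 16 * A^2 * (real CARD('d) * M^2) * t"
      using s by (intro mult_left_mono) auto
    then have r: "L2norm (rho s) \<le> 2 * A" using t(2) by (intro rho_bound[OF s']) linarith
    have "cmod (f k s) \<le> 2 * pi * norm (kvec k) * (real CARD('d) * (M * L2norm (rho s) * L2norm (rho s)))"
      by (intro divc_drift_le regularD[OF rho_regular s'])
    also have "\<dots> \<le> 2 * pi * N * (real CARD('d) * (M * (2 * A) * (2 * A)))"
      using k r M0 A by (intro mult_mono mult_left_mono) (auto intro!: mult_nonneg_nonneg)
    also have "\<dots> = B" by (simp add: B_def power2_eq_square)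
    finally show "cmod (G k s + lam k * z k s) \<le> B" unfolding G_eq .
  qed
  also have "\<dots> \<le> t * (N * (4 * pi^2 * A) + B)"
  proof (intro mult_left_mono add_right_mono)
    have "lam k * cmod (fc phi k) = 4 * pi^2 * ((norm (kvec k))^2 * cmod (fc phi k))" by (simp add: lam_def)
    also have "\<dots> \<le> 4 * pi^2 * A" by (intro mult_left_mono phi_decay) simp
    also have "\<dots> \<le> N * (4 * pi^2 * A)" using mult_right_mono[OF k(2), of "4 * pi^2 * A"] A by simp
    finally show "lam k * cmod (fc phi k) \<le> N * (4 * pi^2 * A)" .
  qed (use t in simp)
  finally show ?thesis by (simp add: B_def algebra_simps)
qed

end

section \<open>Trigonometric polynomials\<close>

definition modes :: "real \<Rightarrow> (int^'d) set" where
  "modes K = {k. k \<noteq> 0 \<and> norm (kvec k) \<le> K}"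

lemma modes_subset_fbox:
  assumes "1 \<le> K" shows "modes K \<subseteq> fbox (nat \<lfloor>K\<rfloor>)"
proof
  fix k :: "int^'d" assume k: "k \<in> modes K"
  have "\<bar>k $ j\<bar> \<le> \<lfloor>K\<rfloor>" for j
  proof -
    have "real_of_int \<bar>k $ j\<bar> \<le> K" using component_le_norm_kvec[of k j] k by (simp add: modes_def)
    then show ?thesis by (simp add: le_floor_iff)
  qed
  then show "k \<in> fbox (nat \<lfloor>K\<rfloor>)" using assms by (simp add: fbox_def)
qed

lemma finite_modes: "1 \<le> K \<Longrightarrow> finite (modes K)"
  using finite_subset[OF modes_subset_fbox finite_fbox] .

lemma card_modes:
  assumes "1 \<le> K" shows "real (card (modes K :: (int^'d) set)) \<le> 3 ^ CARD('d) * K powr real CARD('d)"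
proof -
  have "real (card (modes K :: (int^'d) set)) \<le> real (card (fbox (nat \<lfloor>K\<rfloor>) :: (int^'d) set))"
    using card_mono[OF finite_fbox modes_subset_fbox[OF assms]] by simp
  also have "\<dots> = (2 * real (nat \<lfloor>K\<rfloor>) + 1) ^ CARD('d)" by (rule card_fbox)
  also have "\<dots> \<le> (3 * K) ^ CARD('d)"
  proof (rule power_mono)
    have "real (nat \<lfloor>K\<rfloor>) \<le> K" using assms by simp
    then show "2 * real (nat \<lfloor>K\<rfloor>) + 1 \<le> 3 * K" using assms by linarith
  qed simp
  also have "\<dots> = 3 ^ CARD('d) * K powr real CARD('d)"
    using assms by (simp add: power_mult_distrib powr_realpow)
  finally show ?thesis .
qed

lemma norm_kvec_ge_1:
  assumes "k \<noteq> 0" shows "1 \<le> norm (kvec k)"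
proof -
  obtain j where "k $ j \<noteq> 0" using assms by (auto simp: vec_eq_iff)
  then have "1 \<le> \<bar>real_of_int (k $ j)\<bar>" by linarith
  also have "\<dots> \<le> norm (kvec k)" by (rule component_le_norm_kvec)
  finally show ?thesis .
qed

text \<open>The coefficients are left existential. Different sign patterns in the expansion of a
  product of sines and cosines can produce the same frequency, and only the set of frequencies
  matters.\<close>

definition spectrum_in :: "(int^'d) set \<Rightarrow> (real^'d \<Rightarrow> complex) \<Rightarrow> bool" where
  "spectrum_in P f \<longleftrightarrow> (\<exists>h. \<forall>x. f x = (\<Sum>k\<in>P. h k * chr k x))"

lemma spectrum_in_sum:
  assumes "\<And>i. i \<in> I \<Longrightarrow> spectrum_in P (f i)"
  shows "spectrum_in P (\<lambda>x. \<Sum>i\<in>I. c i * f i x)"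
proof -
  obtain h where h: "\<And>i x. i \<in> I \<Longrightarrow> f i x = (\<Sum>k\<in>P. h i k * chr k x)"
    using assms unfolding spectrum_in_def by metis
  have "(\<Sum>i\<in>I. c i * f i x) = (\<Sum>k\<in>P. (\<Sum>i\<in>I. c i * h i k) * chr k x)" for x
  proof -
    have "(\<Sum>i\<in>I. c i * f i x) = (\<Sum>i\<in>I. \<Sum>k\<in>P. c i * h i k * chr k x)"
      by (intro sum.cong) (auto simp: h sum_distrib_left mult.assoc)
    also have "\<dots> = (\<Sum>k\<in>P. \<Sum>i\<in>I. c i * h i k * chr k x)" by (rule sum.swap)
    finally show ?thesis by (simp add: sum_distrib_right)
  qed
  then show ?thesis unfolding spectrum_in_def by (intro exI[of _ "\<lambda>k. \<Sum>i\<in>I. c i * h i k"] allI)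
qed

lemma spectrum_in_chr:
  assumes "finite P" "k \<in> P" shows "spectrum_in P (chr k)"
proof -
  have "chr k x = (\<Sum>l\<in>P. (if l = k then 1 else 0) * chr l x)" for x
  proof -
    have "(\<Sum>l\<in>P. (if l = k then 1 else 0) * chr l x) = (\<Sum>l\<in>P. if l = k then chr l x else 0)"
      by (intro sum.cong) auto
    then show ?thesis using assms by simp
  qed
  then show ?thesis unfolding spectrum_in_def by (intro exI[of _ "\<lambda>l. if l = k then 1 else 0"]) blast
qed

text \<open>Coefficients from Euler's formula. At \<open>m = 0\<close> the constant 1 is split into
  two halves, so that each coordinate contributes exactly two terms and the product over coordinates
  expands over sign vectors.\<close>

definition trig_coeff :: "int \<Rightarrow> int \<Rightarrow> complex" where
  "trig_coeff m b = (if m > 0 then sqrt 2 / 2 else if m = 0 then 1 / 2 else of_int b * sqrt 2 / (2 * \<i>))"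

lemma trig_eq: "complex_of_real (trig m y) = (\<Sum>b\<in>{1, -1}. trig_coeff m b * cis (2 * pi * real_of_int (b * m) * y))"
  by (auto simp: trig_def trig_coeff_def complex_eq_iff)

lemma chr_eq_prod: "chr k x = (\<Prod>j\<in>UNIV. cis (2 * pi * real_of_int (k $ j) * x $ j))"
proof -
  have "chr k x = exp (\<Sum>j\<in>UNIV. \<i> * of_real (2 * pi * real_of_int (k $ j) * x $ j))"
    by (simp add: chr_def inner_vec_def kvec_def sum_distrib_left mult_ac)
  then show ?thesis by (simp add: exp_sum cis_conv_exp)
qed

text \<open>Flipping signs of components of \<open>k\<close> preserves its norm, so all frequencies
  of the expansion stay in \<open>modes K\<close>.\<close>

lemma spectrum_in_tau:
  assumes "1 \<le> K" "k \<in> modes K"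
  shows "spectrum_in (modes K) (\<lambda>x. of_real (tau k x))"
proof -
  define S where "S = PiE (UNIV :: 'a set) (\<lambda>_. {1, -1 :: int})"
  define sg where "sg \<sigma> = (\<chi> j. \<sigma> j * k $ j)" for \<sigma> :: "'a \<Rightarrow> int"
  have "complex_of_real (tau k x) = (\<Sum>\<sigma>\<in>S. (\<Prod>j\<in>UNIV. trig_coeff (k $ j) (\<sigma> j)) * chr (sg \<sigma>) x)" for x
  proof -
    have "complex_of_real (tau k x) = (\<Prod>j\<in>UNIV. \<Sum>b\<in>{1, -1}. trig_coeff (k $ j) b * cis (2 * pi * real_of_int (b * k $ j) * x $ j))"
      unfolding tau_def of_real_prod trig_eq ..
    also have "\<dots> = (\<Sum>\<sigma>\<in>S. \<Prod>j\<in>UNIV. trig_coeff (k $ j) (\<sigma> j) * cis (2 * pi * real_of_int (\<sigma> j * k $ j) * x $ j))"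
      unfolding S_def by (rule prod_sum_PiE) auto
    also have "\<dots> = (\<Sum>\<sigma>\<in>S. (\<Prod>j\<in>UNIV. trig_coeff (k $ j) (\<sigma> j)) * chr (sg \<sigma>) x)"
      unfolding chr_eq_prod sg_def by (simp add: prod.distrib)
    finally show ?thesis .
  qed
  moreover have "spectrum_in (modes K) (\<lambda>x. \<Sum>\<sigma>\<in>S. (\<Prod>j\<in>UNIV. trig_coeff (k $ j) (\<sigma> j)) * chr (sg \<sigma>) x)"
  proof (intro spectrum_in_sum spectrum_in_chr finite_modes assms(1))
    fix \<sigma> assume \<sigma>: "\<sigma> \<in> S"
    have s: "\<sigma> j = 1 \<or> \<sigma> j = -1" for j using \<sigma> by (auto simp: S_def PiE_iff)
    have "(real_of_int (\<sigma> j * k $ j))^2 = (real_of_int (k $ j))^2" for j using s[of j] by auto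
    then have "(norm (kvec (sg \<sigma>)))^2 = (norm (kvec k))^2" unfolding norm_kvec_power2 sg_def by simp
    then have n: "norm (kvec (sg \<sigma>)) = norm (kvec k)" by simp
    have "sg \<sigma> \<noteq> 0" using n assms(2) by (auto simp: modes_def kvec_eq_0_iff)
    then show "sg \<sigma> \<in> modes K" using n assms(2) by (simp add: modes_def)
  qed
  ultimately show ?thesis by simp
qed

lemma EK_spectrum:
  assumes "1 \<le> K" "H \<in> EK K"
  obtains h where "\<And>x. of_real (H x) = (\<Sum>k\<in>modes K. h k * chr k x)"
proof -
  obtain c where c: "H = (\<lambda>x. \<Sum>k\<in>modes K. c k * tau k x)" using assms(2) unfolding EK_def modes_def by blast
  have "spectrum_in (modes K) (\<lambda>x. \<Sum>k\<in>modes K. of_real (c k) * of_real (tau k x))"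
    by (intro spectrum_in_sum spectrum_in_tau assms)
  then have "spectrum_in (modes K) (\<lambda>x. of_real (H x))" unfolding c by simp
  then show ?thesis using that unfolding spectrum_in_def by blast
qed

section \<open>Derivatives and convolutions of trigonometric polynomials\<close>

lemma pd_spectrum:
  assumes P: "finite P" and H: "\<And>x. of_real (H x) = (\<Sum>k\<in>P. h k * chr k x)"
  shows "complex_of_real (pd H j x) = (\<Sum>k\<in>P. (2 * pi * \<i> * of_int (k $ j) * h k) * chr k x)"
proof -
  define D where "D = (\<Sum>k\<in>P. (2 * pi * \<i> * of_int (k $ j) * h k) * chr k x)"
  have e: "chr k (x + t *\<^sub>R axis j 1) = chr k x * exp (2 * pi * \<i> * of_int (k $ j) * of_real t)" for k t
    by (simp add: chr_def inner_add_right inner_axis kvec_def exp_add [symmetric] algebra_simps)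
  have "((\<lambda>t. \<Sum>k\<in>P. h k * chr k (x + t *\<^sub>R axis j 1)) has_vector_derivative D) (at 0)"
    unfolding D_def e
  proof (rule has_vector_derivative_sum)
    fix k
    have "((\<lambda>z. h k * (chr k x * exp (2 * pi * \<i> * of_int (k $ j) * z))) has_field_derivative (2 * pi * \<i> * of_int (k $ j) * h k) * chr k x) (at (of_real 0))"
      by (auto intro!: derivative_eq_intros)
    then show "((\<lambda>t. h k * (chr k x * exp (2 * pi * \<i> * of_int (k $ j) * of_real t))) has_vector_derivative (2 * pi * \<i> * of_int (k $ j) * h k) * chr k x) (at 0)"
      by (rule has_vector_derivative_real_field)
  qed
  then have d: "((\<lambda>t. of_real (H (x + t *\<^sub>R axis j 1))) has_vector_derivative D) (at 0)"
    unfolding H .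
  have "((\<lambda>t. Re (of_real (H (x + t *\<^sub>R axis j 1)))) has_vector_derivative Re D) (at 0)"
    by (rule bounded_linear.has_vector_derivative[OF bounded_linear_Re d])
  then have re: "pd H j x = Re D"
    unfolding pd_def by (intro DERIV_imp_deriv) (simp add: has_real_derivative_iff_has_vector_derivative)
  \<comment> \<open>\<open>H\<close> is real, so the imaginary part is constantly 0 and so is its
    derivative; the real derivative \<open>pd\<close> is thus the full complex sum.\<close>
  have "((\<lambda>t. Im (of_real (H (x + t *\<^sub>R axis j 1)))) has_vector_derivative Im D) (at 0)"
    by (rule bounded_linear.has_vector_derivative[OF bounded_linear_Im d])
  then have "((\<lambda>t::real. 0::real) has_vector_derivative Im D) (at 0)" by simp
  then have "Im D = 0" using vector_derivative_unique_at[OF _ has_vector_derivative_const] by blast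
  then show ?thesis unfolding D_def[symmetric] re by (simp add: complex_eq_iff)
qed

lemma conv_pd_spectrum:
  assumes P: "finite P" and H: "\<And>x. of_real (H x) = (\<Sum>k\<in>P. h k * chr k x)" and b: "L2cube b"
  shows "complex_of_real (conv (pd H j) b x) = (\<Sum>k\<in>P. (2 * pi * \<i> * of_int (k $ j) * h k * fc b k) * chr k x)"
proof -
  have "complex_of_real (conv (pd H j) b x) = (\<integral>y. complex_of_real (pd H j (x - y)) * complex_of_real (b y) \<partial>torus)"
    unfolding conv_eq integral_complex_of_real[symmetric] by simp
  also have "\<dots> = (\<integral>y. (\<Sum>k\<in>P. (2 * pi * \<i> * of_int (k $ j) * h k * chr k x) * (of_real (b y) * cnj (chr k y))) \<partial>torus)"
    unfolding pd_spectrum[OF P H] chr_arg_diff sum_distrib_right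
    by (intro Bochner_Integration.integral_cong sum.cong refl) (simp add: mult_ac)
  also have "\<dots> = (\<Sum>k\<in>P. (2 * pi * \<i> * of_int (k $ j) * h k * chr k x) * fc b k)"
    unfolding fc_eq using integrable_fc[OF L2cube_integrable[OF b]]
    by (subst Bochner_Integration.integral_sum) auto
  finally show ?thesis by (simp add: mult_ac)
qed

text \<open>Convolution multiplies coefficients and multiplication by \<open>a\<close> convolves
  them, so the source is a finite sum over the frequencies of \<open>H\<close>, although
  \<open>a\<close> and \<open>b\<close> may have infinitely many.\<close>

lemma fc_drift_pd:
  assumes P: "finite P" and H: "\<And>x. of_real (H x) = (\<Sum>k\<in>P. h k * chr k x)" and a: "L2cube a" and b: "L2cube b"
  shows "fc (drift a (pd H) b j) k = (\<Sum>l\<in>P. (2 * pi * \<i> * of_int (l $ j) * h l * fc b l) * fc a (k - l))"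
proof -
  have "fc (drift a (pd H) b j) k = (\<integral>x. (\<Sum>l\<in>P. (2 * pi * \<i> * of_int (l $ j) * h l * fc b l) * (of_real (a x) * cnj (chr (k - l) x))) \<partial>torus)"
    unfolding drift_def fc_eq[of "\<lambda>x. a x * conv (pd H j) b x"] of_real_mult conv_pd_spectrum[OF P H b] sum_distrib_left sum_distrib_right
    by (intro Bochner_Integration.integral_cong sum.cong refl) (simp add: chr_diff mult_ac)
  also have "\<dots> = (\<Sum>l\<in>P. (2 * pi * \<i> * of_int (l $ j) * h l * fc b l) * fc a (k - l))"
    unfolding fc_eq[of a] using integrable_fc[OF L2cube_integrable[OF a]]
    by (subst Bochner_Integration.integral_sum) auto
  finally show ?thesis .
qed

lemma L2norm_spectrum:
  assumes P: "finite P" and H: "\<And>x. of_real (H x) = (\<Sum>k\<in>P. h k * chr k x)"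
  shows "(L2norm H)^2 = (\<Sum>k\<in>P. (cmod (h k))^2)"
proof -
  have "(H x)^2 = (cmod (\<Sum>k\<in>P. h k * chr k x))^2" for x
    unfolding H[symmetric] by simp
  then show ?thesis unfolding L2norm_power2 using parseval_finite[OF P] by simp
qed

section \<open>Quadratic forms in Fourier coefficients\<close>

lemma complex_Cauchy_Schwarz_sum:
  fixes x y :: "'i \<Rightarrow> complex"
  shows "cmod (\<Sum>i\<in>I. x i * y i) \<le> sqrt (\<Sum>i\<in>I. (cmod (x i))^2) * sqrt (\<Sum>i\<in>I. (cmod (y i))^2)"
proof -
  have "cmod (\<Sum>i\<in>I. x i * y i) \<le> (\<Sum>i\<in>I. cmod (x i) * cmod (y i))"
    by (rule order_trans[OF norm_sum]) (simp add: norm_mult)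
  also have "\<dots> \<le> sqrt ((\<Sum>i\<in>I. (cmod (x i))^2) * (\<Sum>i\<in>I. (cmod (y i))^2))"
    by (rule real_le_rsqrt[OF Cauchy_Schwarz_ineq_sum])
  finally show ?thesis by (simp add: real_sqrt_mult)
qed

lemma sum_cmod_le_sqrt_card:
  fixes a :: "'i \<Rightarrow> complex"
  shows "(\<Sum>i\<in>I. cmod (a i)) \<le> sqrt (real (card I)) * sqrt (\<Sum>i\<in>I. (cmod (a i))^2)"
proof -
  have "(\<Sum>i\<in>I. 1 * cmod (a i)) \<le> sqrt ((\<Sum>i\<in>I. 1^2) * (\<Sum>i\<in>I. (cmod (a i))^2))"
    by (rule real_le_rsqrt[OF Cauchy_Schwarz_ineq_sum])
  then show ?thesis by (simp add: real_sqrt_mult)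
qed

text \<open>The Toeplitz form with symbol \<open>phi\<close> is the integral of
  \<open>phi |p|^2\<close>, with \<open>p\<close> the trigonometric polynomial of coefficients
  \<open>a\<close>; Parseval then converts the pointwise lower bound on \<open>phi\<close>.\<close>

lemma fc_form_lower:
  fixes phi :: "real^'d \<Rightarrow> real"
  assumes P: "finite P" and phi: "L2cube phi" "\<And>x. m \<le> phi x" and m: "0 \<le> m"
  shows "m * (\<Sum>k\<in>P. (cmod (a k))^2) \<le> Re (\<Sum>k\<in>P. \<Sum>l\<in>P. cnj (a k) * a l * fc phi (k - l))"
proof -
  define p where "p x = (\<Sum>k\<in>P. a k * chr k x)" for x
  have [measurable]: "phi \<in> borel_measurable borel" using phi by (simp add: L2cube_iff)
  have [measurable]: "p \<in> borel_measurable borel" unfolding p_def by measurable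
  have p2b: "(cmod (p x))^2 \<le> (\<Sum>k\<in>P. cmod (a k))^2" for x
    unfolding p_def by (intro power_mono trig_sum_le) simp
  have ip: "integrable torus (\<lambda>x. (cmod (p x))^2)" unfolding p_def by (rule integrable_trig_sum_power2)
  have ipp: "integrable torus (\<lambda>x. phi x * (cmod (p x))^2)"
  proof (rule Bochner_Integration.integrable_bound[of torus "\<lambda>x. phi x * (\<Sum>k\<in>P. cmod (a k))^2"])
    show "integrable torus (\<lambda>x. phi x * (\<Sum>k\<in>P. cmod (a k))^2)" using L2cube_integrable[OF phi(1)] by simp
    show "AE x in torus. norm (phi x * (cmod (p x))^2) \<le> norm (phi x * (\<Sum>k\<in>P. cmod (a k))^2)"
      using p2b by (auto simp: abs_mult intro!: AE_I2 mult_left_mono)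
  qed measurable
  have "complex_of_real (\<integral>x. phi x * (cmod (p x))^2 \<partial>torus)
      = (\<integral>x. (\<Sum>k\<in>P. \<Sum>l\<in>P. (cnj (a k) * a l) * (of_real (phi x) * cnj (chr (k - l) x))) \<partial>torus)"
  proof -
    have "complex_of_real (\<integral>x. phi x * (cmod (p x))^2 \<partial>torus) = (\<integral>x. complex_of_real (phi x * (cmod (p x))^2) \<partial>torus)"
      by (rule integral_complex_of_real[symmetric])
    also have "\<dots> = (\<integral>x. (\<Sum>k\<in>P. \<Sum>l\<in>P. (cnj (a k) * a l) * (of_real (phi x) * cnj (chr (k - l) x))) \<partial>torus)"
    proof (rule Bochner_Integration.integral_cong[OF refl])
      fix x
      have "complex_of_real (phi x * (cmod (p x))^2) = complex_of_real (phi x) * (cnj (p x) * p x)"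
        unfolding of_real_mult complex_norm_square by (simp add: mult.commute)
      also have "\<dots> = (\<Sum>k\<in>P. \<Sum>l\<in>P. (cnj (a k) * a l) * (of_real (phi x) * cnj (chr (k - l) x)))"
        unfolding p_def cnj_sum unfolding sum_product unfolding sum_distrib_left
        by (intro sum.cong refl) (simp add: chr_diff mult_ac)
      finally show "complex_of_real (phi x * (cmod (p x))^2) = (\<Sum>k\<in>P. \<Sum>l\<in>P. (cnj (a k) * a l) * (complex_of_real (phi x) * cnj (chr (k - l) x)))" .
    qed
    finally show ?thesis .
  qed
  also have "\<dots> = (\<Sum>k\<in>P. \<Sum>l\<in>P. cnj (a k) * a l * fc phi (k - l))"
    unfolding fc_eq using integrable_fc[OF L2cube_integrable[OF phi(1)]] by simp
  finally have e: "Re (\<Sum>k\<in>P. \<Sum>l\<in>P. cnj (a k) * a l * fc phi (k - l)) = (\<integral>x. phi x * (cmod (p x))^2 \<partial>torus)"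
    by (metis Re_complex_of_real)
  have "m * (\<Sum>k\<in>P. (cmod (a k))^2) = (\<integral>x. m * (cmod (p x))^2 \<partial>torus)"
    using parseval_finite[OF P, of a] by (simp add: p_def)
  also have "\<dots> \<le> (\<integral>x. phi x * (cmod (p x))^2 \<partial>torus)"
    by (rule integral_mono) (use ip ipp phi(2) in \<open>auto intro!: mult_right_mono\<close>)
  finally show ?thesis unfolding e .
qed

text \<open>With only a uniform bound on the entries, the full number of modes is lost. This is
  affordable for the perturbation of the outer factor, which involves no division by coefficients of
  \<open>phi\<close>.\<close>

lemma form_bound_sup:
  fixes a :: "int^'d \<Rightarrow> complex"
  assumes "\<And>k l. k \<in> P \<Longrightarrow> l \<in> P \<Longrightarrow> cmod (w (k - l)) \<le> \<epsilon>" and "0 \<le> \<epsilon>"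
  shows "cmod (\<Sum>k\<in>P. \<Sum>l\<in>P. cnj (a k) * a l * w (k - l)) \<le> \<epsilon> * real (card P) * (\<Sum>k\<in>P. (cmod (a k))^2)"
proof -
  have "cmod (\<Sum>k\<in>P. \<Sum>l\<in>P. cnj (a k) * a l * w (k - l)) \<le> (\<Sum>k\<in>P. \<Sum>l\<in>P. cmod (a k) * cmod (a l) * \<epsilon>)"
    by (intro order_trans[OF norm_sum] sum_mono) (auto simp: norm_mult intro!: mult_left_mono assms)
  also have "\<dots> = (\<Sum>k\<in>P. cmod (a k))^2 * \<epsilon>"
    unfolding power2_eq_square unfolding sum_product unfolding sum_distrib_right ..
  also have "\<dots> \<le> (sqrt (real (card P)) * sqrt (\<Sum>k\<in>P. (cmod (a k))^2))^2 * \<epsilon>"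
    by (intro mult_right_mono power_mono sum_cmod_le_sqrt_card assms sum_nonneg) auto
  also have "\<dots> = \<epsilon> * real (card P) * (\<Sum>k\<in>P. (cmod (a k))^2)"
    by (simp add: power_mult_distrib sum_nonneg)
  finally show ?thesis .
qed

text \<open>Bessel's inequality in \<open>l\<close> reduces the loss to the square root of the
  number of modes. The saving matters because \<open>q\<close> will contain the factor K^zeta:
  \<open>1 + zeta + d / 2\<close> is guaranteed to be at most \<open>4 * zeta / 3\<close>, but
  \<open>1 + zeta + d\<close> is not.\<close>

lemma form_bound_L2:
  fixes a e :: "int^'d \<Rightarrow> complex"
  assumes P: "finite P" and r: "L2cube r" and e: "\<And>l. l \<in> P \<Longrightarrow> cmod (e l) \<le> q * cmod (a l)" and q: "0 \<le> q"
  shows "cmod (\<Sum>k\<in>P. \<Sum>l\<in>P. cnj (a k) * e l * fc r (k - l)) \<le> q * L2norm r * sqrt (real (card P)) * (\<Sum>k\<in>P. (cmod (a k))^2)"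
proof -
  define N where "N = sqrt (\<Sum>k\<in>P. (cmod (a k))^2)"
  have N0: "0 \<le> N" by (simp add: N_def sum_nonneg)
  have eN: "sqrt (\<Sum>l\<in>P. (cmod (e l))^2) \<le> q * N"
  proof -
    have "(\<Sum>l\<in>P. (cmod (e l))^2) \<le> (\<Sum>l\<in>P. (q * cmod (a l))^2)" by (intro sum_mono power_mono e) auto
    also have "\<dots> = q^2 * (\<Sum>l\<in>P. (cmod (a l))^2)" by (simp add: power_mult_distrib sum_distrib_left)
    finally have "sqrt (\<Sum>l\<in>P. (cmod (e l))^2) \<le> sqrt (q^2 * (\<Sum>l\<in>P. (cmod (a l))^2))" by simp
    then show ?thesis using q by (simp add: real_sqrt_mult N_def)
  qed
  have inner: "cmod (\<Sum>l\<in>P. e l * fc r (k - l)) \<le> q * N * L2norm r" for k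
  proof -
    have "(\<Sum>l\<in>P. (cmod (fc r (k - l)))^2) = (\<Sum>m\<in>(\<lambda>l. k - l) ` P. (cmod (fc r m))^2)"
      by (subst sum.reindex) (auto intro!: inj_onI)
    also have "\<dots> \<le> (L2norm r)^2" by (rule bessel) (use P r in auto)
    finally have "sqrt (\<Sum>l\<in>P. (cmod (fc r (k - l)))^2) \<le> L2norm r" by (rule real_le_lsqrt[OF L2norm_nonneg])
    then have "sqrt (\<Sum>l\<in>P. (cmod (e l))^2) * sqrt (\<Sum>l\<in>P. (cmod (fc r (k - l)))^2) \<le> q * N * L2norm r"
      using eN by (intro mult_mono) (auto simp: sum_nonneg q N0)
    then show ?thesis using complex_Cauchy_Schwarz_sum[of e "\<lambda>l. fc r (k - l)" P] by linarith
  qed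
  have "cmod (\<Sum>k\<in>P. \<Sum>l\<in>P. cnj (a k) * e l * fc r (k - l)) = cmod (\<Sum>k\<in>P. cnj (a k) * (\<Sum>l\<in>P. e l * fc r (k - l)))"
    by (simp add: sum_distrib_left mult.assoc)
  also have "\<dots> \<le> (\<Sum>k\<in>P. cmod (a k) * (q * N * L2norm r))"
    by (intro order_trans[OF norm_sum] sum_mono) (auto simp: norm_mult intro!: mult_left_mono inner)
  also have "\<dots> = (\<Sum>k\<in>P. cmod (a k)) * (q * N * L2norm r)" by (simp add: sum_distrib_right)
  also have "\<dots> \<le> (sqrt (real (card P)) * N) * (q * N * L2norm r)"
    unfolding N_def[symmetric] using sum_cmod_le_sqrt_card[of a P] q N0
    by (intro mult_right_mono) (auto simp: N_def[symmetric])
  also have "\<dots> = q * L2norm r * sqrt (real (card P)) * (N * N)" by simp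
  also have "N * N = (\<Sum>k\<in>P. (cmod (a k))^2)" by (simp add: N_def sum_nonneg)
  finally show ?thesis .
qed

section \<open>The linearised equation\<close>

definition grad :: "(int^'d \<Rightarrow> complex) \<Rightarrow> 'd \<Rightarrow> int^'d \<Rightarrow> complex" where
  "grad u j k = 2 * pi * \<i> * of_int (k $ j) * u k"

text \<open>By Parseval, the L^2 norm of the gradient of the trigonometric polynomial with
  coefficients \<open>u\<close> on \<open>P\<close>.\<close>

definition gradnorm :: "(int^'d) set \<Rightarrow> (int^'d \<Rightarrow> complex) \<Rightarrow> real" where
  "gradnorm P u = sqrt (\<Sum>k\<in>P. lam k * (cmod (u k))^2)"

lemma gradnorm_nonneg [simp]: "0 \<le> gradnorm P u"
  by (simp add: gradnorm_def sum_nonneg lam_nonneg)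

lemma sum_grad: "(\<Sum>j\<in>UNIV. (cmod (grad u j k))^2) = lam k * (cmod (u k))^2"
  unfolding lam_def norm_kvec_power2 grad_def
  by (simp add: norm_mult power_mult_distrib sum_distrib_left sum_distrib_right mult_ac)

lemma gradnorm_power2: "(gradnorm P u)^2 = (\<Sum>k\<in>P. lam k * (cmod (u k))^2)"
  by (simp add: gradnorm_def sum_nonneg lam_nonneg)

lemma gradnorm_power2_grad: "(gradnorm P u)^2 = (\<Sum>j\<in>UNIV. \<Sum>k\<in>P. (cmod (grad u j k))^2)"
  unfolding gradnorm_power2 sum_grad[symmetric] by (rule sum.swap)

text \<open>Integration by parts; the sign comes from conjugating the factor
  \<open>\<i>\<close>.\<close>

lemma sum_cnj_divc:
  "(\<Sum>k\<in>P. cnj (u k) * divc F k) = - (\<Sum>j\<in>UNIV. \<Sum>k\<in>P. cnj (grad u j k) * fc (F j) k)"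
proof -
  have "(\<Sum>k\<in>P. cnj (u k) * divc F k) = (\<Sum>k\<in>P. \<Sum>j\<in>UNIV. - (cnj (grad u j k) * fc (F j) k))"
    unfolding divc_def sum_distrib_left grad_def by (intro sum.cong refl) (simp add: mult_ac)
  also have "\<dots> = (\<Sum>j\<in>UNIV. \<Sum>k\<in>P. - (cnj (grad u j k) * fc (F j) k))" by (rule sum.swap)
  finally show ?thesis by (simp add: sum_negf)
qed

text \<open>Poincare's inequality: frequency zero is absent from \<open>modes K\<close>, and every
  other \<open>lam k\<close> is at least 1.\<close>

lemma sum_modes_le:
  fixes u :: "int^'d \<Rightarrow> complex"
  assumes "1 \<le> K"
  shows "sqrt (\<Sum>k\<in>modes K. (cmod (u k))^2) \<le> gradnorm (modes K) u"
  unfolding gradnorm_def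
proof (intro real_sqrt_le_mono sum_mono)
  fix k :: "int^'d" assume "k \<in> modes K"
  then have "1 \<le> norm (kvec k)" by (intro norm_kvec_ge_1) (simp add: modes_def)
  moreover have "1 \<le> 4 * pi^2" using pi_ge_two power_mono[OF pi_ge_two, of 2] by simp
  ultimately have "1 * 1 \<le> (4 * pi^2) * (norm (kvec k))^2" by (intro mult_mono) (auto simp: one_le_power)
  then show "(cmod (u k))^2 \<le> lam k * (cmod (u k))^2" by (simp add: lam_def mult_le_cancel_right1)
qed

text \<open>One of the two derivatives stays on \<open>u\<close> as \<open>gradnorm\<close>, the
  other is bounded by the largest frequency. Among the terms containing \<open>v\<close>, this is
  the one that costs a factor \<open>K\<close>.\<close>

lemma sum_lapc_le:
  fixes w :: "real^'d \<Rightarrow> real"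
  assumes K: "1 \<le> K" and w: "L2cube w"
  shows "cmod (\<Sum>k\<in>modes K. cnj (u k) * lapc w k) \<le> 2 * pi * K * gradnorm (modes K) u * L2norm w"
proof -
  have "(\<Sum>k\<in>modes K. cnj (u k) * lapc w k) = (\<Sum>k\<in>modes K. - (cnj (u k) * of_real (lam k)) * fc w k)"
    by (simp add: lapc_eq mult.assoc)
  also have "cmod \<dots> \<le> sqrt (\<Sum>k\<in>modes K. (cmod (- (cnj (u k) * of_real (lam k))))^2) * sqrt (\<Sum>k\<in>modes K. (cmod (fc w k))^2)"
    by (rule complex_Cauchy_Schwarz_sum)
  also have "\<dots> \<le> (2 * pi * K * gradnorm (modes K) u) * L2norm w"
  proof (rule mult_mono)
    have "(\<Sum>k\<in>modes K. (cmod (- (cnj (u k) * of_real (lam k))))^2) \<le> (\<Sum>k\<in>modes K. (2 * pi * K)^2 * (lam k * (cmod (u k))^2))"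
    proof (rule sum_mono)
      fix k :: "int^'d" assume k: "k \<in> modes K"
      have "(norm (kvec k))^2 \<le> K^2" using k by (intro power_mono) (auto simp: modes_def)
      then have "lam k \<le> (2 * pi * K)^2" by (simp add: lam_def power_mult_distrib)
      then have "lam k * (lam k * (cmod (u k))^2) \<le> (2 * pi * K)^2 * (lam k * (cmod (u k))^2)"
        by (rule mult_right_mono) (simp add: lam_nonneg)
      then show "(cmod (- (cnj (u k) * of_real (lam k))))^2 \<le> (2 * pi * K)^2 * (lam k * (cmod (u k))^2)"
        by (simp add: norm_mult power_mult_distrib power2_eq_square[of "lam k"] mult_ac)
    qed
    also have "\<dots> = (2 * pi * K * gradnorm (modes K) u)^2"
      unfolding power_mult_distrib[of _ "gradnorm (modes K) u"] gradnorm_power2 sum_distrib_left ..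
    finally show "sqrt (\<Sum>k\<in>modes K. (cmod (- (cnj (u k) * of_real (lam k))))^2) \<le> 2 * pi * K * gradnorm (modes K) u"
      using K by (intro real_le_lsqrt) auto
    show "sqrt (\<Sum>k\<in>modes K. (cmod (fc w k))^2) \<le> L2norm w"
      by (rule real_le_lsqrt[OF L2norm_nonneg bessel[OF finite_modes[OF K] w]])
  qed (use K in \<open>auto simp: sum_nonneg\<close>)
  finally show ?thesis .
qed

text \<open>The derivative is moved to \<open>u\<close>; Cauchy-Schwarz over pairs of component and
  mode, followed by Bessel, gives a bound free of the number and size of the modes.\<close>

lemma (in drift_field) sum_divc_drift_le:
  assumes P: "finite P" and ab: "L2cube a" "L2cube b"
  shows "cmod (\<Sum>k\<in>P. cnj (u k) * divc (drift a g b) k) \<le> gradnorm P u * (sqrt (real CARD('d)) * M * L2norm a * L2norm b)"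
proof -
  define I where "I = (UNIV :: 'd set) \<times> P"
  have "cmod (\<Sum>k\<in>P. cnj (u k) * divc (drift a g b) k) = cmod (\<Sum>(j, k)\<in>I. cnj (grad u j k) * fc (drift a g b j) k)"
    unfolding sum_cnj_divc I_def norm_minus_cancel sum.cartesian_product ..
  also have "\<dots> = cmod (\<Sum>p\<in>I. cnj (grad u (fst p) (snd p)) * fc (drift a g b (fst p)) (snd p))"
    by (simp add: case_prod_beta)
  also have "\<dots> \<le> sqrt (\<Sum>p\<in>I. (cmod (cnj (grad u (fst p) (snd p))))^2) * sqrt (\<Sum>p\<in>I. (cmod (fc (drift a g b (fst p)) (snd p)))^2)"
    by (rule complex_Cauchy_Schwarz_sum)
  also have "(\<Sum>p\<in>I. (cmod (cnj (grad u (fst p) (snd p))))^2) = (gradnorm P u)^2"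
    unfolding gradnorm_power2_grad sum.cartesian_product I_def by (simp add: case_prod_beta)
  also have "(\<Sum>p\<in>I. (cmod (fc (drift a g b (fst p)) (snd p)))^2) = (\<Sum>j\<in>UNIV. \<Sum>k\<in>P. (cmod (fc (drift a g b j) k))^2)"
    unfolding sum.cartesian_product I_def by (simp add: case_prod_beta)
  also have "sqrt ((gradnorm P u)^2) * sqrt (\<Sum>j\<in>UNIV. \<Sum>k\<in>P. (cmod (fc (drift a g b j) k))^2)
     \<le> gradnorm P u * sqrt (real CARD('d) * M^2 * (L2norm a)^2 * (L2norm b)^2)"
    using sum_fc_drift_le[OF ab P] by (simp add: mult_left_mono)
  also have "sqrt (real CARD('d) * M^2 * (L2norm a)^2 * (L2norm b)^2) = sqrt (real CARD('d)) * M * L2norm a * L2norm b"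
    using M0 by (simp add: real_sqrt_mult)
  finally show ?thesis .
qed

text \<open>With \<open>u = H * phi\<close>, the source tested against \<open>u\<close> is \<open>- \<integral> phi |grad u|^2\<close> up to two errors: one
  from replacing the outer factor \<open>r\<close> by \<open>phi\<close>, one from replacing \<open>H * r\<close> by \<open>H * phi\<close>. The second one
  costs the factor \<open>q\<close>, the inverse of the smallest Fourier coefficient of \<open>phi\<close> on the modes.\<close>

lemma source_lower_bound:
  fixes phi r H :: "real^'d \<Rightarrow> real"
  assumes K: "1 \<le> K" and H: "\<And>x. of_real (H x) = (\<Sum>k\<in>modes K. h k * chr k x)"
    and r: "L2cube r" and phi: "L2cube phi" "\<And>x. m \<le> phi x" and m: "0 \<le> m"
    and inc: "\<And>k. norm (kvec k) \<le> 2 * K \<Longrightarrow> cmod (fc r k - fc phi k) \<le> \<epsilon>" and \<epsilon>: "0 \<le> \<epsilon>"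
    and q: "\<And>k. k \<in> modes K \<Longrightarrow> 1 \<le> q * cmod (fc phi k)" and q0: "0 \<le> q"
  shows "Re (\<Sum>k\<in>modes K. cnj (h k * fc phi k) * divc (drift r (pd H) r) k)
     \<le> - ((m - \<epsilon> * (real (card (modes K :: (int^'d) set)) + q * L2norm r * sqrt (real (card (modes K :: (int^'d) set))))) * (gradnorm (modes K) (\<lambda>k. h k * fc phi k))^2)"
proof -
  define P where "P = (modes K :: (int^'d) set)"
  define u where "u k = h k * fc phi k" for k
  define a where "a = grad u"
  define e where "e j l = 2 * pi * \<i> * of_int (l $ j) * h l * (fc r l - fc phi l)" for j l
  have P: "finite P" unfolding P_def by (rule finite_modes[OF K])
  note H' = H[folded P_def]
  \<comment> \<open>The product \<open>r grad (H * r)\<close> is split into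
    \<open>phi grad (H * phi)\<close>, \<open>(r - phi) grad (H * phi)\<close> and
    \<open>r grad (H * (r - phi))\<close>.\<close>
  have F: "fc (drift r (pd H) r j) k = (\<Sum>l\<in>P. a j l * fc phi (k - l)) + (\<Sum>l\<in>P. a j l * (fc r (k - l) - fc phi (k - l))) + (\<Sum>l\<in>P. e j l * fc r (k - l))" for j k
    unfolding fc_drift_pd[OF P H' r r] sum.distrib[symmetric]
    by (intro sum.cong refl) (simp add: a_def grad_def u_def e_def algebra_simps)
  define Q1 where "Q1 j = (\<Sum>k\<in>P. \<Sum>l\<in>P. cnj (a j k) * a j l * fc phi (k - l))" for j
  define Q2 where "Q2 j = (\<Sum>k\<in>P. \<Sum>l\<in>P. cnj (a j k) * a j l * (fc r (k - l) - fc phi (k - l)))" for j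
  define Q3 where "Q3 j = (\<Sum>k\<in>P. \<Sum>l\<in>P. cnj (a j k) * e j l * fc r (k - l))" for j
  define N where "N j = (\<Sum>k\<in>P. (cmod (a j k))^2)" for j
  have N0: "0 \<le> N j" for j by (simp add: N_def sum_nonneg)
  define c where "c = real (card P)"
  have S: "(\<Sum>k\<in>P. cnj (u k) * divc (drift r (pd H) r) k) = - (\<Sum>j\<in>UNIV. Q1 j + Q2 j + Q3 j)"
    unfolding sum_cnj_divc F Q1_def Q2_def Q3_def a_def[symmetric]
    by (simp add: distrib_left sum.distrib sum_distrib_left mult.assoc)
  have b1: "m * N j \<le> Re (Q1 j)" for j
    unfolding N_def Q1_def by (rule fc_form_lower[OF P phi m])
  have b2: "cmod (Q2 j) \<le> \<epsilon> * c * N j" for j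
    unfolding N_def Q2_def c_def
  proof (rule form_bound_sup[where w = "\<lambda>k. fc r k - fc phi k"])
    fix k l assume kl: "k \<in> P" "l \<in> P"
    \<comment> \<open>Differences of two modes reach norm \<open>2 * K\<close>, hence the range in
      the assumption on increments.\<close>
    have "norm (kvec (k - l)) \<le> norm (kvec k) + norm (kvec l)" unfolding kvec_diff by (rule norm_triangle_ineq4)
    also have "\<dots> \<le> 2 * K" using kl by (simp add: P_def modes_def)
    finally show "cmod (fc r (k - l) - fc phi (k - l)) \<le> \<epsilon>" by (rule inc)
  qed (rule \<epsilon>)
  have b3: "cmod (Q3 j) \<le> (\<epsilon> * q) * L2norm r * sqrt c * N j" for j
    unfolding N_def Q3_def c_def
  proof (rule form_bound_L2[OF P r])
    fix l assume l: "l \<in> P"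
    define b where "b = cmod (2 * pi * \<i> * of_int (l $ j) * h l)"
    have b0: "0 \<le> b" by (simp add: b_def)
    have "cmod (fc r l - fc phi l) \<le> \<epsilon>" by (rule inc) (use l K in \<open>simp add: P_def modes_def\<close>)
    then have "cmod (e j l) \<le> b * \<epsilon>" unfolding e_def b_def norm_mult[of _ "fc r l - fc phi l"] by (rule mult_left_mono) simp
    \<comment> \<open>Inserting \<open>1 \<le> q * cmod (fc phi l)\<close> trades the coefficient of
      \<open>H\<close> for that of \<open>u\<close>.\<close>
    also have "\<dots> \<le> b * \<epsilon> * (q * cmod (fc phi l))"
      using mult_left_mono[OF q[of l], of "b * \<epsilon>"] l b0 \<epsilon> by (simp add: P_def)
    also have "\<dots> = \<epsilon> * q * cmod (a j l)" by (simp add: b_def a_def grad_def u_def norm_mult)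
    finally show "cmod (e j l) \<le> \<epsilon> * q * cmod (a j l)" .
  qed (use \<epsilon> q0 in simp)
  have "(m - \<epsilon> * (c + q * L2norm r * sqrt c)) * N j \<le> Re (Q1 j + Q2 j + Q3 j)" for j
  proof -
    have "- cmod (Q2 j) \<le> Re (Q2 j)" "- cmod (Q3 j) \<le> Re (Q3 j)"
      using abs_Re_le_cmod[of "Q2 j"] abs_Re_le_cmod[of "Q3 j"] by linarith+
    then show ?thesis using b1[of j] b2[of j] b3[of j] by (simp add: algebra_simps)
  qed
  then have "(\<Sum>j\<in>UNIV. (m - \<epsilon> * (c + q * L2norm r * sqrt c)) * N j) \<le> (\<Sum>j\<in>UNIV. Re (Q1 j + Q2 j + Q3 j))"
    by (intro sum_mono)
  moreover have "(\<Sum>j\<in>UNIV. N j) = (gradnorm P u)^2" unfolding gradnorm_power2_grad N_def a_def ..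
  ultimately have "(m - \<epsilon> * (c + q * L2norm r * sqrt c)) * (gradnorm P u)^2 \<le> Re (\<Sum>j\<in>UNIV. Q1 j + Q2 j + Q3 j)"
    by (simp add: sum_distrib_left[symmetric])
  then have "Re (\<Sum>k\<in>P. cnj (u k) * divc (drift r (pd H) r) k) \<le> - ((m - \<epsilon> * (c + q * L2norm r * sqrt c)) * (gradnorm P u)^2)"
    unfolding S by simp
  then show ?thesis unfolding u_def[symmetric] P_def[symmetric] c_def[symmetric] .
qed

section \<open>From growth in time to a lower bound in L^2\<close>

lemma integral_tm_ident: "0 \<le> t \<Longrightarrow> (\<integral>s. s \<partial>tm t) = t^2 / 2"
proof -
  assume t: "0 \<le> t"
  have "set_integrable lborel {0..t} (\<lambda>s::real. s)"
    by (rule borel_integrable_atLeastAtMost') (intro continuous_intros)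
  from set_borel_integral_eq_integral(2)[OF this] have "(LINT s:{0..t}|lborel. s) = integral {0..t} (\<lambda>s. s)" .
  also have "\<dots> = t^2 / 2" using ident_has_integral[OF t] by (simp add: integral_unique)
  finally show ?thesis unfolding set_integral_tm .
qed

text \<open>A bound at a single time says nothing about the L^2 norm in time, so the growth
  condition is integrated once more: the left side yields \<open>m * t0^2 / 2\<close>, and passing
  from the integral of \<open>n\<close> to its L^2 norm costs \<open>sqrt t0\<close>.\<close>

lemma smoothing_lower_bound:
  fixes n :: "real \<Rightarrow> real"
  assumes nm: "n \<in> borel_measurable (tm T)" and n0: "\<And>s. s \<in> {0..T} \<Longrightarrow> 0 \<le> n s" and nR: "\<And>s. s \<in> {0..T} \<Longrightarrow> n s \<le> R"
    and t0: "0 < t0" "t0 \<le> T" and c: "0 \<le> c"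
    and growth: "\<And>t. t \<in> {0..t0} \<Longrightarrow> m * t \<le> n t + c * (\<integral>s. n s \<partial>tm t)"
  shows "m * t0^2 / 2 \<le> (1 + c * t0) * sqrt t0 * sqrt (\<integral>s. (n s)^2 \<partial>tm T)"
proof -
  note [measurable] = measurable_tm_mono[OF nm t0(2)]
  have i: "integrable (tm t0) n"
    by (rule integrable_tm_bounded[where B = R]) (use n0 nR t0 in auto)
  have i2T: "integrable (tm T) (\<lambda>s. (n s)^2)"
  proof (rule integrable_tm_bounded)
    show "(\<lambda>s. (n s)^2) \<in> borel_measurable (tm T)" using nm by measurable
    fix s assume s: "s \<in> {0..T}"
    have "(n s)^2 \<le> R^2" by (intro power_mono nR n0 s)
    then show "norm ((n s)^2) \<le> R^2" by simp
  qed
  have i2: "integrable (tm t0) (\<lambda>s. (n s)^2)" by (rule integrable_tm_mono[OF i2T t0(2)])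
  define I where "I = (\<integral>s. n s \<partial>tm t0)"
  have I0: "0 \<le> I" unfolding I_def by (rule Bochner_Integration.integral_nonneg_AE) (use n0 t0 in \<open>auto intro!: AE_I2\<close>)
  have it: "integrable (tm t0) (\<lambda>t::real. t)"
    by (rule integrable_tm_bounded[where B = t0]) auto
  have g: "m * t \<le> n t + c * I" if t: "t \<in> {0..t0}" for t
  proof -
    have "(\<integral>s. n s \<partial>tm t) \<le> I" unfolding I_def by (rule integral_tm_mono[OF i]) (use t n0 t0 in auto)
    then show ?thesis using growth[OF t] mult_left_mono[of _ I c] c by (smt (verit))
  qed
  have "(\<integral>t. m * t \<partial>tm t0) \<le> (\<integral>t. n t + c * I \<partial>tm t0)"
    by (rule integral_mono) (use it i g in auto)
  then have "m * (t0^2 / 2) \<le> I + t0 * (c * I)"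
    using i t0 integral_tm_ident[of t0] measure_tm[of t0] by (simp add: I_def)
  also have "\<dots> = (1 + c * t0) * I" by (simp add: algebra_simps)
  also have "\<dots> \<le> (1 + c * t0) * (sqrt t0 * sqrt (\<integral>s. (n s)^2 \<partial>tm T))"
  proof (rule mult_left_mono)
    have "I^2 \<le> (\<integral>s. 1^2 \<partial>tm t0) * (\<integral>s. (n s)^2 \<partial>tm t0)"
      using integral_Cauchy_Schwarz_real(2)[of "\<lambda>_. 1" "tm t0" n] i2 by (simp add: I_def)
    also have "\<dots> = t0 * (\<integral>s. (n s)^2 \<partial>tm t0)" using measure_tm[of t0] t0 by simp
    also have "\<dots> \<le> t0 * (\<integral>s. (n s)^2 \<partial>tm T)"
      using t0 by (intro mult_left_mono integral_tm_mono[OF i2T]) auto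
    finally have "I \<le> sqrt (t0 * (\<integral>s. (n s)^2 \<partial>tm T))" by (rule real_le_rsqrt)
    then show "I \<le> sqrt t0 * sqrt (\<integral>s. (n s)^2 \<partial>tm T)" by (simp add: real_sqrt_mult)
  qed (use c t0 in simp)
  finally show ?thesis by (simp add: mult.assoc)
qed

lemma (in drift_field) divc_drift_integrable:
  assumes a: "regular T a" and b: "regular T b"
  shows "integrable (tm T) (\<lambda>s. divc (drift (a s) g (b s)) k)"
proof -
  obtain Ra where Ra: "0 < Ra" "\<And>t. t \<in> {0..T} \<Longrightarrow> L2norm (a t) \<le> Ra" using regular_bound[OF a] by blast
  obtain Rb where Rb: "0 < Rb" "\<And>t. t \<in> {0..T} \<Longrightarrow> L2norm (b t) \<le> Rb" using regular_bound[OF b] by blast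
  show ?thesis
  proof (rule integrable_tm_bounded[OF divc_drift_measurable[OF a b]])
    fix s assume s: "s \<in> {0..T}"
    show "cmod (divc (drift (a s) g (b s)) k) \<le> 2 * pi * norm (kvec k) * (real CARD('d) * (M * Ra * Rb))"
      by (rule order_trans[OF divc_drift_le[OF regularD(1)[OF a s] regularD(1)[OF b s]]])
        (use Ra(1) Ra(2)[OF s] Rb(1) Rb(2)[OF s] M0 in \<open>auto intro!: mult_left_mono mult_mono\<close>)
  qed
qed

lemma (in drift_field) lapc_integrable:
  assumes a: "regular T a" shows "integrable (tm T) (\<lambda>s. lapc (a s) k)"
proof -
  obtain R where R: "0 < R" "\<And>t. t \<in> {0..T} \<Longrightarrow> L2norm (a t) \<le> R" using regular_bound[OF a] by blast
  have [measurable]: "(\<lambda>s. fc (a s) k) \<in> borel_measurable (tm T)" using a by (simp add: regular_def)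
  have "integrable (tm T) (\<lambda>s. fc (a s) k)"
  proof (rule integrable_tm_bounded)
    fix s assume s: "s \<in> {0..T}"
    show "cmod (fc (a s) k) \<le> R" using regular_fc_le[OF regularD(1)[OF a s], of k] R(2)[OF s] by linarith
  qed measurable
  then show ?thesis unfolding lapc_eq by simp
qed

text \<open>\<open>B\<close> may depend on \<open>H\<close> and \<open>K\<close>: it is used for
  integrability of the source and does not reach the final constant.\<close>

lemma pd_bounded_kernel:
  assumes P: "finite P" and H: "\<And>x. of_real (H x) = (\<Sum>k\<in>P. h k * chr k x)"
  obtains B where "\<And>j. bounded_kernel (pd H j) B"
proof -
  define c where "c j k = 2 * pi * \<i> * of_int (k $ j) * h k" for j k
  define B where "B = (\<Sum>j\<in>UNIV. \<Sum>k\<in>P. cmod (c j k))"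
  have e: "complex_of_real (pd H j x) = (\<Sum>k\<in>P. c j k * chr k x)" for j x
    unfolding c_def by (rule pd_spectrum[OF P H])
  have "bounded_kernel (pd H j) B" for j
  proof
    have "pd H j = (\<lambda>x. Re (\<Sum>k\<in>P. c j k * chr k x))" unfolding e[symmetric] by simp
    also have "\<dots> \<in> borel_measurable borel" by measurable
    finally show "pd H j \<in> borel_measurable borel" .
    have "\<bar>pd H j x\<bar> \<le> B" for x
    proof -
      have "\<bar>pd H j x\<bar> = cmod (\<Sum>k\<in>P. c j k * chr k x)" unfolding e[symmetric] by simp
      also have "\<dots> \<le> (\<Sum>k\<in>P. cmod (c j k))" by (rule order_trans[OF norm_sum]) (simp add: norm_mult)
      also have "\<dots> \<le> B" unfolding B_def by (rule member_le_sum) (auto simp: sum_nonneg)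
      finally show ?thesis .
    qed
    then show "AE z in lborel. \<bar>pd H j z\<bar> \<le> B" by simp
    show "0 \<le> B" unfolding B_def by (simp add: sum_nonneg)
  qed
  then show thesis by (rule that)
qed

section \<open>Lower bound at a fixed cut-off\<close>

context aggregation
begin

definition "incr_const = 4 * pi^2 * A + 8 * pi * real CARD('d) * M * A^2"

lemma incr_const_nonneg: "0 \<le> incr_const"
  unfolding incr_const_def using A M0 by simp

text \<open>On the time scale \<open>K powr (- 4 * zeta / 3)\<close> the errors in \<open>source_lower_bound\<close> are of order one,
  since \<open>1 + d\<close> and \<open>1 + zeta + d / 2\<close> are at most \<open>4 * zeta / 3\<close>.\<close>

lemma source_error:
  assumes K: "1 \<le> K" and cs: "0 < cs" and zeta: "3 + 3 * real CARD('d) / 2 \<le> zeta"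
    and s: "0 \<le> s" "s \<le> c0 * K powr (- 4 * zeta / 3)"
    and r: "0 \<le> r" "r \<le> 2 * A"
  shows "s * (2 * K) * incr_const * (real (card (modes K :: (int^'d) set)) + K powr zeta / cs * r * sqrt (real (card (modes K :: (int^'d) set))))
    \<le> 2 * incr_const * 3 ^ CARD('d) * (1 + 2 * A / cs) * c0"
proof -
  define d where "d = real CARD('d)"
  define c where "c = real (card (modes K :: (int^'d) set))"
  define E where "E = K powr (4 * zeta / 3)"
  have d1: "0 \<le> d" by (simp add: d_def)
  have E: "0 < E" using K by (simp add: E_def)
  have c0: "0 \<le> c" by (simp add: c_def)
  have t3: "(1::real) \<le> 3 ^ CARD('d)" by simp
  have cle: "c \<le> 3 ^ CARD('d) * K powr d" unfolding c_def d_def by (rule card_modes[OF K])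
  \<comment> \<open>The prefactor is enlarged from the root of \<open>3 ^ d\<close> to
    \<open>3 ^ d\<close>, so that it can be taken out together with the one in
    \<open>cle\<close>.\<close>
  have sc: "sqrt c \<le> 3 ^ CARD('d) * K powr (d / 2)"
  proof (rule real_le_lsqrt)
    have "c \<le> 3 ^ CARD('d) * K powr d" by (rule cle)
    also have "\<dots> \<le> (3 ^ CARD('d))^2 * (K powr (d / 2))^2"
    proof (rule mult_mono)
      show "(3::real) ^ CARD('d) \<le> (3 ^ CARD('d))^2" using t3 by (simp add: power2_eq_square)
      have "(K powr (d / 2))^2 = K powr d" using K by (simp add: power2_eq_square powr_add[symmetric])
      then show "K powr d \<le> (K powr (d / 2))^2" by simp
    qed auto
    finally show "c \<le> (3 ^ CARD('d) * K powr (d / 2))^2" by (simp add: power_mult_distrib)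
  qed simp
  have p1: "K * K powr d \<le> E"
  proof -
    have "K * K powr d = K powr (1 + d)" using K by (simp add: powr_add)
    also have "\<dots> \<le> E" unfolding E_def using K zeta d1 by (intro powr_mono) (auto simp: d_def[symmetric])
    finally show ?thesis .
  qed
  have p2: "K * (K powr zeta * K powr (d / 2)) \<le> E"
  proof -
    have "K * (K powr zeta * K powr (d / 2)) = K powr (1 + (zeta + d / 2))" using K by (simp add: powr_add)
    also have "\<dots> \<le> E" unfolding E_def using K zeta by (intro powr_mono) (auto simp: d_def[symmetric])
    finally show ?thesis .
  qed
  have "K powr zeta / cs * r * sqrt c \<le> K powr zeta / cs * (2 * A) * (3 ^ CARD('d) * K powr (d / 2))"
    using r sc cs K c0 A by (intro mult_mono mult_left_mono) auto
  then have "K * (c + K powr zeta / cs * r * sqrt c) \<le> K * (3 ^ CARD('d) * K powr d + K powr zeta / cs * (2 * A) * (3 ^ CARD('d) * K powr (d / 2)))"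
    using cle K by (intro mult_left_mono add_mono) auto
  also have "\<dots> = 3 ^ CARD('d) * (K * K powr d + 2 * A / cs * (K * (K powr zeta * K powr (d / 2))))"
    by (simp add: algebra_simps)
  also have "\<dots> \<le> 3 ^ CARD('d) * (E + 2 * A / cs * E)"
    using p1 p2 A cs by (intro mult_left_mono add_mono) auto
  finally have 1: "K * (c + K powr zeta / cs * r * sqrt c) \<le> 3 ^ CARD('d) * (1 + 2 * A / cs) * E"
    by (simp add: algebra_simps)
  have sE: "s * E \<le> c0"
  proof -
    have "s * E \<le> c0 * K powr (- 4 * zeta / 3) * E" using s(2) E by (intro mult_right_mono) auto
    also have "\<dots> = c0" using K by (simp add: E_def powr_add[symmetric] mult.assoc)
    finally show ?thesis .
  qed
  have "s * (2 * K) * incr_const * (c + K powr zeta / cs * r * sqrt c) = 2 * incr_const * s * (K * (c + K powr zeta / cs * r * sqrt c))"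
    by (simp add: mult_ac)
  also have "\<dots> \<le> 2 * incr_const * s * (3 ^ CARD('d) * (1 + 2 * A / cs) * E)"
    using 1 s incr_const_nonneg by (intro mult_left_mono) auto
  also have "\<dots> = 2 * incr_const * 3 ^ CARD('d) * (1 + 2 * A / cs) * (s * E)" by (simp add: mult_ac)
  also have "\<dots> \<le> 2 * incr_const * 3 ^ CARD('d) * (1 + 2 * A / cs) * c0"
    using sE incr_const_nonneg A cs by (intro mult_left_mono) auto
  finally show ?thesis unfolding c_def .
qed

lemma phi_modes_lower:
  assumes K: "1 \<le> K" and cs: "0 < cs" and zeta: "0 \<le> zeta" and k: "k \<in> modes K"
    and decay: "\<And>k. k \<noteq> 0 \<Longrightarrow> cs * norm (kvec k) powr (- zeta) \<le> cmod (fc phi k)"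
  shows "cs * K powr (- zeta) \<le> cmod (fc phi k)"
proof -
  have k': "k \<noteq> 0" "norm (kvec k) \<le> K" using k by (auto simp: modes_def)
  have "K powr (- zeta) \<le> norm (kvec k) powr (- zeta)"
    using norm_kvec_ge_1[OF k'(1)] k'(2) zeta by (intro powr_mono2') auto
  then show ?thesis using decay[OF k'(1)] cs mult_left_mono[of "K powr (- zeta)" "norm (kvec k) powr (- zeta)" cs] by linarith
qed

text \<open>\<open>c0\<close> is the part of the time scale that does not see \<open>K\<close>. Its
  conditions keep \<open>t0\<close> within the time interval and within the range of
  \<open>rho_bound\<close>, and let the source lose at most half of \<open>pm\<close>.\<close>

lemma linearised_lower_bound:
  fixes H :: "real^'d \<Rightarrow> real"
  assumes v: "lin_sol T beta rho g (pd H) v" and K: "1 \<le> K"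
    and H: "\<And>x. of_real (H x) = (\<Sum>k\<in>modes K. h k * chr k x)"
    and pm: "0 < pm" "\<And>x. pm \<le> phi x" and cs: "0 < cs" and zeta: "3 + 3 * real CARD('d) / 2 \<le> zeta"
    and decay: "\<And>k. k \<noteq> 0 \<Longrightarrow> cs * norm (kvec k) powr (- zeta) \<le> cmod (fc phi k)"
    and c0: "0 < c0" "c0 \<le> T" "16 * A^2 * (real CARD('d) * M^2) * c0 \<le> 1"
      "2 * incr_const * 3 ^ CARD('d) * (1 + 2 * A / cs) * c0 \<le> pm / 2"
  shows "pm * c0 powr (3 / 2) * cs / (4 * (1 + (2 * pi + 4 * sqrt (real CARD('d)) * M * A) * c0)) * K powr (- 3 * zeta) * L2norm H \<le> L2L2 T v"
proof -
  define P where "P = (modes K :: (int^'d) set)"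
  have P: "finite P" unfolding P_def by (rule finite_modes[OF K])
  define u where "u k = h k * fc phi k" for k
  define X where "X = gradnorm P u"
  define n where "n s = L2norm (v s)" for s
  define e where "e = K powr (- 4 * zeta / 3)"
  define t0 where "t0 = c0 * e"
  define C1 where "C1 = 2 * pi * K + 4 * sqrt (real CARD('d)) * M * A"
  have zeta0: "3 \<le> zeta" using zeta by (smt (verit) divide_nonneg_nonneg of_nat_0_le_iff)
  have e: "0 < e" "e \<le> 1" "K * e \<le> 1"
  proof -
    show "0 < e" using K by (simp add: e_def)
    have "e \<le> K powr 0" unfolding e_def using K zeta0 by (intro powr_mono) auto
    then show "e \<le> 1" using K by simp
    have "K * e = K powr (1 + (- 4 * zeta / 3))" unfolding e_def powr_add using K by simp
    also have "\<dots> \<le> K powr 0" using K zeta0 by (intro powr_mono) auto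
    finally show "K * e \<le> 1" using K by simp
  qed
  have t0: "0 < t0" "t0 \<le> c0" "t0 \<le> T"
    using c0 e by (auto simp: t0_def mult_le_cancel_left1 intro: order_trans[OF _ c0(2)])
  have X0: "0 \<le> X" by (simp add: X_def)
  have C1: "0 \<le> C1" unfolding C1_def using K M0 A by simp
  have n0: "0 \<le> n s" for s by (simp add: n_def)
  have vn: "regular T v" using v unfolding lin_sol_def by (intro in_F_regular[OF T beta(1)]) blast
  obtain R where R: "0 < R" "\<And>t. t \<in> {0..T} \<Longrightarrow> n t \<le> R" unfolding n_def using regular_bound[OF vn] by blast
  obtain B where B: "\<And>j. bounded_kernel (pd H j) B" using pd_bounded_kernel[OF finite_modes[OF K] H] by blast
  interpret DH: drift_field "pd H" B T by (rule drift_field.intro[OF B T])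
  define L where "L k s = lapc (v s) k + divc (drift (v s) g (rho s)) k + divc (drift (rho s) g (v s)) k
    + divc (drift (rho s) (pd H) (rho s)) k" for k s
  have Li: "integrable (tm T) (L k)" for k
    unfolding L_def by (intro Bochner_Integration.integrable_add lapc_integrable divc_drift_integrable DH.divc_drift_integrable rho_regular vn)
  have veq: "fc (v t) k = (\<integral>s. L k s \<partial>tm t)" if "t \<in> {0..T}" for t k
    using v that unfolding lin_sol_def set_integral_tm L_def by blast
  have nm: "n \<in> borel_measurable (tm T)" unfolding n_def by (rule regular_L2norm_measurable(2)[OF vn])
  have ni: "integrable (tm T) n"
    by (rule integrable_tm_bounded[where B = R]) (use nm n0 R in auto)
  \<comment> \<open>This bounds the rate of change of the pairing of \<open>v\<close> with
    \<open>u\<close>. The main term is negative because the divergence is integrated by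
    parts.\<close>
  have pw: "Re (\<Sum>k\<in>P. cnj (u k) * L k s) \<le> - (pm / 2 * X^2) + C1 * X * n s" if s: "s \<in> {0..t0}" for s
  proof -
    have sT: "s \<in> {0..T}" using s t0 by auto
    have "16 * A^2 * (real CARD('d) * M^2) * s \<le> 16 * A^2 * (real CARD('d) * M^2) * c0"
      using s t0 by (intro mult_left_mono) auto
    then have sA: "16 * A^2 * (real CARD('d) * M^2) * s \<le> 1" using c0(3) by linarith
    have r: "L2norm (rho s) \<le> 2 * A" by (rule rho_bound[OF sT sA])
    note Lv = regularD(1)[OF vn sT] and Lr = regularD(1)[OF rho_regular sT]
    define S1 where "S1 = (\<Sum>k\<in>P. cnj (u k) * lapc (v s) k)"
    define S2 where "S2 = (\<Sum>k\<in>P. cnj (u k) * divc (drift (v s) g (rho s)) k)"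
    define S3 where "S3 = (\<Sum>k\<in>P. cnj (u k) * divc (drift (rho s) g (v s)) k)"
    define S4 where "S4 = (\<Sum>k\<in>P. cnj (u k) * divc (drift (rho s) (pd H) (rho s)) k)"
    have S: "(\<Sum>k\<in>P. cnj (u k) * L k s) = S1 + S2 + S3 + S4"
      unfolding L_def S1_def S2_def S3_def S4_def by (simp add: distrib_left sum.distrib)
    have "cmod S1 \<le> 2 * pi * K * X * n s"
      unfolding S1_def X_def n_def P_def by (rule sum_lapc_le[OF K Lv])
    moreover have "cmod S2 \<le> 2 * sqrt (real CARD('d)) * M * A * X * n s"
    proof -
      have "cmod S2 \<le> X * (sqrt (real CARD('d)) * M * n s * L2norm (rho s))"
        unfolding S2_def X_def n_def by (rule sum_divc_drift_le[OF P Lv Lr])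
      also have "\<dots> \<le> X * (sqrt (real CARD('d)) * M * n s * (2 * A))"
        using r X0 M0 n0[of s] by (intro mult_left_mono) auto
      finally show ?thesis by (simp add: mult_ac)
    qed
    moreover have "cmod S3 \<le> 2 * sqrt (real CARD('d)) * M * A * X * n s"
    proof -
      have "cmod S3 \<le> X * (sqrt (real CARD('d)) * M * L2norm (rho s) * n s)"
        unfolding S3_def X_def n_def by (rule sum_divc_drift_le[OF P Lr Lv])
      also have "\<dots> \<le> X * (sqrt (real CARD('d)) * M * (2 * A) * n s)"
        using r X0 M0 n0[of s] by (intro mult_left_mono mult_right_mono) auto
      finally show ?thesis by (simp add: mult_ac)
    qed
    moreover have "Re S4 \<le> - (pm / 2 * X^2)"
    proof -
      define \<epsilon> where "\<epsilon> = s * (2 * K) * incr_const"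
      define q where "q = K powr zeta / cs"
      define err where "err = \<epsilon> * (real (card P) + q * L2norm (rho s) * sqrt (real (card P)))"
      have "Re S4 \<le> - ((pm - err) * X^2)"
        unfolding S4_def u_def X_def P_def err_def
      proof (rule source_lower_bound[OF K H Lr])
        show "L2cube phi" using phi by (simp add: sob_mem_def)
        show "cmod (fc (rho s) k - fc phi k) \<le> \<epsilon>" if "norm (kvec k) \<le> 2 * K" for k
          unfolding \<epsilon>_def incr_const_def by (rule mode_increment[OF sT sA that]) (use K in simp)
        show "0 \<le> \<epsilon>" unfolding \<epsilon>_def using s K incr_const_nonneg by simp
        show "0 \<le> q" unfolding q_def using cs by simp
        show "1 \<le> q * cmod (fc phi k)" if k: "k \<in> modes K" for k
        proof -
          have "1 = q * (cs * K powr (- zeta))" unfolding q_def using K cs by (simp add: powr_minus field_simps)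
          also have "\<dots> \<le> q * cmod (fc phi k)"
            by (rule mult_left_mono[OF phi_modes_lower[OF K cs _ k decay]]) (use zeta0 cs in \<open>auto simp: q_def\<close>)
          finally show ?thesis .
        qed
      qed (use pm in auto)
      moreover have "err \<le> pm / 2"
      proof -
        have "err \<le> 2 * incr_const * 3 ^ CARD('d) * (1 + 2 * A / cs) * c0"
          unfolding err_def \<epsilon>_def q_def P_def
          by (rule source_error[OF K cs zeta]) (use s r in \<open>auto simp: t0_def e_def\<close>)
        then show ?thesis using c0(4) by linarith
      qed
      ultimately show ?thesis using mult_right_mono[of "pm / 2" "pm - err" "X^2"] by simp
    qed
    moreover have "C1 * X * n s = 2 * pi * K * X * n s + 2 * (2 * sqrt (real CARD('d)) * M * A * X * n s)"
      by (simp add: C1_def algebra_simps)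
    ultimately show ?thesis unfolding S
      using complex_Re_le_cmod[of S1] complex_Re_le_cmod[of S2] complex_Re_le_cmod[of S3] by simp
  qed
  \<comment> \<open>Integrated from the initial value 0, the pairing is bounded in modulus by
    \<open>X * n t\<close> through Cauchy-Schwarz and \<open>sum_modes_le\<close>. One factor
    \<open>X\<close> is then common to both sides and is cancelled below when it is nonzero.\<close>
  have growth: "pm / 2 * X^2 * t \<le> X * n t + C1 * X * (\<integral>s. n s \<partial>tm t)" if t: "t \<in> {0..t0}" for t
  proof -
    have tT: "t \<in> {0..T}" "t \<le> T" using t t0 by auto
    define y where "y = (\<Sum>k\<in>P. cnj (u k) * fc (v t) k)"
    have Lt: "integrable (tm t) (L k)" for k by (rule integrable_tm_mono[OF Li tT(2)])
    have int: "integrable (tm t) (\<lambda>s. \<Sum>k\<in>P. cnj (u k) * L k s)" using Lt by auto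
    have "y = (\<integral>s. (\<Sum>k\<in>P. cnj (u k) * L k s) \<partial>tm t)"
      unfolding y_def veq[OF tT(1)] using Lt by simp
    then have "Re y = (\<integral>s. Re (\<Sum>k\<in>P. cnj (u k) * L k s) \<partial>tm t)" using integral_Re[OF int] by simp
    also have "\<dots> \<le> (\<integral>s. - (pm / 2 * X^2) + C1 * X * n s \<partial>tm t)"
    proof (rule integral_mono)
      show "integrable (tm t) (\<lambda>s. Re (\<Sum>k\<in>P. cnj (u k) * L k s))" by (rule integrable_Re[OF int])
      show "integrable (tm t) (\<lambda>s. - (pm / 2 * X^2) + C1 * X * n s)" using integrable_tm_mono[OF ni tT(2)] by simp
      show "Re (\<Sum>k\<in>P. cnj (u k) * L k s) \<le> - (pm / 2 * X^2) + C1 * X * n s" if "s \<in> space (tm t)" for s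
        using that t by (intro pw) auto
    qed
    also have "\<dots> = - (pm / 2 * X^2 * t) + C1 * X * (\<integral>s. n s \<partial>tm t)"
      using integrable_tm_mono[OF ni tT(2)] measure_tm[of t] t
      by (subst Bochner_Integration.integral_add) (auto simp: mult.commute)
    finally have 1: "Re y \<le> - (pm / 2 * X^2 * t) + C1 * X * (\<integral>s. n s \<partial>tm t)" .
    have "cmod y \<le> sqrt (\<Sum>k\<in>P. (cmod (cnj (u k)))^2) * sqrt (\<Sum>k\<in>P. (cmod (fc (v t) k))^2)"
      unfolding y_def by (rule complex_Cauchy_Schwarz_sum)
    also have "\<dots> \<le> X * n t"
    proof (rule mult_mono)
      show "sqrt (\<Sum>k\<in>P. (cmod (cnj (u k)))^2) \<le> X" using sum_modes_le[OF K, of u] by (simp add: X_def P_def)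
      show "sqrt (\<Sum>k\<in>P. (cmod (fc (v t) k))^2) \<le> n t"
        unfolding n_def by (rule real_le_lsqrt[OF L2norm_nonneg bessel[OF P regularD(1)[OF vn tT(1)]]])
    qed (auto simp: X0 sum_nonneg)
    finally show ?thesis using 1 abs_Re_le_cmod[of y] by linarith
  qed
  have L2: "L2L2 T v = sqrt (\<integral>s. (n s)^2 \<partial>tm T)" unfolding L2L2_def set_integral_tm n_def ..
  have L20: "0 \<le> L2L2 T v" unfolding L2 by simp
  define C1' where "C1' = 2 * pi + 4 * sqrt (real CARD('d)) * M * A"
  have C1': "0 \<le> C1'" unfolding C1'_def using M0 A by simp
  \<comment> \<open>\<open>C1\<close> grows like \<open>K\<close>, but \<open>K * e \<le> 1\<close>
    keeps its product with \<open>t0\<close> bounded, so the terms containing \<open>v\<close> do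
    not worsen the power of \<open>K\<close>.\<close>
  have C1t: "C1 * t0 \<le> C1' * c0"
  proof -
    have "C1 * t0 = c0 * (2 * pi * (K * e) + 4 * sqrt (real CARD('d)) * M * A * e)" by (simp add: C1_def t0_def algebra_simps)
    also have "\<dots> \<le> c0 * (2 * pi * 1 + 4 * sqrt (real CARD('d)) * M * A * 1)"
      using e c0(1) M0 A by (intro mult_left_mono add_mono) auto
    finally show ?thesis by (simp add: C1'_def mult.commute)
  qed
  have key: "pm * X * t0 powr (3 / 2) / 4 \<le> (1 + C1' * c0) * L2L2 T v"
  proof (cases "X = 0")
    case True then show ?thesis using C1' c0(1) L20 by simp
  next
    case False
    then have Xp: "0 < X" using X0 by simp
    have "pm / 2 * X * t0^2 / 2 \<le> (1 + C1 * t0) * sqrt t0 * sqrt (\<integral>s. (n s)^2 \<partial>tm T)"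
    proof (rule smoothing_lower_bound[OF nm n0 R(2) t0(1) t0(3) C1])
      fix t assume t: "t \<in> {0..t0}"
      have "X * (pm / 2 * X * t) \<le> X * (n t + C1 * (\<integral>s. n s \<partial>tm t))"
        using growth[OF t] by (simp add: power2_eq_square algebra_simps)
      then show "pm / 2 * X * t \<le> n t + C1 * (\<integral>s. n s \<partial>tm t)" using Xp by (simp only: mult_le_cancel_left_pos)
    qed
    also have "\<dots> \<le> (1 + C1' * c0) * sqrt t0 * L2L2 T v"
      unfolding L2[symmetric] using C1t L20 t0(1) by (intro mult_right_mono) auto
    finally have s1: "pm / 2 * X * t0^2 / 2 \<le> (1 + C1' * c0) * sqrt t0 * L2L2 T v" .
    \<comment> \<open>Cancelling \<open>sqrt t0\<close> from \<open>t0^2\<close> leaves the power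
      3/2, which turns K^(- 4 zeta / 3) into K^(- 2 zeta).\<close>
    have sq: "sqrt t0 * t0 powr (3 / 2) = t0^2"
    proof -
      have "sqrt t0 * t0 powr (3 / 2) = t0 powr (1 / 2 + 3 / 2)" unfolding powr_add using t0(1) by (simp add: powr_half_sqrt)
      also have "\<dots> = t0^2" using t0(1) by (simp add: powr_numeral)
      finally show ?thesis .
    qed
    have "sqrt t0 * (pm * X * t0 powr (3 / 2) / 4) = pm * X * (sqrt t0 * t0 powr (3 / 2)) / 4" by simp
    also have "\<dots> = pm / 2 * X * t0^2 / 2" unfolding sq by simp
    also note s1
    also have "(1 + C1' * c0) * sqrt t0 * L2L2 T v = sqrt t0 * ((1 + C1' * c0) * L2L2 T v)" by (simp only: mult_ac)
    finally show ?thesis by (rule mult_left_le_imp_le) (use t0(1) in simp)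
  qed
  have tp: "t0 powr (3 / 2) = c0 powr (3 / 2) * K powr (- 2 * zeta)"
    using c0(1) K by (simp add: t0_def e_def powr_mult powr_powr)
  have XH: "cs * K powr (- zeta) * L2norm H \<le> X"
  proof -
    have "(cs * K powr (- zeta) * L2norm H)^2 = (\<Sum>k\<in>P. (cs * K powr (- zeta))^2 * (cmod (h k))^2)"
      unfolding power_mult_distrib[of _ "L2norm H"] L2norm_spectrum[OF finite_modes[OF K] H] P_def sum_distrib_left ..
    also have "\<dots> \<le> (\<Sum>k\<in>P. (cmod (u k))^2)"
    proof (rule sum_mono)
      fix k assume k: "k \<in> P"
      have "(cs * K powr (- zeta))^2 \<le> (cmod (fc phi k))^2"
        by (rule power_mono[OF phi_modes_lower[OF K cs _ _ decay]]) (use k zeta0 cs in \<open>auto simp: P_def\<close>)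
      then show "(cs * K powr (- zeta))^2 * (cmod (h k))^2 \<le> (cmod (u k))^2"
        by (simp add: u_def norm_mult power_mult_distrib mult.commute[of "(cmod (h k))^2"] mult_right_mono)
    qed
    finally have "cs * K powr (- zeta) * L2norm H \<le> sqrt (\<Sum>k\<in>P. (cmod (u k))^2)" by (rule real_le_rsqrt)
    also have "\<dots> \<le> X" unfolding X_def P_def by (rule sum_modes_le[OF K])
    finally show ?thesis .
  qed
  have D: "0 < 4 * (1 + C1' * c0)" using C1' c0(1) by (simp add: add_pos_nonneg)
  have "pm * c0 powr (3 / 2) * K powr (- 2 * zeta) * (cs * K powr (- zeta) * L2norm H) \<le> pm * c0 powr (3 / 2) * K powr (- 2 * zeta) * X"
    using XH pm(1) by (intro mult_left_mono) auto
  also have "\<dots> \<le> 4 * (1 + C1' * c0) * L2L2 T v" using key unfolding tp by (simp add: mult_ac)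
  finally have F: "pm * c0 powr (3 / 2) * K powr (- 2 * zeta) * (cs * K powr (- zeta) * L2norm H) \<le> 4 * (1 + C1' * c0) * L2L2 T v" .
  have "K powr (- 3 * zeta) = K powr (- 2 * zeta) * K powr (- zeta)" unfolding powr_add[symmetric] by simp
  then have "pm * c0 powr (3 / 2) * cs / (4 * (1 + C1' * c0)) * K powr (- 3 * zeta) * L2norm H
     = (pm * c0 powr (3 / 2) * K powr (- 2 * zeta) * (cs * K powr (- zeta) * L2norm H)) / (4 * (1 + C1' * c0))"
    by (simp add: mult_ac)
  also have "\<dots> \<le> L2L2 T v" using F D by (simp only: pos_divide_le_eq mult.commute)
  finally show ?thesis unfolding C1'_def .
qed

end

section \<open>Choice of the constants\<close>

theorem theorem2p9:
  fixes T M cst phimin Phi :: real and beta :: nat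
  assumes "T > 0" and "M > 0"
  shows "\<exists>C>0. \<forall>(phi::real^'d \<Rightarrow> real) zeta.
     A1 beta phi \<and> A2 beta phi phimin cst zeta \<and> sqrt (sob_norm2 (real beta) phi) \<le> Phi \<longrightarrow>
     (\<forall>W g h B. W2inf W g h B \<and> B < M \<and> fc W 0 = 0 \<longrightarrow>
       (\<forall>K\<ge>1. \<forall>H\<in>EK K. \<forall>rho v.
          agg_sol T beta phi g rho \<and> lin_sol T beta rho g (pd H) v \<longrightarrow>
          L2L2 T v \<ge> C * K powr (- 3 * zeta) * L2norm H))"
proof (cases "phimin > 0 \<and> cst > 0")
  case False
  \<comment> \<open>\<open>phimin\<close> and \<open>cst\<close> are fixed before (A2) is assumed;
    if one of them is not positive, the claim is vacuous.\<close>
  then have "\<not> A2 beta phi phimin cst zeta" for phi :: "real^'d \<Rightarrow> real" and zeta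
    unfolding A2_def by blast
  then show ?thesis by (intro exI[of _ 1]) auto
next
  case True
  \<comment> \<open>The maximum with 1 makes \<open>A\<close> positive whatever the sign of
    \<open>Phi\<close>. Using this bound in place of the norm of \<open>phi\<close> lets the
    constants be chosen before \<open>phi\<close>.\<close>
  define A where "A = max Phi 1"
  define d where "d = real CARD('d)"
  define incr_c where "incr_c = 4 * pi^2 * A + 8 * pi * d * M * A^2"
  define C2 where "C2 = 2 * incr_c * 3 ^ CARD('d) * (1 + 2 * A / cst)"
  \<comment> \<open>The three entries keep \<open>c0\<close> within the time interval, within the
    range of \<open>rho_bound\<close>, and below the threshold for the source error; with the added
    1, nonnegativity of the other terms gives positive denominators. Nothing depends on
    \<open>zeta\<close>, \<open>phi\<close> or \<open>K\<close>, as the order of quantifiers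
    demands.\<close>
  define c0 where "c0 = min T (min (1 / (16 * A^2 * (d * M^2) + 1)) (phimin / (2 * (C2 + 1))))"
  define C where "C = phimin * c0 powr (3 / 2) * cst / (4 * (1 + (2 * pi + 4 * sqrt d * M * A) * c0))"
  have A: "1 \<le> A" by (simp add: A_def)
  have d: "0 \<le> d" by (simp add: d_def)
  have incr_c: "0 \<le> incr_c" unfolding incr_c_def using A d assms by simp
  have C2: "0 \<le> C2" unfolding C2_def using incr_c A True by simp
  have D: "0 \<le> 16 * A^2 * (d * M^2)" using d by simp
  have c0: "0 < c0" unfolding c0_def using assms True C2 D by (simp add: add_nonneg_pos)
  have c0T: "c0 \<le> T" by (simp add: c0_def)
  have c0A: "16 * A^2 * (d * M^2) * c0 \<le> 1"
  proof -
    have "c0 \<le> 1 / (16 * A^2 * (d * M^2) + 1)" by (simp add: c0_def)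
    then have "(16 * A^2 * (d * M^2) + 1) * c0 \<le> 1" using D by (simp add: pos_le_divide_eq mult.commute add_nonneg_pos)
    then show ?thesis using c0 by (simp add: distrib_right)
  qed
  have c0p: "C2 * c0 \<le> phimin / 2"
  proof -
    have "c0 \<le> phimin / (2 * (C2 + 1))" by (simp add: c0_def)
    then have "(C2 + 1) * c0 \<le> phimin / 2" using C2 by (simp add: field_simps)
    then show ?thesis using c0 by (simp add: distrib_right)
  qed
  have C: "0 < C" unfolding C_def using True c0 A d assms
    by (intro divide_pos_pos mult_pos_pos add_pos_nonneg) auto
  show ?thesis
  proof (intro exI[of _ C] conjI C allI impI ballI)
    fix phi :: "real^'d \<Rightarrow> real" and zeta :: real and W g h B K H rho v
    assume a: "A1 beta phi \<and> A2 beta phi phimin cst zeta \<and> sqrt (sob_norm2 (real beta) phi) \<le> Phi"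
      and w: "W2inf W g h B \<and> B < M \<and> fc W 0 = 0" and K: "1 \<le> K" and H: "H \<in> EK K"
      and s: "agg_sol T beta phi g rho \<and> lin_sol T beta rho g (pd H) v"
    have beta3: "beta \<ge> 3 + CARD('d)" using a by (simp add: A1_def)
    obtain hh where hh: "\<And>x. complex_of_real (H x) = (\<Sum>k\<in>modes K. hh k * chr k x)"
      using EK_spectrum[OF K H] by blast
    have kernel: "bounded_kernel (g j) M" for j
    proof
      show "g j \<in> borel_measurable borel" using w by (simp add: W2inf_def)
      have "AE x in lborel. x \<in> unit_cube \<longrightarrow> \<bar>g j x\<bar> \<le> M"
        using w unfolding W2inf_def by (auto elim!: eventually_mono intro: order_trans[OF _ less_imp_le])
      then show "AE z in lborel. \<bar>g j z\<bar> \<le> M" using w by (intro periodic1_AE) (auto simp: W2inf_def)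
    qed (use assms in simp)
    have sob: "sob_norm2 (real beta) phi \<le> A^2"
    proof -
      have "sqrt (sob_norm2 (real beta) phi) \<le> Phi" using a by blast
      also have "\<dots> \<le> A" by (simp add: A_def)
      finally show ?thesis using sqrt_le_D by blast
    qed
    interpret aggregation g M T beta phi rho A
      by (intro aggregation.intro drift_field.intro aggregation_axioms.intro kernel)
        (use assms beta3 s a sob A in \<open>auto simp: A1_def\<close>)
    have "phimin * c0 powr (3 / 2) * cst / (4 * (1 + (2 * pi + 4 * sqrt (real CARD('d)) * M * A) * c0)) * K powr (- 3 * zeta) * L2norm H \<le> L2L2 T v"
    proof (rule linearised_lower_bound[OF _ K hh])
      show "lin_sol T beta rho g (pd H) v" using s by blast
      show "3 + 3 * real CARD('d) / 2 \<le> zeta" 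
      proof -
        \<comment> \<open>Here the decay exponent and \<open>beta \<ge> 3 + d\<close> combine to the
          room needed by \<open>source_error\<close>.\<close>
        have "real beta + real CARD('d) / 2 < zeta" using a by (simp add: A2_def)
        moreover have "3 + real CARD('d) \<le> real beta" using beta3 by linarith
        ultimately show ?thesis by linarith
      qed
      show "2 * incr_const * 3 ^ CARD('d) * (1 + 2 * A / cst) * c0 \<le> phimin / 2"
        using c0p unfolding C2_def incr_c_def incr_const_def d_def .
    qed (use True a c0 c0T c0A in \<open>auto simp: A2_def d_def\<close>)
    then show "C * K powr (- 3 * zeta) * L2norm H \<le> L2L2 T v" unfolding C_def d_def .
  qed
qed

end
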